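(* Let $s=|\sigma_0|^2$ be a random variable with values in $(0,\infty)$ and prior distribution $\pi$, and let $\mu=\mu(\sigma)$ be, conditionally on $s$, an Itô measure on $\mathbb{R}$ with constant variance function $|\sigma(x)|^2=s$ for all $x\in\mathbb{R}$. Let $\epsilon_1,\epsilon_2\in\mathscr{S}'(\mathbb{R})$ be (deterministic) admissible transmitted waveforms, and let $$z_1=\epsilon_1*\mu(\sigma)+\xi_1,\qquad z_2=\epsilon_2*\mu(\sigma)+\xi_2,$$ where $\xi_1$ and $\xi_2$ are identically distributed complex Gaussian $\mathscr{S}'(\mathbb{R})$-valued random objects, each of which is independent of $(s,\mu)$. If the moduli of the Fourier transforms of the transmitted waveforms coincide, i.e. $|\widehat{\epsilon}_1|=|\widehat{\epsilon}_2|$ as Schwartz distributions, then the posterior variances of $|\sigma_0|^2$ given $z_1$ and given $z_2$ are equal: $$\mathrm{var}(|\sigma_0|^2\mid z_1)=\mathrm{var}(|\sigma_0|^2\mid z_2),$$ where the equality is between functions of the observed data, that is, $\mathrm{var}(|\sigma_0|^2\mid z_1=y)=\mathrm{var}(|\sigma_0|^2\mid z_2=y)$ for almost every $y\in\mathscr{S}'(\mathbb{R})$, with respect to the law of $z_1$ as well as with respect to the law of $z_2$.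
   Context: $\mathscr{S}(\mathbb{R})$ is the space of complex-valued Schwartz functions and $\mathscr{S}'(\mathbb{R})$ the space of tempered distributions with its Borel $\sigma$-algebra; $\widehat{\cdot}$ denotes the Fourier transform. Complex Gaussian: a family of complex random variables is centered complex Gaussian if all its finite subfamilies are of the form $AY$ with $A$ a complex matrix and $Y$ a vector of independent complex Gaussian variables whose real and imaginary parts are independent centered real Gaussians with equal variance (so it is circularly symmetric). Complex Gaussian means centered complex Gaussian plus a deterministic mean. A random object $\xi$ in $\mathscr{S}'(\mathbb{R})$ is complex Gaussian if the family $(\xi(\phi))_{\phi\in\mathscr{S}(\mathbb{R})}$ is complex Gaussian. Itô measure with constant variance: an Itô measure on $\mathbb{R}$ with variance function $|\sigma(x)|^2$ is a centered complex Gaussian random measure $\mu$ with $\mathbb{E}[\mu(B_1)\overline{\mu(B_2)}]=X(B_1\cap B_2)$ for bounded Borel sets $B_1,B_2$, where the structure measure is $X(B)=\int_B|\sigma(x)|^2\,dx$. When $|\sigma(x)|^2=s$ is constant, $\mu$ extends by isometry to a centered complex Gaussian family $(\mu(f))_{f\in L^2(\mathbb{R};\mathbb{C})}$, linear in $f$, with $\mathbb{E}[\mu(f)\overline{\mu(g)}]=s\int_{\mathbb{R}}f\,\overline{g}\,dx$. "Conditionally on $s$" means that the conditional distribution of $\mu$ given $s$ is this Gaussian law. Admissible waveform: $\epsilon\in\mathscr{S}'(\mathbb{R})$ is admissible if $\widehat{\epsilon}$ is a locally integrable function and $\int_{\mathbb{R}}|\widehat{\epsilon}|^2|\widehat{\phi}|^2\,dx<\infty$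 for every $\phi\in\mathscr{S}(\mathbb{R})$. Then $\epsilon*\mu$ is the $\mathscr{S}'(\mathbb{R})$-valued random object given by $(\epsilon*\mu)(\phi)=\mu(\check{\epsilon}*\phi)$ for $\phi\in\mathscr{S}(\mathbb{R})$, where $\check{\epsilon}$ is the reflection of $\epsilon$ ($\check\epsilon(x)=\epsilon(-x)$ in the distributional sense), and $\check\epsilon*\phi\in L^2(\mathbb{R})$. Posterior: the posterior distribution of $|\sigma_0|^2=s$ given $z_j=y$ is the regular conditional distribution $\nu_{j,y}$ of $s$ given $z_j=y$, which is determined for almost every $y$ with respect to the law of $z_j$. The posterior variance $\mathrm{var}(|\sigma_0|^2\mid z_j=y)\in[0,\infty]$ is the variance of $\nu_{j,y}$, i.e. $\tfrac12\iint(a-b)^2\,\nu_{j,y}(da)\,\nu_{j,y}(db)$. *)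

theory Defs
  imports "HOL-Probability.Probability"
begin

section \<open>Schwartz functions\<close>

primrec nth_vderiv :: "nat \<Rightarrow> (real \<Rightarrow> complex) \<Rightarrow> real \<Rightarrow> complex" where
  "nth_vderiv 0 f = f"
| "nth_vderiv (Suc n) f = (\<lambda>x. vector_derivative (nth_vderiv n f) (at x))"

definition schwartz_functions :: "(real \<Rightarrow> complex) set" where
  "schwartz_functions = {f. (\<forall>n x. nth_vderiv n f differentiable (at x)) \<and>
     (\<forall>a b. bdd_above (range (\<lambda>x. \<bar>x\<bar> ^ a * cmod (nth_vderiv b f x))))}"

lemma nth_vderiv_eqI:
  assumes "F 0 = f" "\<And>n x. (F n has_vector_derivative F (Suc n) x) (at x)"
  shows "nth_vderiv n f = F n"
proof (induction n)
  case (Suc n)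
  then show ?case
    using vector_derivative_at[OF assms(2)] by auto
qed (simp add: assms(1))

lemma schwartz_functionsI:
  assumes F: "F 0 = f" "\<And>n x. (F n has_vector_derivative F (Suc n) x) (at x)"
    and bound: "\<And>a b. \<exists>C. \<forall>x. \<bar>x\<bar> ^ a * cmod (F b x) \<le> C"
  shows "f \<in> schwartz_functions"
proof -
  have [simp]: "nth_vderiv n f = F n" for n
    using nth_vderiv_eqI[of F f] F by blast
  have "bdd_above (range (\<lambda>x. \<bar>x\<bar> ^ a * cmod (F b x)))" for a b
    using bound[of a b] by (auto simp: bdd_above_def)
  then show ?thesis
    by (auto simp: schwartz_functions_def intro!: differentiableI_vector[OF F(2)])
qed

lemma schwartz_functions_deriv:
  "f \<in> schwartz_functions \<Longrightarrow>
    (nth_vderiv n f has_vector_derivative nth_vderiv (Suc n) f x) (at x)"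
  by (simp add: schwartz_functions_def vector_derivative_works[symmetric])

lemma schwartz_functions_bound:
  "f \<in> schwartz_functions \<Longrightarrow> \<exists>C. \<forall>x. \<bar>x\<bar> ^ a * cmod (nth_vderiv b f x) \<le> C"
  by (fastforce simp: schwartz_functions_def bdd_above_def)

lemma power_abs_add_le: "\<bar>x + y\<bar> ^ a \<le> 2 ^ a * (\<bar>x\<bar> ^ a + \<bar>y\<bar> ^ a)" for x y :: real
proof -
  have "\<bar>x + y\<bar> ^ a \<le> (2 * max \<bar>x\<bar> \<bar>y\<bar>) ^ a"
    by (intro power_mono) auto
  also have "\<dots> = 2 ^ a * (max \<bar>x\<bar> \<bar>y\<bar>) ^ a"
    by (simp add: power_mult_distrib)
  also have "(max \<bar>x\<bar> \<bar>y\<bar>) ^ a \<le> \<bar>x\<bar> ^ a + \<bar>y\<bar> ^ a"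
    by (auto simp: max_def)
  finally show ?thesis by simp
qed

lemma schwartz_functions_add:
  assumes fg: "f \<in> schwartz_functions" "g \<in> schwartz_functions"
  shows "(\<lambda>x. f x + g x) \<in> schwartz_functions"
proof (rule schwartz_functionsI[where F = "\<lambda>n x. nth_vderiv n f x + nth_vderiv n g x"])
  fix a b
  from schwartz_functions_bound[OF fg(1), of a b] schwartz_functions_bound[OF fg(2), of a b]
  obtain C D where *: "\<And>x. \<bar>x\<bar> ^ a * cmod (nth_vderiv b f x) \<le> C"
    "\<And>x. \<bar>x\<bar> ^ a * cmod (nth_vderiv b g x) \<le> D" by blast
  have "\<bar>x\<bar> ^ a * cmod (nth_vderiv b f x + nth_vderiv b g x) \<le> C + D" for x
  proof -
    have "\<bar>x\<bar> ^ a * cmod (nth_vderiv b f x + nth_vderiv b g x)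
        \<le> \<bar>x\<bar> ^ a * (cmod (nth_vderiv b f x) + cmod (nth_vderiv b g x))"
      by (intro mult_left_mono norm_triangle_ineq) auto
    also have "\<dots> \<le> C + D"
      using *[of x] by (simp add: distrib_left)
    finally show ?thesis .
  qed
  then show "\<exists>C. \<forall>x. \<bar>x\<bar> ^ a * cmod (nth_vderiv b f x + nth_vderiv b g x) \<le> C"
    by blast
qed (auto intro!: has_vector_derivative_add schwartz_functions_deriv fg simp del: nth_vderiv.simps(2))

typedef schwartz = schwartz_functions
  morphisms schwartz_fun Schwartz
  by (rule exI[of _ "\<lambda>_. 0"], rule schwartz_functionsI[where F = "\<lambda>_ _. 0"]) auto

setup_lifting type_definition_schwartz

instantiation schwartz :: ab_group_add
begin

lift_definition zero_schwartz :: schwartz is "\<lambda>_. 0"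
  by (rule schwartz_functionsI[where F = "\<lambda>_ _. 0"]) auto

lift_definition plus_schwartz :: "schwartz \<Rightarrow> schwartz \<Rightarrow> schwartz" is "\<lambda>f g x. f x + g x"
  by (rule schwartz_functions_add)

lift_definition uminus_schwartz :: "schwartz \<Rightarrow> schwartz" is "\<lambda>f x. - f x"
  by (rule schwartz_functionsI[where F = "\<lambda>n x. - nth_vderiv n f x" for f])
     (auto intro!: has_vector_derivative_minus schwartz_functions_deriv schwartz_functions_bound
       simp del: nth_vderiv.simps(2))

definition minus_schwartz :: "schwartz \<Rightarrow> schwartz \<Rightarrow> schwartz" where
  "minus_schwartz \<phi> \<psi> = \<phi> + - \<psi>"

instance
  by standard (transfer; simp add: minus_schwartz_def add_ac | simp add: minus_schwartz_def)+

end

lift_definition schwartz_scale :: "complex \<Rightarrow> schwartz \<Rightarrow> schwartz" is "\<lambda>c f x. c * f x"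
proof (rule schwartz_functionsI[where F = "\<lambda>n x. c * nth_vderiv n f x" for f c])
  fix f c a b
  assume f: "f \<in> schwartz_functions"
  from schwartz_functions_bound[OF f, of a b]
  obtain C where *: "\<And>x. \<bar>x\<bar> ^ a * cmod (nth_vderiv b f x) \<le> C" by blast
  have "\<bar>x\<bar> ^ a * cmod (c * nth_vderiv b f x) \<le> cmod c * C" for x
    using mult_left_mono[OF *[of x], of "cmod c"] by (simp add: norm_mult mult_ac)
  then show "\<exists>C. \<forall>x. \<bar>x\<bar> ^ a * cmod (c * nth_vderiv b f x) \<le> C"
    by blast
qed (auto intro!: has_vector_derivative_mult_right schwartz_functions_deriv simp del: nth_vderiv.simps(2))

lift_definition schwartz_reflect_at :: "real \<Rightarrow> schwartz \<Rightarrow> schwartz" is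
  "\<lambda>x f y. f (x - y)"
proof (rule schwartz_functionsI[where F = "\<lambda>n y. (- 1) ^ n * nth_vderiv n f (x - y)" for f x])
  fix f and x y :: real and n
  assume f: "f \<in> schwartz_functions"
  have "((nth_vderiv n f \<circ> (\<lambda>y. x - y)) has_vector_derivative
      (- 1) *\<^sub>R nth_vderiv (Suc n) f (x - y)) (at y)"
    by (intro vector_diff_chain_at schwartz_functions_deriv f) (auto intro!: derivative_eq_intros)
  from has_vector_derivative_mult_right[OF this, of "(- 1) ^ n"]
  show "((\<lambda>y. (- 1) ^ n * nth_vderiv n f (x - y)) has_vector_derivative
      (- 1) ^ Suc n * nth_vderiv (Suc n) f (x - y)) (at y)"
    by (simp add: o_def del: nth_vderiv.simps)
next
  fix f and x :: real and a b
  assume f: "f \<in> schwartz_functions"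
  from schwartz_functions_bound[OF f, of a b] schwartz_functions_bound[OF f, of 0 b]
  obtain C D where *: "\<And>x. \<bar>x\<bar> ^ a * cmod (nth_vderiv b f x) \<le> C"
    "\<And>x. cmod (nth_vderiv b f x) \<le> D" by auto
  have "\<bar>y\<bar> ^ a * cmod ((- 1) ^ b * nth_vderiv b f (x - y)) \<le> 2 ^ a * (\<bar>x\<bar> ^ a * D + C)" for y
  proof -
    have "\<bar>y\<bar> ^ a \<le> 2 ^ a * (\<bar>x\<bar> ^ a + \<bar>x - y\<bar> ^ a)"
      using power_abs_add_le[of x "y - x" a] by (simp add: abs_minus_commute)
    then have "\<bar>y\<bar> ^ a * cmod (nth_vderiv b f (x - y))
        \<le> (2 ^ a * (\<bar>x\<bar> ^ a + \<bar>x - y\<bar> ^ a)) * cmod (nth_vderiv b f (x - y))"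
      by (intro mult_right_mono) auto
    also have "\<dots> = 2 ^ a * (\<bar>x\<bar> ^ a * cmod (nth_vderiv b f (x - y))
        + \<bar>x - y\<bar> ^ a * cmod (nth_vderiv b f (x - y)))"
      by (simp add: algebra_simps)
    also have "\<dots> \<le> 2 ^ a * (\<bar>x\<bar> ^ a * D + C)"
      by (intro mult_left_mono add_mono * ) auto
    finally show ?thesis by (simp add: norm_mult norm_power)
  qed
  then show "\<exists>C. \<forall>y. \<bar>y\<bar> ^ a * cmod ((- 1) ^ b * nth_vderiv b f (x - y)) \<le> C"
    by blast
qed auto

definition schwartz_seminorm :: "nat \<Rightarrow> nat \<Rightarrow> schwartz \<Rightarrow> real" where
  "schwartz_seminorm a b \<phi> = (SUP x. \<bar>x\<bar> ^ a * cmod (nth_vderiv b (schwartz_fun \<phi>) x))"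

instantiation schwartz :: topological_space
begin

definition open_schwartz :: "schwartz set \<Rightarrow> bool" where
  "open_schwartz = generate_topology
     {{\<psi>. schwartz_seminorm a b (\<psi> - \<phi>) < r} | a b \<phi> r. True}"

instance
  by standard (auto simp: open_schwartz_def intro: generate_topology.intros)

end


lemma schwartz_seminorm_upper:
  "\<bar>x\<bar> ^ a * cmod (nth_vderiv b (schwartz_fun \<phi>) x) \<le> schwartz_seminorm a b \<phi>"
  unfolding schwartz_seminorm_def
  using schwartz_fun[of \<phi>] by (intro cSUP_upper) (auto simp: schwartz_functions_def)

lemma schwartz_seminorm_least:
  "(\<And>x. \<bar>x\<bar> ^ a * cmod (nth_vderiv b (schwartz_fun \<phi>) x) \<le> C) \<Longrightarrow> schwartz_seminorm a b \<phi> \<le> C"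
  unfolding schwartz_seminorm_def by (intro cSUP_least) auto

lemma schwartz_seminorm_nonneg: "0 \<le> schwartz_seminorm a b \<phi>"
  by (rule order_trans[OF _ schwartz_seminorm_upper[of 0]]) auto

lemma schwartz_fun_deriv:
  "(nth_vderiv n (schwartz_fun \<phi>) has_vector_derivative nth_vderiv (Suc n) (schwartz_fun \<phi>) x) (at x)"
  by (rule schwartz_functions_deriv[OF schwartz_fun])

lemma nth_vderiv_add:
  "nth_vderiv n (schwartz_fun (\<phi> + \<psi>)) x
    = nth_vderiv n (schwartz_fun \<phi>) x + nth_vderiv n (schwartz_fun \<psi>) x"
proof -
  have "nth_vderiv n (schwartz_fun (\<phi> + \<psi>))
      = (\<lambda>x. nth_vderiv n (schwartz_fun \<phi>) x + nth_vderiv n (schwartz_fun \<psi>) x)"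
    by (rule nth_vderiv_eqI[where F = "\<lambda>n x. nth_vderiv n (schwartz_fun \<phi>) x + nth_vderiv n (schwartz_fun \<psi>) x"])
       (auto simp: plus_schwartz.rep_eq intro!: has_vector_derivative_add schwartz_fun_deriv
         simp del: nth_vderiv.simps(2))
  then show ?thesis by simp
qed

lemma schwartz_seminorm_add:
  "schwartz_seminorm a b (\<phi> + \<psi>) \<le> schwartz_seminorm a b \<phi> + schwartz_seminorm a b \<psi>"
proof (rule schwartz_seminorm_least)
  fix x
  have "\<bar>x\<bar> ^ a * cmod (nth_vderiv b (schwartz_fun (\<phi> + \<psi>)) x)
      \<le> \<bar>x\<bar> ^ a * (cmod (nth_vderiv b (schwartz_fun \<phi>) x) + cmod (nth_vderiv b (schwartz_fun \<psi>) x))"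
    by (auto simp: nth_vderiv_add intro!: mult_left_mono norm_triangle_ineq)
  also have "\<dots> \<le> schwartz_seminorm a b \<phi> + schwartz_seminorm a b \<psi>"
    by (simp add: distrib_left add_mono schwartz_seminorm_upper)
  finally show "\<bar>x\<bar> ^ a * cmod (nth_vderiv b (schwartz_fun (\<phi> + \<psi>)) x)
      \<le> schwartz_seminorm a b \<phi> + schwartz_seminorm a b \<psi>" .
qed

definition seminorm_dominated :: "(schwartz \<Rightarrow> real) \<Rightarrow> bool" where
  "seminorm_dominated q \<longleftrightarrow>
     (\<exists>C N. C \<ge> 0 \<and> (\<forall>\<phi>. q \<phi> \<le> C * (\<Sum>a\<le>N. \<Sum>b\<le>N. schwartz_seminorm a b \<phi>)))"

lemma seminorm_dominated_mono:
  "seminorm_dominated q \<Longrightarrow> (\<And>\<phi>. r \<phi> \<le> q \<phi>) \<Longrightarrow> seminorm_dominated r"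
  unfolding seminorm_dominated_def by (meson order_trans)

lemma seminorm_dominated_seminorm: "seminorm_dominated (schwartz_seminorm a b)"
proof -
  have "schwartz_seminorm a b \<phi> \<le> 1 * (\<Sum>a'\<le>max a b. \<Sum>b'\<le>max a b. schwartz_seminorm a' b' \<phi>)"
    for \<phi>
  proof -
    have "schwartz_seminorm a b \<phi> \<le> (\<Sum>b'\<le>max a b. schwartz_seminorm a b' \<phi>)"
      by (rule member_le_sum) (auto simp: schwartz_seminorm_nonneg)
    also have "\<dots> \<le> (\<Sum>a'\<le>max a b. \<Sum>b'\<le>max a b. schwartz_seminorm a' b' \<phi>)"
      by (rule member_le_sum[of a _ "\<lambda>a'. \<Sum>b'\<le>max a b. schwartz_seminorm a' b' \<phi>"])
         (auto simp: schwartz_seminorm_nonneg sum_nonneg)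
    finally show ?thesis by simp
  qed
  then show ?thesis
    unfolding seminorm_dominated_def by (intro exI[of _ 1] exI[of _ "max a b"] conjI allI) auto
qed

lemma seminorm_dominated_scale:
  assumes "seminorm_dominated q" "c \<ge> 0"
  shows "seminorm_dominated (\<lambda>\<phi>. c * q \<phi>)"
proof -
  from assms obtain C N where "C \<ge> 0" "\<And>\<phi>. q \<phi> \<le> C * (\<Sum>a\<le>N. \<Sum>b\<le>N. schwartz_seminorm a b \<phi>)"
    unfolding seminorm_dominated_def by blast
  with assms(2) have "\<forall>\<phi>. c * q \<phi> \<le> (c * C) * (\<Sum>a\<le>N. \<Sum>b\<le>N. schwartz_seminorm a b \<phi>)" "c * C \<ge> 0"
    by (auto simp: mult.assoc intro!: mult_left_mono)
  then show ?thesis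
    unfolding seminorm_dominated_def by blast
qed

lemma seminorm_dominated_add:
  assumes "seminorm_dominated q" "seminorm_dominated r"
  shows "seminorm_dominated (\<lambda>\<phi>. q \<phi> + r \<phi>)"
proof -
  let ?S = "\<lambda>N \<phi>. \<Sum>a\<le>N. \<Sum>b\<le>N. schwartz_seminorm a b \<phi>"
  have mono: "?S M \<phi> \<le> ?S N \<phi>" if "M \<le> N" for M N :: nat and \<phi>
  proof -
    have "?S M \<phi> \<le> (\<Sum>a\<le>M. \<Sum>b\<le>N. schwartz_seminorm a b \<phi>)"
      using that by (intro sum_mono sum_mono2) (auto simp: schwartz_seminorm_nonneg)
    also have "\<dots> \<le> ?S N \<phi>"
      using that by (intro sum_mono2) (auto simp: schwartz_seminorm_nonneg sum_nonneg)
    finally show ?thesis .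
  qed
  from assms obtain C M D N where CD: "C \<ge> 0" "D \<ge> 0"
    and *: "\<And>\<phi>. q \<phi> \<le> C * ?S M \<phi>" "\<And>\<phi>. r \<phi> \<le> D * ?S N \<phi>"
    unfolding seminorm_dominated_def by blast
  have "q \<phi> + r \<phi> \<le> (C + D) * ?S (max M N) \<phi>" for \<phi>
  proof -
    have "q \<phi> + r \<phi> \<le> C * ?S M \<phi> + D * ?S N \<phi>"
      by (intro add_mono *)
    also have "\<dots> \<le> C * ?S (max M N) \<phi> + D * ?S (max M N) \<phi>"
      using CD by (intro add_mono mult_left_mono mono) auto
    finally show ?thesis by (simp add: distrib_right)
  qed
  moreover have "C + D \<ge> 0" using CD by simp
  ultimately show ?thesis
    unfolding seminorm_dominated_def by blast
qed

lemma seminorm_dominated_zero: "seminorm_dominated (\<lambda>_. 0)"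
  unfolding seminorm_dominated_def by (intro exI[of _ 0]) auto

lemma seminorm_dominated_sum:
  "(\<And>i. i \<in> I \<Longrightarrow> seminorm_dominated (q i)) \<Longrightarrow> seminorm_dominated (\<lambda>\<phi>. \<Sum>i\<in>I. q i \<phi>)"
  by (induction I rule: infinite_finite_induct)
     (auto intro: seminorm_dominated_add seminorm_dominated_zero)

lemma seminorm_dominated_compose:
  assumes "seminorm_dominated q" "\<And>a b. seminorm_dominated (\<lambda>\<phi>. schwartz_seminorm a b (L \<phi>))"
  shows "seminorm_dominated (\<lambda>\<phi>. q (L \<phi>))"
proof -
  from assms(1) obtain C N where *: "C \<ge> 0" "\<And>\<phi>. q \<phi> \<le> C * (\<Sum>a\<le>N. \<Sum>b\<le>N. schwartz_seminorm a b \<phi>)"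
    unfolding seminorm_dominated_def by blast
  have "seminorm_dominated (\<lambda>\<phi>. C * (\<Sum>a\<le>N. \<Sum>b\<le>N. schwartz_seminorm a b (L \<phi>)))"
    by (intro seminorm_dominated_scale seminorm_dominated_sum assms(2) *(1))
  then show ?thesis
    by (rule seminorm_dominated_mono) (rule *(2))
qed

lemma continuous_on_schwartzI:
  fixes L :: "schwartz \<Rightarrow> schwartz"
  assumes add: "\<And>\<phi> \<psi>. L (\<phi> + \<psi>) = L \<phi> + L \<psi>"
    and dom: "\<And>a b. seminorm_dominated (\<lambda>\<phi>. schwartz_seminorm a b (L \<phi>))"
  shows "continuous_on UNIV L"
proof (rule continuous_on_generate_topology[OF open_schwartz_def])
  fix B assume "B \<in> {{\<psi>. schwartz_seminorm a b (\<psi> - \<phi>) < r} |a b \<phi> r. True}"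
  then obtain a b \<phi> r where B: "B = {\<psi>. schwartz_seminorm a b (\<psi> - \<phi>) < r}" by blast
  have "open (L -` B)"
  proof (subst open_subopen, intro ballI)
    fix \<psi>0 assume "\<psi>0 \<in> L -` B"
    define \<delta> where "\<delta> = r - schwartz_seminorm a b (L \<psi>0 - \<phi>)"
    have "\<delta> > 0" using \<open>\<psi>0 \<in> L -` B\<close> by (simp add: B \<delta>_def)
    from dom[of a b] obtain C N where C: "C \<ge> 0"
      and CN: "\<And>\<phi>. schwartz_seminorm a b (L \<phi>) \<le> C * (\<Sum>a\<le>N. \<Sum>b\<le>N. schwartz_seminorm a b \<phi>)"
      unfolding seminorm_dominated_def by blast
    define \<eta> where "\<eta> = \<delta> / ((C + 1) * (real (Suc N))\<^sup>2)"
    have "\<eta> > 0" using \<open>\<delta> > 0\<close> C by (simp add: \<eta>_def)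
    define U where "U = (\<Inter>a'\<in>{..N}. \<Inter>b'\<in>{..N}. {\<psi>. schwartz_seminorm a' b' (\<psi> - \<psi>0) < \<eta>})"
    have "open U"
      unfolding U_def
      by (intro open_INT ballI finite_atMost) (auto simp: open_schwartz_def intro!: generate_topology.Basis)
    moreover have "schwartz_seminorm a b 0 = 0" for a b
    proof -
      have "nth_vderiv n (\<lambda>x. 0) = (\<lambda>x. 0)" for n
        by (rule nth_vderiv_eqI[where F = "\<lambda>_ _. 0"]) auto
      then show ?thesis
        by (simp add: schwartz_seminorm_def zero_schwartz.rep_eq)
    qed
    then have "\<psi>0 \<in> U"
      using \<open>\<eta> > 0\<close> by (simp add: U_def)
    moreover have "U \<subseteq> L -` B"
    proof
      fix \<psi> assume "\<psi> \<in> U"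
      have "schwartz_seminorm a b (L (\<psi> - \<psi>0)) \<le> C * (\<Sum>a\<le>N. \<Sum>b\<le>N. schwartz_seminorm a b (\<psi> - \<psi>0))"
        by (rule CN)
      also have "\<dots> \<le> C * (\<Sum>a\<le>N. \<Sum>b\<le>N. \<eta>)"
        using C \<open>\<psi> \<in> U\<close> by (intro mult_left_mono sum_mono) (auto simp: U_def less_imp_le)
      also have "\<dots> = C * ((real (Suc N))\<^sup>2 * \<eta>)"
        by (simp add: power2_eq_square algebra_simps)
      also have "(real (Suc N))\<^sup>2 * \<eta> = \<delta> / (C + 1)"
        by (simp add: \<eta>_def del: of_nat_Suc)
      also have "C * (\<delta> / (C + 1)) < \<delta>"
        using C \<open>\<delta> > 0\<close> by (simp add: field_simps)
      finally have *: "schwartz_seminorm a b (L (\<psi> - \<psi>0)) < \<delta>" .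
      have "L \<psi> = L (\<psi> - \<psi>0) + L \<psi>0"
        by (subst add[symmetric]) simp
      then have "L \<psi> - \<phi> = L (\<psi> - \<psi>0) + (L \<psi>0 - \<phi>)"
        by simp
      then have "schwartz_seminorm a b (L \<psi> - \<phi>)
          \<le> schwartz_seminorm a b (L (\<psi> - \<psi>0)) + schwartz_seminorm a b (L \<psi>0 - \<phi>)"
        by (simp only: schwartz_seminorm_add)
      with * show "\<psi> \<in> L -` B"
        by (simp add: B \<delta>_def)
    qed
    ultimately show "\<exists>T. open T \<and> \<psi>0 \<in> T \<and> T \<subseteq> L -` B" by blast
  qed
  then show "\<exists>C. open C \<and> C \<inter> UNIV = L -` B \<inter> UNIV" by blast
qed

section \<open>The Fourier transform of Schwartz functions\<close>

definition fourier_integral :: "(real \<Rightarrow> complex) \<Rightarrow> real \<Rightarrow> complex" where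
  "fourier_integral f \<xi> = (LINT x|lborel. cis (- (2 * pi * x * \<xi>)) * f x)"

lift_definition schwartz_deriv :: "schwartz \<Rightarrow> schwartz" is "nth_vderiv 1"
proof (rule schwartz_functionsI[where F = "\<lambda>n. nth_vderiv (Suc n) f" for f])
  fix f :: "real \<Rightarrow> complex" and n x
  assume "f \<in> schwartz_functions"
  then show "(nth_vderiv (Suc n) f has_vector_derivative nth_vderiv (Suc (Suc n)) f x) (at x)"
    by (rule schwartz_functions_deriv)
next
  fix f :: "real \<Rightarrow> complex" and a b
  assume "f \<in> schwartz_functions"
  then show "\<exists>C. \<forall>x. \<bar>x\<bar> ^ a * cmod (nth_vderiv (Suc b) f x) \<le> C"
    by (rule schwartz_functions_bound)
qed simp

definition nth_vderiv_times :: "(real \<Rightarrow> complex) \<Rightarrow> nat \<Rightarrow> real \<Rightarrow> complex" where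
  "nth_vderiv_times f n x = of_real x * nth_vderiv n f x + of_nat n * nth_vderiv (n - 1) f x"

lemma nth_vderiv_times_0: "nth_vderiv_times f 0 = (\<lambda>x. of_real x * f x)"
  by (simp add: fun_eq_iff nth_vderiv_times_def)

lemma nth_vderiv_times_deriv:
  assumes "f \<in> schwartz_functions"
  shows "(nth_vderiv_times f n has_vector_derivative nth_vderiv_times f (Suc n) x) (at x)"
proof -
  have "((\<lambda>x. of_real x * nth_vderiv n f x) has_vector_derivative
      of_real x * nth_vderiv (Suc n) f x + 1 * nth_vderiv n f x) (at x)"
    by (intro has_vector_derivative_mult schwartz_functions_deriv assms)
       (auto intro!: derivative_eq_intros)
  moreover have "((\<lambda>x. of_nat n * nth_vderiv (n - 1) f x) has_vector_derivative
      of_nat n * nth_vderiv n f x) (at x)"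
  proof (cases n)
    case (Suc m)
    show ?thesis
      using has_vector_derivative_mult_right[OF schwartz_functions_deriv[OF assms, of m], of "of_nat n"]
      by (simp add: Suc del: nth_vderiv.simps)
  qed simp
  ultimately have "((\<lambda>x. of_real x * nth_vderiv n f x + of_nat n * nth_vderiv (n - 1) f x)
      has_vector_derivative of_real x * nth_vderiv (Suc n) f x + 1 * nth_vderiv n f x
        + of_nat n * nth_vderiv n f x) (at x)"
    by (rule has_vector_derivative_add)
  moreover have "of_real x * nth_vderiv (Suc n) f x + 1 * nth_vderiv n f x
      + of_nat n * nth_vderiv n f x = nth_vderiv_times f (Suc n) x"
    by (simp add: nth_vderiv_times_def algebra_simps del: nth_vderiv.simps)
  ultimately show ?thesis
    by (simp only: nth_vderiv_times_def[abs_def])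
qed

lemma nth_vderiv_times_bound:
  assumes "\<bar>x\<bar> ^ Suc a * cmod (nth_vderiv b f x) \<le> C" "\<bar>x\<bar> ^ a * cmod (nth_vderiv (b - 1) f x) \<le> D"
  shows "\<bar>x\<bar> ^ a * cmod (nth_vderiv_times f b x) \<le> C + real b * D"
proof -
  have "cmod (nth_vderiv_times f b x)
      \<le> \<bar>x\<bar> * cmod (nth_vderiv b f x) + real b * cmod (nth_vderiv (b - 1) f x)"
    unfolding nth_vderiv_times_def by (rule order_trans[OF norm_triangle_ineq]) (simp add: norm_mult)
  then have "\<bar>x\<bar> ^ a * cmod (nth_vderiv_times f b x)
      \<le> \<bar>x\<bar> ^ a * (\<bar>x\<bar> * cmod (nth_vderiv b f x) + real b * cmod (nth_vderiv (b - 1) f x))"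
    by (intro mult_left_mono) auto
  also have "\<dots> = \<bar>x\<bar> ^ Suc a * cmod (nth_vderiv b f x)
      + real b * (\<bar>x\<bar> ^ a * cmod (nth_vderiv (b - 1) f x))"
    by (simp add: algebra_simps)
  also have "\<dots> \<le> C + real b * D"
    by (intro add_mono mult_left_mono assms) auto
  finally show ?thesis .
qed

lift_definition schwartz_times :: "schwartz \<Rightarrow> schwartz" is "\<lambda>f x. of_real x * f x"
proof (rule schwartz_functionsI[where F = "nth_vderiv_times f" for f])
  fix f :: "real \<Rightarrow> complex" and a b
  assume f: "f \<in> schwartz_functions"
  from schwartz_functions_bound[OF f, of "Suc a" b] schwartz_functions_bound[OF f, of a "b - 1"]
  obtain C D where "\<And>x. \<bar>x\<bar> ^ Suc a * cmod (nth_vderiv b f x) \<le> C"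
    "\<And>x. \<bar>x\<bar> ^ a * cmod (nth_vderiv (b - 1) f x) \<le> D" by blast
  from nth_vderiv_times_bound[OF this]
  show "\<exists>C. \<forall>x. \<bar>x\<bar> ^ a * cmod (nth_vderiv_times f b x) \<le> C" by blast
qed (auto simp: nth_vderiv_times_deriv nth_vderiv_times_0)

lemma nth_vderiv_schwartz_deriv:
  "nth_vderiv n (schwartz_fun (schwartz_deriv \<phi>)) = nth_vderiv (Suc n) (schwartz_fun \<phi>)"
  by (rule nth_vderiv_eqI[where F = "\<lambda>n. nth_vderiv (Suc n) (schwartz_fun \<phi>)"])
     (simp add: schwartz_deriv.rep_eq, rule schwartz_fun_deriv)

lemma nth_vderiv_schwartz_times:
  "nth_vderiv n (schwartz_fun (schwartz_times \<phi>)) = nth_vderiv_times (schwartz_fun \<phi>) n"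
  by (rule nth_vderiv_eqI[where F = "nth_vderiv_times (schwartz_fun \<phi>)"])
     (auto simp: schwartz_times.rep_eq nth_vderiv_times_deriv schwartz_fun nth_vderiv_times_0)

lemma nth_vderiv_schwartz_scale:
  "nth_vderiv n (schwartz_fun (schwartz_scale c \<phi>)) = (\<lambda>x. c * nth_vderiv n (schwartz_fun \<phi>) x)"
  by (rule nth_vderiv_eqI[where F = "\<lambda>n x. c * nth_vderiv n (schwartz_fun \<phi>) x"])
     (auto simp: schwartz_scale.rep_eq intro!: has_vector_derivative_mult_right schwartz_fun_deriv
       simp del: nth_vderiv.simps(2))

lemma schwartz_seminorm_deriv:
  "schwartz_seminorm a b (schwartz_deriv \<phi>) = schwartz_seminorm a (Suc b) \<phi>"
  by (simp add: schwartz_seminorm_def nth_vderiv_schwartz_deriv del: nth_vderiv.simps)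

lemma schwartz_seminorm_times:
  "schwartz_seminorm a b (schwartz_times \<phi>)
    \<le> schwartz_seminorm (Suc a) b \<phi> + real b * schwartz_seminorm a (b - 1) \<phi>"
  by (rule schwartz_seminorm_least)
     (simp only: nth_vderiv_schwartz_times nth_vderiv_times_bound schwartz_seminorm_upper)

lemma schwartz_seminorm_scale:
  "schwartz_seminorm a b (schwartz_scale c \<phi>) \<le> cmod c * schwartz_seminorm a b \<phi>"
proof (rule schwartz_seminorm_least)
  fix x
  show "\<bar>x\<bar> ^ a * cmod (nth_vderiv b (schwartz_fun (schwartz_scale c \<phi>)) x)
      \<le> cmod c * schwartz_seminorm a b \<phi>"
    using mult_left_mono[OF schwartz_seminorm_upper[of x a b \<phi>], of "cmod c"]
    by (simp add: nth_vderiv_schwartz_scale norm_mult mult_ac)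
qed

lemma schwartz_fun_continuous: "continuous_on A (schwartz_fun \<phi>)"
  using schwartz_fun_deriv[of 0 \<phi>]
  by (auto intro!: continuous_at_imp_continuous_on has_vector_derivative_continuous)

lemma schwartz_fun_measurable [measurable]: "schwartz_fun \<phi> \<in> borel_measurable borel"
  by (rule borel_measurable_continuous_onI[OF schwartz_fun_continuous])

lemma integrable_inverse_one_plus_square:
  "integrable lborel (\<lambda>x::real. inverse (1 + x\<^sup>2))"
  using integrable_inverse_1_plus_square by (simp add: set_integrable_def)

lemma schwartz_fun_decay:
  "cmod (schwartz_fun \<phi> x) \<le> (schwartz_seminorm 0 0 \<phi> + schwartz_seminorm 2 0 \<phi>) * inverse (1 + x\<^sup>2)"
proof -
  have "(1 + x\<^sup>2) * cmod (schwartz_fun \<phi> x) \<le> schwartz_seminorm 0 0 \<phi> + schwartz_seminorm 2 0 \<phi>"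
    using schwartz_seminorm_upper[of x 0 0 \<phi>] schwartz_seminorm_upper[of x 2 0 \<phi>]
    by (simp add: algebra_simps)
  moreover have "1 + x\<^sup>2 > 0" by (simp add: add_pos_nonneg)
  ultimately show ?thesis by (simp add: field_simps)
qed

lemma schwartz_fun_integrable: "integrable lborel (schwartz_fun \<phi>)"
proof (rule Bochner_Integration.integrable_bound)
  show "integrable lborel
      (\<lambda>x. (schwartz_seminorm 0 0 \<phi> + schwartz_seminorm 2 0 \<phi>) * inverse (1 + x\<^sup>2))"
    by (intro integrable_mult_right integrable_inverse_one_plus_square)
qed (auto intro!: AE_I2 order_trans[OF schwartz_fun_decay])

lemma fourier_integrand_integrable: "integrable lborel (\<lambda>x. cis (- (2 * pi * x * \<xi>)) * schwartz_fun \<phi> x)"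
proof (rule Bochner_Integration.integrable_bound[OF schwartz_fun_integrable[of \<phi>]])
  have "continuous_on UNIV (\<lambda>x. cis (- (2 * pi * x * \<xi>)))"
    by (intro continuous_intros)
  then have [measurable]: "(\<lambda>x. cis (- (2 * pi * x * \<xi>))) \<in> borel_measurable borel"
    by (rule borel_measurable_continuous_onI)
  show "(\<lambda>x. cis (- (2 * pi * x * \<xi>)) * schwartz_fun \<phi> x) \<in> borel_measurable lborel"
    by measurable
qed (simp add: norm_mult)

lemma fourier_integral_bound:
  "cmod (fourier_integral (schwartz_fun \<phi>) \<xi>)
    \<le> (schwartz_seminorm 0 0 \<phi> + schwartz_seminorm 2 0 \<phi>) * (LBINT x. inverse (1 + x\<^sup>2))"
proof -
  have "cmod (fourier_integral (schwartz_fun \<phi>) \<xi>)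
      \<le> (LBINT x. cmod (cis (- (2 * pi * x * \<xi>)) * schwartz_fun \<phi> x))"
    unfolding fourier_integral_def by (rule integral_norm_bound)
  also have "\<dots> = (LBINT x. cmod (schwartz_fun \<phi> x))"
    by (simp add: norm_mult)
  also have "\<dots> \<le> (LBINT x. (schwartz_seminorm 0 0 \<phi> + schwartz_seminorm 2 0 \<phi>) * inverse (1 + x\<^sup>2))"
    by (intro integral_mono integrable_norm schwartz_fun_integrable integrable_mult_right
        integrable_inverse_one_plus_square schwartz_fun_decay)
  finally show ?thesis by simp
qed

lemma fourier_integral_deriv:
  "(fourier_integral (schwartz_fun \<phi>) has_vector_derivative
    fourier_integral (schwartz_fun (schwartz_scale (- (2 * of_real pi * \<i>)) (schwartz_times \<phi>))) \<xi>) (at \<xi>)"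
proof -
  let ?F = "fourier_integral (schwartz_fun \<phi>)"
  let ?\<psi> = "schwartz_scale (- (2 * of_real pi * \<i>)) (schwartz_times \<phi>)"
  let ?G = "fourier_integral (schwartz_fun ?\<psi>)"
  let ?\<theta> = "schwartz_times (schwartz_times \<phi>)"
  define K where "K = (LBINT x. 2 * pi\<^sup>2 * cmod (schwartz_fun ?\<theta> x))"
  have bound: "cmod (?F (\<xi> + h) - ?F \<xi> - h *\<^sub>R ?G \<xi>) \<le> K * h\<^sup>2" for h
  proof -
    let ?e = "\<lambda>\<xi> x. cis (- (2 * pi * x * \<xi>))"
    let ?d = "\<lambda>x. ?e (\<xi> + h) x * schwartz_fun \<phi> x - ?e \<xi> x * schwartz_fun \<phi> x
        - h *\<^sub>R (?e \<xi> x * schwartz_fun ?\<psi> x)"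
    note int = fourier_integrand_integrable
    have "(LINT x|lborel. ?d x) = ?F (\<xi> + h) - ?F \<xi> - h *\<^sub>R ?G \<xi>"
      unfolding fourier_integral_def
      by (simp only: Bochner_Integration.integral_diff[OF Bochner_Integration.integrable_diff[OF int int]
            integrable_scaleR_right[OF int]] Bochner_Integration.integral_diff[OF int int]
          integral_scaleR_right)
    then have "cmod (?F (\<xi> + h) - ?F \<xi> - h *\<^sub>R ?G \<xi>) = cmod (LINT x|lborel. ?d x)"
      by simp
    also have "\<dots> \<le> (LBINT x. cmod (?d x))"
      by (rule integral_norm_bound)
    also have "\<dots> \<le> (LBINT x. h\<^sup>2 * (2 * pi\<^sup>2 * cmod (schwartz_fun ?\<theta> x)))"
    proof (intro integral_mono integrable_norm Bochner_Integration.integrable_diff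
        integrable_scaleR_right integrable_mult_right fourier_integrand_integrable schwartz_fun_integrable)
      fix x
      define u where "u = - 2 * pi * x * h"
      have "?d x = ?e \<xi> x * schwartz_fun \<phi> x * (iexp u - (\<Sum>k\<le>1. (\<i> * u) ^ k / fact k))"
      proof -
        have "cis (- (2 * pi * x * (\<xi> + h))) = cis (- (2 * pi * x * \<xi>) + u)"
          by (simp add: u_def distrib_left)
        then have *: "?e (\<xi> + h) x = ?e \<xi> x * iexp u"
          by (simp only: cis_mult[symmetric] cis_conv_exp[of u])
        have "(\<Sum>k\<le>1. (\<i> * u) ^ k / fact k) = 1 + \<i> * u"
          by simp
        moreover have "h *\<^sub>R (?e \<xi> x * schwartz_fun ?\<psi> x) = ?e \<xi> x * schwartz_fun \<phi> x * (\<i> * u)"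
          by (simp add: schwartz_scale.rep_eq schwartz_times.rep_eq u_def scaleR_conv_of_real)
        ultimately show ?thesis
          unfolding * by (simp only: right_diff_distrib distrib_left mult_1_right mult.assoc mult.commute[of "iexp u"]) simp
      qed
      then have "cmod (?d x) = cmod (schwartz_fun \<phi> x) * cmod (iexp u - (\<Sum>k\<le>1. (\<i> * u) ^ k / fact k))"
        by (simp add: norm_mult del: atMost_Suc sum.atMost_Suc One_nat_def)
      also have "\<dots> \<le> cmod (schwartz_fun \<phi> x) * (\<bar>u\<bar> ^ Suc 1 / fact (Suc 1))"
        by (intro mult_left_mono iexp_approx1) auto
      also have "\<dots> = h\<^sup>2 * (2 * pi\<^sup>2 * cmod (schwartz_fun ?\<theta> x))"
        by (simp add: u_def schwartz_times.rep_eq norm_mult power2_eq_square abs_mult)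
      finally show "cmod (?d x) \<le> h\<^sup>2 * (2 * pi\<^sup>2 * cmod (schwartz_fun ?\<theta> x))" .
    qed
    also have "\<dots> = K * h\<^sup>2"
      unfolding K_def by (subst integral_mult_right_zero) (simp add: mult_ac)
    finally show ?thesis .
  qed
  have "((\<lambda>h. norm (?F (\<xi> + h) - ?F \<xi> - h *\<^sub>R ?G \<xi>) / norm h) \<longlongrightarrow> 0) (at 0)"
  proof (rule Lim_null_comparison[where g = "\<lambda>h. K * \<bar>h\<bar>"])
    have "norm (?F (\<xi> + h) - ?F \<xi> - h *\<^sub>R ?G \<xi>) / norm h \<le> K * \<bar>h\<bar>" for h
      using bound[of h] by (cases "h = 0") (auto simp: divide_le_eq power2_eq_square mult_ac abs_mult_self_eq)
    then show "\<forall>\<^sub>F h in at 0. norm (norm (?F (\<xi> + h) - ?F \<xi> - h *\<^sub>R ?G \<xi>) / norm h) \<le> K * \<bar>h\<bar>"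
      by (auto intro!: always_eventually)
    show "((\<lambda>h. K * \<bar>h\<bar>) \<longlongrightarrow> 0) (at 0)"
      by (auto intro!: tendsto_eq_intros)
  qed
  then show ?thesis
    by (simp add: has_vector_derivative_def has_derivative_at bounded_linear_scaleR_left)
qed

lemma fourier_integral_schwartz_deriv:
  "fourier_integral (schwartz_fun (schwartz_deriv \<phi>)) \<xi>
    = 2 * pi * \<i> * \<xi> * fourier_integral (schwartz_fun \<phi>) \<xi>"
proof -
  let ?e = "\<lambda>x. cis (- (2 * pi * x * \<xi>))"
  let ?G = "\<lambda>x. ?e x * schwartz_fun \<phi> x"
  let ?g = "\<lambda>x. ?e x * schwartz_fun (schwartz_deriv \<phi>) x - (2 * of_real pi * \<i>) * \<xi> * (?e x * schwartz_fun \<phi> x)"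
  have int: "integrable lborel ?g"
    by (intro Bochner_Integration.integrable_diff integrable_mult_right fourier_integrand_integrable)
  have lim: "(?G \<longlongrightarrow> 0) at_top" "(?G \<longlongrightarrow> 0) at_bot"
  proof -
    define C where "C = schwartz_seminorm 0 0 \<phi> + schwartz_seminorm 2 0 \<phi>"
    have G: "norm (?G x) \<le> C * inverse (1 + x\<^sup>2)" for x
      using schwartz_fun_decay[of \<phi> x] by (simp add: norm_mult C_def)
    have "((\<lambda>x::real. C * inverse (1 + x\<^sup>2)) \<longlongrightarrow> 0) at_top"
      "((\<lambda>x::real. C * inverse (1 + x\<^sup>2)) \<longlongrightarrow> 0) at_bot"
      by real_asymp+
    then show "(?G \<longlongrightarrow> 0) at_top" "(?G \<longlongrightarrow> 0) at_bot"
      by (auto intro!: Lim_null_comparison[where g = "\<lambda>x. C * inverse (1 + x\<^sup>2)"] always_eventually G)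
  qed
  have "(LBINT x=-\<infinity>..\<infinity>. ?g x) = 0 - 0"
  proof (rule interval_integral_FTC_integrable)
    fix x
    have "(?e has_vector_derivative - (2 * pi * \<i> * \<xi>) * ?e x) (at x)"
    proof -
      have "((\<lambda>x. - (2 * pi * x * \<xi>)) has_vector_derivative - (2 * pi * \<xi>)) (at x)"
        by (auto intro!: derivative_eq_intros)
      from vector_diff_chain_at[OF this has_vector_derivative_iexp] show ?thesis
        by (simp add: o_def cis_conv_exp scaleR_conv_of_real mult_ac)
    qed
    from has_vector_derivative_mult[OF this schwartz_fun_deriv[of 0 \<phi>, simplified nth_vderiv.simps]]
    show "(?G has_vector_derivative ?g x) (at x)"
      by (simp add: schwartz_deriv.rep_eq algebra_simps)
    have "continuous_on UNIV ?g"
      by (intro continuous_intros schwartz_fun_continuous)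
    then show "isCont ?g x"
      by (simp add: continuous_on_eq_continuous_at)
  next
    show "set_integrable lborel (einterval (-\<infinity>) \<infinity>) ?g"
      using int by (simp add: set_integrable_def)
  qed (use lim in \<open>auto simp: ereal_tendsto_simps1\<close>)
  then have "(LINT x|lborel. ?g x) = 0"
    by (simp add: interval_lebesgue_integral_def set_lebesgue_integral_def)
  also have "(LINT x|lborel. ?g x) = fourier_integral (schwartz_fun (schwartz_deriv \<phi>)) \<xi>
      - (2 * of_real pi * \<i>) * \<xi> * fourier_integral (schwartz_fun \<phi>) \<xi>"
    unfolding fourier_integral_def
    by (subst Bochner_Integration.integral_diff)
       (auto intro!: integrable_mult_right fourier_integrand_integrable simp: integral_mult_right_zero)
  finally show ?thesis by simp
qed

lemma fourier_integral_schwartz_deriv_funpow: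
  "fourier_integral (schwartz_fun ((schwartz_deriv ^^ a) \<phi>)) \<xi>
    = (2 * pi * \<i> * \<xi>) ^ a * fourier_integral (schwartz_fun \<phi>) \<xi>"
  by (induction a) (auto simp: fourier_integral_schwartz_deriv)

abbreviation (input) fourier_times :: "schwartz \<Rightarrow> schwartz" where
  "fourier_times \<phi> \<equiv> schwartz_scale (- (2 * of_real pi * \<i>)) (schwartz_times \<phi>)"

lemma fourier_integral_weighted_bound:
  "\<bar>\<xi>\<bar> ^ a * cmod (fourier_integral (schwartz_fun \<phi>) \<xi>)
    \<le> (schwartz_seminorm 0 0 ((schwartz_deriv ^^ a) \<phi>) + schwartz_seminorm 2 0 ((schwartz_deriv ^^ a) \<phi>))
      * (LBINT x. inverse (1 + x\<^sup>2))"
proof -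
  have "\<bar>\<xi>\<bar> ^ a \<le> \<bar>2 * pi * \<xi>\<bar> ^ a"
  proof (intro power_mono)
    have "1 * \<bar>\<xi>\<bar> \<le> (2 * pi) * \<bar>\<xi>\<bar>"
      using pi_ge_two by (intro mult_right_mono) auto
    then show "\<bar>\<xi>\<bar> \<le> \<bar>2 * pi * \<xi>\<bar>" by (simp add: abs_mult)
  qed auto
  then have "\<bar>\<xi>\<bar> ^ a * cmod (fourier_integral (schwartz_fun \<phi>) \<xi>)
      \<le> \<bar>2 * pi * \<xi>\<bar> ^ a * cmod (fourier_integral (schwartz_fun \<phi>) \<xi>)"
    by (intro mult_right_mono) auto
  also have "\<dots> = cmod (fourier_integral (schwartz_fun ((schwartz_deriv ^^ a) \<phi>)) \<xi>)"
    by (simp add: fourier_integral_schwartz_deriv_funpow norm_mult norm_power abs_mult)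
  also note fourier_integral_bound
  finally show ?thesis .
qed

lift_definition schwartz_fourier :: "schwartz \<Rightarrow> schwartz" is fourier_integral
proof -
  fix f assume "f \<in> schwartz_functions"
  then obtain \<phi> where f: "f = schwartz_fun \<phi>"
    by (metis Schwartz_inverse)
  show "fourier_integral f \<in> schwartz_functions"
  proof (rule schwartz_functionsI[where F = "\<lambda>n. fourier_integral (schwartz_fun ((fourier_times ^^ n) \<phi>))"])
    show "(fourier_integral (schwartz_fun ((fourier_times ^^ n) \<phi>)) has_vector_derivative
        fourier_integral (schwartz_fun ((fourier_times ^^ Suc n) \<phi>)) \<xi>) (at \<xi>)" for n \<xi>
      using fourier_integral_deriv[of "(fourier_times ^^ n) \<phi>" \<xi>] by simp
    show "\<exists>C. \<forall>\<xi>. \<bar>\<xi>\<bar> ^ a * cmod (fourier_integral (schwartz_fun ((fourier_times ^^ b) \<phi>)) \<xi>) \<le> C" for a b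
      by (rule exI, rule allI, rule fourier_integral_weighted_bound)
  qed (simp add: f)
qed

lemma nth_vderiv_schwartz_fourier:
  "nth_vderiv n (schwartz_fun (schwartz_fourier \<phi>))
    = fourier_integral (schwartz_fun ((fourier_times ^^ n) \<phi>))"
  by (rule nth_vderiv_eqI[where F = "\<lambda>n. fourier_integral (schwartz_fun ((fourier_times ^^ n) \<phi>))"])
     (simp_all add: schwartz_fourier.rep_eq fourier_integral_deriv)

lemma seminorm_dominated_deriv: "seminorm_dominated (\<lambda>\<phi>. schwartz_seminorm a b (schwartz_deriv \<phi>))"
  by (simp add: schwartz_seminorm_deriv seminorm_dominated_seminorm)

lemma seminorm_dominated_fourier_times:
  "seminorm_dominated (\<lambda>\<phi>. schwartz_seminorm a b (fourier_times \<phi>))"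
proof (rule seminorm_dominated_compose[where L = schwartz_times
      and q = "\<lambda>\<phi>. schwartz_seminorm a b (schwartz_scale (- (2 * of_real pi * \<i>)) \<phi>)"])
  show "seminorm_dominated (\<lambda>\<phi>. schwartz_seminorm a b (schwartz_scale (- (2 * of_real pi * \<i>)) \<phi>))"
    by (rule seminorm_dominated_mono[OF seminorm_dominated_scale[OF seminorm_dominated_seminorm]
          schwartz_seminorm_scale]) auto
  show "seminorm_dominated (\<lambda>\<phi>. schwartz_seminorm a b (schwartz_times \<phi>))" for a b
    by (rule seminorm_dominated_mono[OF seminorm_dominated_add[OF seminorm_dominated_seminorm
          seminorm_dominated_scale[OF seminorm_dominated_seminorm]] schwartz_seminorm_times]) auto
qed

lemma seminorm_dominated_funpow:
  assumes "\<And>a b. seminorm_dominated (\<lambda>\<phi>. schwartz_seminorm a b (L \<phi>))"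
  shows "seminorm_dominated (\<lambda>\<phi>. schwartz_seminorm a b ((L ^^ n) \<phi>))"
proof (induction n arbitrary: a b)
  case (Suc n)
  show ?case
    using seminorm_dominated_compose[where q = "\<lambda>\<phi>. schwartz_seminorm a b (L \<phi>)" and L = "L ^^ n",
        OF assms Suc.IH]
    by simp
qed (simp add: seminorm_dominated_seminorm)

lemma seminorm_dominated_fourier:
  "seminorm_dominated (\<lambda>\<phi>. schwartz_seminorm a b (schwartz_fourier \<phi>))"
proof -
  define K where "K = (LBINT x::real. inverse (1 + x\<^sup>2))"
  have "K \<ge> 0" by (simp add: K_def)
  let ?q = "\<lambda>\<phi>. K * (schwartz_seminorm 0 0 ((schwartz_deriv ^^ a) \<phi>)
    + schwartz_seminorm 2 0 ((schwartz_deriv ^^ a) \<phi>))"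
  have "seminorm_dominated ?q"
    by (intro seminorm_dominated_scale seminorm_dominated_add seminorm_dominated_funpow
        seminorm_dominated_deriv \<open>K \<ge> 0\<close>)
  then have "seminorm_dominated (\<lambda>\<phi>. ?q ((fourier_times ^^ b) \<phi>))"
    by (rule seminorm_dominated_compose[where q = ?q and L = "fourier_times ^^ b"])
       (intro seminorm_dominated_funpow seminorm_dominated_fourier_times)
  then show ?thesis
  proof (rule seminorm_dominated_mono)
    show "schwartz_seminorm a b (schwartz_fourier \<phi>) \<le> ?q ((fourier_times ^^ b) \<phi>)" for \<phi>
    proof (rule schwartz_seminorm_least)
      fix \<xi>
      show "\<bar>\<xi>\<bar> ^ a * cmod (nth_vderiv b (schwartz_fun (schwartz_fourier \<phi>)) \<xi>)
          \<le> ?q ((fourier_times ^^ b) \<phi>)"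
        unfolding nth_vderiv_schwartz_fourier
        using fourier_integral_weighted_bound[of \<xi> a "(fourier_times ^^ b) \<phi>"]
        by (simp add: K_def mult.commute)
    qed
  qed
qed

lemma schwartz_fourier_add: "schwartz_fourier (\<phi> + \<psi>) = schwartz_fourier \<phi> + schwartz_fourier \<psi>"
proof -
  have "schwartz_fun (schwartz_fourier (\<phi> + \<psi>)) = schwartz_fun (schwartz_fourier \<phi> + schwartz_fourier \<psi>)"
    by (simp add: fun_eq_iff schwartz_fourier.rep_eq plus_schwartz.rep_eq fourier_integral_def
        distrib_left fourier_integrand_integrable)
  then show ?thesis by (simp add: schwartz_fun_inject)
qed

lemma schwartz_fourier_scale: "schwartz_fourier (schwartz_scale c \<phi>) = schwartz_scale c (schwartz_fourier \<phi>)"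
proof -
  have "schwartz_fun (schwartz_fourier (schwartz_scale c \<phi>)) = schwartz_fun (schwartz_scale c (schwartz_fourier \<phi>))"
    by (simp add: fun_eq_iff schwartz_fourier.rep_eq schwartz_scale.rep_eq fourier_integral_def
        mult.left_commute[of "cis _" c])
  then show ?thesis by (simp add: schwartz_fun_inject)
qed

lemma continuous_on_schwartz_fourier: "continuous_on UNIV schwartz_fourier"
  by (intro continuous_on_schwartzI schwartz_fourier_add seminorm_dominated_fourier)

abbreviation schwartz_reflect :: "schwartz \<Rightarrow> schwartz" where
  "schwartz_reflect \<equiv> schwartz_reflect_at 0"

lemma nth_vderiv_schwartz_reflect:
  "nth_vderiv n (schwartz_fun (schwartz_reflect \<phi>)) = (\<lambda>y. (- 1) ^ n * nth_vderiv n (schwartz_fun \<phi>) (- y))"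
proof (rule nth_vderiv_eqI[where F = "\<lambda>n y. (- 1) ^ n * nth_vderiv n (schwartz_fun \<phi>) (- y)"])
  fix n y
  have "((nth_vderiv n (schwartz_fun \<phi>) \<circ> uminus) has_vector_derivative
      (- 1) *\<^sub>R nth_vderiv (Suc n) (schwartz_fun \<phi>) (- y)) (at y)"
    by (intro vector_diff_chain_at schwartz_fun_deriv) (auto intro!: derivative_eq_intros)
  from has_vector_derivative_mult_right[OF this, of "(- 1) ^ n"]
  show "((\<lambda>y. (- 1) ^ n * nth_vderiv n (schwartz_fun \<phi>) (- y)) has_vector_derivative
      (- 1) ^ Suc n * nth_vderiv (Suc n) (schwartz_fun \<phi>) (- y)) (at y)"
    by (simp add: o_def del: nth_vderiv.simps)
qed (simp add: schwartz_reflect_at.rep_eq)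

lemma schwartz_reflect_add: "schwartz_reflect (\<phi> + \<psi>) = schwartz_reflect \<phi> + schwartz_reflect \<psi>"
  by (transfer, simp)

lemma schwartz_reflect_scale: "schwartz_reflect (schwartz_scale c \<phi>) = schwartz_scale c (schwartz_reflect \<phi>)"
  by (transfer, simp)

lemma continuous_on_schwartz_reflect: "continuous_on UNIV schwartz_reflect"
proof (intro continuous_on_schwartzI schwartz_reflect_add)
  fix a b
  show "seminorm_dominated (\<lambda>\<phi>. schwartz_seminorm a b (schwartz_reflect \<phi>))"
  proof (rule seminorm_dominated_mono[OF seminorm_dominated_seminorm])
    show "schwartz_seminorm a b (schwartz_reflect \<phi>) \<le> schwartz_seminorm a b \<phi>" for \<phi>
    proof (rule schwartz_seminorm_least)
      fix x
      show "\<bar>x\<bar> ^ a * cmod (nth_vderiv b (schwartz_fun (schwartz_reflect \<phi>)) x) \<le> schwartz_seminorm a b \<phi>"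
        using schwartz_seminorm_upper[of "- x" a b \<phi>]
        by (simp add: nth_vderiv_schwartz_reflect norm_mult norm_power)
    qed
  qed
qed

section \<open>Tempered distributions\<close>

typedef tempered = "{T :: schwartz \<Rightarrow> complex.
    (\<forall>\<phi> \<psi>. T (\<phi> + \<psi>) = T \<phi> + T \<psi>) \<and> (\<forall>c \<phi>. T (schwartz_scale c \<phi>) = c * T \<phi>) \<and>
    continuous_on UNIV T}"
  morphisms tempered_apply Tempered
  by (rule exI[of _ "\<lambda>_. 0"]) simp

setup_lifting type_definition_tempered

text \<open>The topology is the weak-* topology. Its Borel sets are those of the strong topology and
  are also generated by the evaluations.\<close>

instantiation tempered :: "{plus, topological_space}"
begin

lift_definition plus_tempered :: "tempered \<Rightarrow> tempered \<Rightarrow> tempered" is "\<lambda>S T \<phi>. S \<phi> + T \<phi>"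
  by (auto simp: algebra_simps intro!: continuous_on_add)

definition open_tempered :: "tempered set \<Rightarrow> bool" where
  "open_tempered = generate_topology {{T. tempered_apply T \<phi> \<in> U} | \<phi> U. open U}"

instance
  by standard (auto simp: open_tempered_def intro: generate_topology.intros)

end

lift_definition tempered_fourier :: "tempered \<Rightarrow> tempered" is "\<lambda>T \<phi>. T (schwartz_fourier \<phi>)"
  by (simp add: schwartz_fourier_add schwartz_fourier_scale
      continuous_on_compose2[OF _ continuous_on_schwartz_fourier subset_UNIV])

lift_definition tempered_reflect :: "tempered \<Rightarrow> tempered" is "\<lambda>T \<phi>. T (schwartz_reflect \<phi>)"
  by (simp add: schwartz_reflect_add schwartz_reflect_scale
      continuous_on_compose2[OF _ continuous_on_schwartz_reflect subset_UNIV])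

definition tempered_convolution :: "tempered \<Rightarrow> schwartz \<Rightarrow> real \<Rightarrow> complex" where
  "tempered_convolution T \<phi> x = tempered_apply T (schwartz_reflect_at x \<phi>)"

definition locally_integrable :: "(real \<Rightarrow> complex) \<Rightarrow> bool" where
  "locally_integrable g \<longleftrightarrow> (\<forall>K. compact K \<longrightarrow> set_integrable lborel K g)"

definition compactly_supported :: "schwartz \<Rightarrow> bool" where
  "compactly_supported \<phi> \<longleftrightarrow> compact (closure {x. schwartz_fun \<phi> x \<noteq> 0})"

text \<open>A locally integrable function need not be integrable against every Schwartz function, so
  functions are identified with distributions by testing against compactly supported ones.\<close>

definition given_by_function :: "tempered \<Rightarrow> (real \<Rightarrow> complex) \<Rightarrow> bool" where
  "given_by_function T g \<longleftrightarrow> locally_integrable g \<and>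
     (\<forall>\<phi>. compactly_supported \<phi> \<longrightarrow> tempered_apply T \<phi> = (LINT x|lborel. g x * schwartz_fun \<phi> x))"

definition equal_as_distributions :: "(real \<Rightarrow> complex) \<Rightarrow> (real \<Rightarrow> complex) \<Rightarrow> bool" where
  "equal_as_distributions f g \<longleftrightarrow>
     (\<forall>\<phi>. compactly_supported \<phi> \<longrightarrow>
        (LINT x|lborel. f x * schwartz_fun \<phi> x) = (LINT x|lborel. g x * schwartz_fun \<phi> x))"

text \<open>The Fourier transform of a tempered distribution as a function, which is determined up to
  Lebesgue null sets; meaningful only if it is locally integrable.\<close>

definition fourier_function :: "tempered \<Rightarrow> real \<Rightarrow> complex" where
  "fourier_function \<epsilon> = (SOME g. given_by_function (tempered_fourier \<epsilon>) g)"

definition admissible :: "tempered \<Rightarrow> bool" where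
  "admissible \<epsilon> \<longleftrightarrow> (\<exists>g. given_by_function (tempered_fourier \<epsilon>) g) \<and>
     (\<forall>\<phi>. integrable lborel
        (\<lambda>x. (cmod (fourier_function \<epsilon> x))\<^sup>2 * (cmod (schwartz_fun (schwartz_fourier \<phi>) x))\<^sup>2))"

section \<open>Complex Gaussian families and Ito measures\<close>

definition circular_gaussian_vector :: "'w measure \<Rightarrow> nat \<Rightarrow> (nat \<Rightarrow> 'w \<Rightarrow> complex) \<Rightarrow> bool" where
  "circular_gaussian_vector M n Y \<longleftrightarrow>
     prob_space.indep_vars M (\<lambda>_. borel) Y {..<n} \<and>
     (\<forall>k<n. prob_space.indep_var M borel (\<lambda>\<omega>. Re (Y k \<omega>)) borel (\<lambda>\<omega>. Im (Y k \<omega>)) \<and>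
        (\<exists>\<sigma>>0. distributed M lborel (\<lambda>\<omega>. Re (Y k \<omega>)) (normal_density 0 \<sigma>) \<and>
               distributed M lborel (\<lambda>\<omega>. Im (Y k \<omega>)) (normal_density 0 \<sigma>)))"

definition centered_complex_gaussian :: "'w measure \<Rightarrow> 'i set \<Rightarrow> ('i \<Rightarrow> 'w \<Rightarrow> complex) \<Rightarrow> bool" where
  "centered_complex_gaussian M I X \<longleftrightarrow>
     (\<forall>i\<in>I. X i \<in> borel_measurable M) \<and>
     (\<forall>J. finite J \<and> J \<subseteq> I \<longrightarrow>
        (\<exists>n (A :: 'i \<Rightarrow> nat \<Rightarrow> complex) Y. circular_gaussian_vector M n Y \<and>
           (\<forall>i\<in>J. AE \<omega> in M. X i \<omega> = (\<Sum>k<n. A i k * Y k \<omega>))))"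

definition complex_gaussian :: "'w measure \<Rightarrow> 'i set \<Rightarrow> ('i \<Rightarrow> 'w \<Rightarrow> complex) \<Rightarrow> bool" where
  "complex_gaussian M I X \<longleftrightarrow> (\<exists>m. centered_complex_gaussian M I (\<lambda>i \<omega>. X i \<omega> - m i))"

definition complex_gaussian_object :: "'w measure \<Rightarrow> ('w \<Rightarrow> tempered) \<Rightarrow> bool" where
  "complex_gaussian_object M \<xi> \<longleftrightarrow> \<xi> \<in> borel_measurable M \<and>
     complex_gaussian M UNIV (\<lambda>\<phi> \<omega>. tempered_apply (\<xi> \<omega>) \<phi>)"

definition ito_measure :: "'w measure \<Rightarrow> (real \<Rightarrow> real) \<Rightarrow> (real set \<Rightarrow> 'w \<Rightarrow> complex) \<Rightarrow> bool" where
  "ito_measure M v m \<longleftrightarrow>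
     centered_complex_gaussian M {B \<in> sets borel. bounded B} m \<and>
     (\<forall>B1\<in>sets borel. \<forall>B2\<in>sets borel. bounded B1 \<and> bounded B2 \<longrightarrow>
        (LINT \<omega>|M. m B1 \<omega> * cnj (m B2 \<omega>)) = measure (density lborel v) (B1 \<inter> B2))"

definition square_integrable :: "(real \<Rightarrow> complex) set" where
  "square_integrable = {f \<in> borel_measurable borel. integrable lborel (\<lambda>x. (cmod (f x))\<^sup>2)}"

text \<open>The square integrable family extending an Ito measure with constant variance function \<open>v\<close>; the
  measure itself is recovered from the indicator functions.\<close>

definition ito_family :: "'w measure \<Rightarrow> real \<Rightarrow> ((real \<Rightarrow> complex) \<Rightarrow> 'w \<Rightarrow> complex) \<Rightarrow> bool" where
  "ito_family M v \<mu> \<longleftrightarrow>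
     ito_measure M (\<lambda>_. v) (\<lambda>B. \<mu> (indicator B)) \<and>
     centered_complex_gaussian M square_integrable \<mu> \<and>
     (\<forall>f\<in>square_integrable. \<forall>g\<in>square_integrable. \<forall>a b.
        AE \<omega> in M. \<mu> (\<lambda>x. a * f x + b * g x) \<omega> = a * \<mu> f \<omega> + b * \<mu> g \<omega>) \<and>
     (\<forall>f\<in>square_integrable. \<forall>g\<in>square_integrable.
        (LINT \<omega>|M. \<mu> f \<omega> * cnj (\<mu> g \<omega>)) = v * (LINT x|lborel. f x * cnj (g x)))"

section \<open>Conditional distributions\<close>

definition regular_conditional_distribution ::
  "'w measure \<Rightarrow> 'a measure \<Rightarrow> ('w \<Rightarrow> 'a) \<Rightarrow> 'b measure \<Rightarrow> ('w \<Rightarrow> 'b) \<Rightarrow> ('b \<Rightarrow> 'a measure) \<Rightarrow> bool" where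
  "regular_conditional_distribution P N X L Y \<kappa> \<longleftrightarrow>
     \<kappa> \<in> measurable L (prob_algebra N) \<and>
     (\<forall>A\<in>sets N. \<forall>B\<in>sets L.
        emeasure P {\<omega> \<in> space P. X \<omega> \<in> A \<and> Y \<omega> \<in> B} = (\<integral>\<^sup>+ y\<in>B. emeasure (\<kappa> y) A \<partial>distr P L Y))"

definition independent_rvs ::
  "'w measure \<Rightarrow> 'a measure \<Rightarrow> ('w \<Rightarrow> 'a) \<Rightarrow> 'b measure \<Rightarrow> ('w \<Rightarrow> 'b) \<Rightarrow> bool" where
  "independent_rvs P N X L Y \<longleftrightarrow>
     prob_space.indep_set P (sets (vimage_algebra (space P) X N)) (sets (vimage_algebra (space P) Y L))"

abbreviation ito_space :: "((real \<Rightarrow> complex) \<Rightarrow> complex) measure" where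
  "ito_space \<equiv> Pi\<^sub>M square_integrable (\<lambda>_. borel)"

abbreviation ito_sample :: "((real \<Rightarrow> complex) \<Rightarrow> 'w \<Rightarrow> complex) \<Rightarrow> 'w \<Rightarrow> (real \<Rightarrow> complex) \<Rightarrow> complex" where
  "ito_sample \<mu> \<omega> \<equiv> (\<lambda>f\<in>square_integrable. \<mu> f \<omega>)"

definition ito_measure_given ::
  "'w measure \<Rightarrow> ('w \<Rightarrow> real) \<Rightarrow> ((real \<Rightarrow> complex) \<Rightarrow> 'w \<Rightarrow> complex) \<Rightarrow> bool" where
  "ito_measure_given P s \<mu> \<longleftrightarrow>
     (\<forall>f\<in>square_integrable. \<mu> f \<in> borel_measurable P) \<and>
     (\<exists>\<kappa>. regular_conditional_distribution P ito_space (ito_sample \<mu>) borel s \<kappa> \<and>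
        (AE v in distr P borel s. ito_family (\<kappa> v) v (\<lambda>f x. x f)))"

text \<open>As \<open>\<mu> f\<close> is only determined almost surely for each \<open>f\<close>, the convolution of \<open>\<epsilon>\<close> with \<open>\<mu>\<close> is a
  random tempered distribution that agrees with it almost surely on each Schwartz function.\<close>

definition random_convolution ::
  "'w measure \<Rightarrow> tempered \<Rightarrow> ((real \<Rightarrow> complex) \<Rightarrow> 'w \<Rightarrow> complex) \<Rightarrow> ('w \<Rightarrow> tempered) \<Rightarrow> bool" where
  "random_convolution P \<epsilon> \<mu> \<eta> \<longleftrightarrow> \<eta> \<in> borel_measurable P \<and>
     (\<forall>\<phi>. AE \<omega> in P. tempered_apply (\<eta> \<omega>) \<phi> = \<mu> (tempered_convolution (tempered_reflect \<epsilon>) \<phi>) \<omega>)"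

definition posterior_variance :: "real measure \<Rightarrow> ennreal" where
  "posterior_variance \<nu> = (\<integral>\<^sup>+ a. \<integral>\<^sup>+ b. ennreal ((a - b)\<^sup>2) \<partial>\<nu> \<partial>\<nu>) / 2"

end

theory Submission
  imports Defs
begin

text \<open>
  The observation enters the posterior only through the joint law of \<open>s\<close> and \<open>z\<close>. Once \<open>(s, z1)\<close> and \<open>(s, z2)\<close>
  have the same law, \<open>\<nu>1\<close> and \<open>\<nu>2\<close> are conditional distributions for one and the same joint law, so they coincide
  almost everywhere (\<open>regular_conditional_distribution_unique\<close>), and with them their variances.

  To compare the joint laws it is enough to compare, for each event \<open>s \<in> A\<close> and each single Schwartz function \<open>\<phi>\<close>, the
  expectations of \<open>indicator A s * cis (Re (z \<phi>))\<close> (\<open>tempered_measure_eqI\<close>). Behind this are two facts: a finite measure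
  is determined by its characteristic functional on a vector space of functions that generates the \<open>\<sigma>\<close>-algebra
  (\<open>finite_measure_eqI_characteristic_functional\<close>), and the Borel sets of the weak-* topology are generated by the
  evaluations (\<open>sets_borel_tempered\<close>).

  By independence, such an expectation is the product of the characteristic functional of the noise, which is the
  same for both observations, and the expectation of \<open>indicator A s * cis (Re (\<mu> f))\<close>, where \<open>f\<close> is the convolution of the
  reflected waveform with \<open>\<phi>\<close> (\<open>characteristic_functional_of_observation\<close>). Given \<open>s = v\<close>, the variable \<open>\<mu> f\<close> is
  circular Gaussian, so the law of its real part depends on \<open>f\<close> only through the second moment, which is \<open>v\<close> times
  the squared norm of \<open>f\<close> (\<open>ito_measure_given_Re_law_eq\<close>). It remains to see that this norm depends only on the
  modulus of the Fourier transform of the waveform.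

  Let \<open>g\<close> be the Fourier transform of the waveform and let \<open>\<phi>\<close> be the Fourier transform of \<open>\<psi>\<close>. Then \<open>f\<close> is the Fourier
  integral of \<open>g \<psi>\<close> (\<open>tempered_convolution_reflect_fourier\<close>), a function which is integrable and square
  integrable, so the Plancherel theorem (\<open>fourier_plancherel\<close>) gives the squared norm of \<open>f\<close> as the integral of
  \<open>|g|\<^sup>2 |\<psi>|\<^sup>2\<close>. Equality of the moduli as distributions is equality almost everywhere
  (\<open>AE_eq_if_equal_as_distributions\<close>), hence the two norms agree (\<open>tempered_convolution_norm_eq\<close>).
\<close>

section \<open>Characteristic functionals of finite measures\<close>

lemma cis_measurable [measurable]: "cis \<in> borel_measurable borel"
  by (intro borel_measurable_continuous_onI continuous_intros)

lemma cnj_measurable [measurable]: "cnj \<in> borel_measurable borel"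
  by (intro borel_measurable_continuous_onI continuous_intros)

text \<open>Levy's uniqueness theorem speaks of probability measures. The value of the transform at frequency zero
  is the total mass, so dividing by it carries the theorem over to finite measures.\<close>

lemma finite_measure_eqI_fourier:
  fixes M N :: "real measure"
  assumes "finite_measure M" "finite_measure N" and [measurable_cong]: "sets M = sets borel" "sets N = sets borel"
    and eq: "\<And>t. (LINT x|M. cis (t * x)) = (LINT x|N. cis (t * x))"
  shows "M = N"
proof -
  interpret M: finite_measure M by fact
  interpret N: finite_measure N by fact
  have spc: "space M = UNIV" "space N = UNIV"
    using assms(3,4)[THEN sets_eq_imp_space_eq] by auto
  define m where "m = measure M UNIV"
  have mN: "measure N UNIV = m"
    using eq[of 0] by (simp add: spc m_def)
  show ?thesis
  proof (cases "m = 0")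
    case True
    show ?thesis
    proof (rule measure_eqI)
      fix A assume "A \<in> sets M"
      have "emeasure M A \<le> emeasure M (space M)" "emeasure N A \<le> emeasure N (space N)"
        by (rule emeasure_space)+
      then show "emeasure M A = emeasure N A"
        using True mN by (simp add: spc M.emeasure_eq_measure N.emeasure_eq_measure m_def measure_le_0_iff)
    qed (simp add: assms)
  next
    case False
    then have m: "m > 0" using measure_nonneg[of M UNIV] by (simp add: m_def less_le)
    let ?D = "\<lambda>K. density K (\<lambda>_. ennreal (1 / m))"
    have distr: "real_distribution (?D K)"
      if "finite_measure K" "sets K = sets borel" "measure K UNIV = m" for K :: "real measure"
    proof -
      interpret K: finite_measure K by fact
      have "space K = UNIV" using that(2)[THEN sets_eq_imp_space_eq] by simp
      moreover have "emeasure (?D K) (space K) = 1"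
        using that m \<open>space K = UNIV\<close>
        by (subst emeasure_density_const)
           (auto simp: K.emeasure_eq_measure ennreal_mult[symmetric])
      ultimately have "prob_space (?D K)"
        by (intro prob_spaceI) simp
      then show ?thesis
        using that \<open>space K = UNIV\<close>
        by (simp add: real_distribution_def real_distribution_axioms_def)
    qed
    have "?D M = ?D N"
    proof (rule Levy_uniqueness)
      have char: "char (?D K) t = (1 / m) *\<^sub>R (LINT x|K. cis (t * x))"
        if [measurable_cong]: "sets K = sets borel" for K :: "real measure" and t
        unfolding char_def using m by (subst integral_density) (auto simp: cis_conv_exp)
      show "char (?D M) = char (?D N)"
        by (rule ext) (simp add: char assms)
    qed (auto intro!: distr assms simp: m_def[symmetric] mN)
    then have *: "emeasure (?D M) A = emeasure (?D N) A" for A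
      by simp
    show ?thesis
    proof (rule measure_eqI)
      fix A assume A: "A \<in> sets M"
      have "ennreal (1 / m) * emeasure M A = ennreal (1 / m) * emeasure N A"
        using *[of A] A assms by (simp add: emeasure_density_const)
      then show "emeasure M A = emeasure N A"
        using m by (simp add: M.emeasure_eq_measure N.emeasure_eq_measure ennreal_mult[symmetric])
    qed (simp add: assms)
  qed
qed

text \<open>One-dimensional uniqueness, applied to the image under \<open>X\<close> of the measure with density \<open>w\<close>.\<close>

lemma integral_indicator_eqI_fourier:
  fixes X w :: "'a \<Rightarrow> real"
  assumes "finite_measure M" "finite_measure N" and sets: "sets M = sets N"
    and [measurable]: "X \<in> borel_measurable N" "w \<in> borel_measurable N" "C \<in> sets borel"
    and w: "\<And>x. 0 \<le> w x" "\<And>x. w x \<le> B"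
    and eq: "\<And>t. (LINT x|M. w x * cis (t * X x)) = (LINT x|N. w x * cis (t * X x))"
  shows "(LINT x|M. w x * indicator C (X x)) = (LINT x|N. w x * indicator C (X x))"
proof -
  let ?D = "\<lambda>K. distr (density K (\<lambda>x. ennreal (w x))) borel X"
  note [measurable_cong] = sets
  have fin: "finite_measure (?D K)" if "finite_measure K" and [measurable_cong]: "sets K = sets N" for K
  proof -
    interpret finite_measure K by fact
    have "emeasure (density K (\<lambda>x. ennreal (w x))) (space K) = (\<integral>\<^sup>+ x. ennreal (w x) \<partial>K)"
      by (subst emeasure_density) (auto intro!: nn_integral_cong)
    also have "\<dots> \<le> (\<integral>\<^sup>+ x. ennreal B \<partial>K)"
      by (intro nn_integral_mono ennreal_leI w)
    also have "\<dots> < \<infinity>"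
      by (simp add: emeasure_eq_measure ennreal_mult_less_top)
    finally have "finite_measure (density K (\<lambda>x. ennreal (w x)))"
      by (intro finite_measureI) auto
    then show ?thesis
      by (rule finite_measure.finite_measure_distr) simp
  qed
  have cf: "(LINT y|?D K. cis (t * y)) = (LINT x|K. w x * cis (t * X x))"
    if [measurable_cong]: "sets K = sets N" for K t
    using w by (simp add: integral_distr integral_density scaleR_conv_of_real)
  have "?D M = ?D N"
    by (rule finite_measure_eqI_fourier) (simp_all only: fin cf assms sets_distr refl)
  moreover have "(LINT y|?D K. indicator C y) = (LINT x|K. w x * indicator C (X x))"
    if [measurable_cong]: "sets K = sets N" for K
    using w by (subst integral_distr) (auto simp: integral_density)
  ultimately show ?thesis
    using sets by metis
qed

text \<open>The joint law of several functions is reached from one-dimensional uniqueness by trading, one function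
  at a time, a factor \<open>cis (t * f)\<close> for an indicator of \<open>f\<close>. All other factors are kept as a weight, and \<open>t\<close> is
  free because \<open>V\<close> is closed under linear combinations. The weight has to be nonnegative, so the remaining factor
  is split as \<open>cis g = (1 + cos g) + \<i> * (1 + sin g) - (1 + \<i>)\<close>.\<close>

lemma finite_measure_eqI_characteristic_functional:
  fixes V :: "('a \<Rightarrow> real) set"
  assumes fin: "finite_measure M" "finite_measure N" and sets: "sets M = sets N"
    and gen: "sets N = sigma_sets (space N) {f -` C \<inter> space N | f C. f \<in> V \<and> C \<in> sets borel}"
    and V: "\<And>f g t. f \<in> V \<Longrightarrow> g \<in> V \<Longrightarrow> (\<lambda>x. f x + t * g x) \<in> V" "(\<lambda>_. 0) \<in> V"
    and eq: "\<And>f. f \<in> V \<Longrightarrow> (LINT x|M. cis (f x)) = (LINT x|N. cis (f x))"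
  shows "M = N"
proof -
  interpret M: finite_measure M by fact
  interpret N: finite_measure N by fact
  note [measurable_cong] = sets
  have Vmeas: "f \<in> borel_measurable N" if "f \<in> V" for f
    using that by (intro measurableI) (auto intro!: sigma_sets.Basic simp only: gen space_borel)
  \<comment> \<open>indexed by lists, since the induction adds one pair of a function and a set at a time\<close>
  define w where "w L x = (\<Prod>(f, C)\<leftarrow>L. indicator C (f x) :: real)" for L :: "(('a \<Rightarrow> real) \<times> real set) list" and x
  have w01: "0 \<le> w L x" "w L x \<le> 1" for L x
  proof -
    have "0 \<le> w L x \<and> w L x \<le> 1"
      by (induction L) (auto simp: w_def indicator_def)
    then show "0 \<le> w L x" "w L x \<le> 1" by auto
  qed
  have wmeas: "w L \<in> borel_measurable N" if "set L \<subseteq> V \<times> sets borel" for L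
    using that
  proof (induction L)
    case (Cons fC L)
    obtain f C where [simp]: "fC = (f, C)" by force
    have [measurable]: "f \<in> borel_measurable N" "C \<in> sets borel" "w L \<in> borel_measurable N"
      using Cons Vmeas by auto
    have "w (fC # L) = (\<lambda>x. indicator C (f x) * w L x)"
      by (simp add: w_def fun_eq_iff)
    then show ?case by simp
  qed (simp add: w_def[abs_def])
  have main: "(LINT x|M. w L x * cis (g x)) = (LINT x|N. w L x * cis (g x))"
    if "set L \<subseteq> V \<times> sets borel" "g \<in> V" for L g
    using that
  proof (induction L arbitrary: g)
    case Nil
    then show ?case using eq by (simp add: w_def)
  next
    case (Cons fC L)
    obtain f C where fC [simp]: "fC = (f, C)" by force
    have L: "set L \<subseteq> V \<times> sets borel" and f: "f \<in> V" and [measurable]: "C \<in> sets borel"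
      using Cons.prems by auto
    note [measurable] = Vmeas[OF f] Vmeas[OF \<open>g \<in> V\<close>] wmeas[OF L]
    have tf: "(\<lambda>x. t * f x) \<in> V" "(\<lambda>x. g x + t * f x) \<in> V" "(\<lambda>x. t * f x - g x) \<in> V" for t
      using V(1)[OF V(2) f, of t] V(1)[OF \<open>g \<in> V\<close> f, of t] V(1)[OF V(1)[OF V(2) f, of t] \<open>g \<in> V\<close>, of "-1"]
      by auto
    have int: "integrable K (\<lambda>x. w L x * cis (h x))"
      if "finite_measure K" and [measurable_cong]: "sets K = sets N" and [measurable]: "h \<in> borel_measurable N"
      for K and h :: "'a \<Rightarrow> real"
      using w01[of L] that(1) by (intro finite_measure.integrable_const_bound[of K _ 1]) (auto simp: norm_mult)
    have eqL: "(LINT x|M. w L x * cis (h x)) = (LINT x|N. w L x * cis (h x))" if "h \<in> V" for h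
      using Cons.IH[OF L that] by simp
    let ?A = "\<lambda>c x. w L x * (1 + Re (c * cis (g x)))"
    let ?J = "\<lambda>c x. ?A c x * indicator C (f x)"
    let ?L = "\<lambda>K c. LINT x|K. ?J c x"
    have A: "0 \<le> ?A c x" "?A c x \<le> 2" if "cmod c \<le> 1" for c x
    proof -
      have "\<bar>Re (c * cis (g x))\<bar> \<le> 1"
        using abs_Re_le_cmod[of "c * cis (g x)"] that by (simp only: norm_mult norm_cis)
      then have "0 \<le> 1 + Re (c * cis (g x))" "1 + Re (c * cis (g x)) \<le> 2" by linarith+
      then show "0 \<le> ?A c x" "?A c x \<le> 2"
        using w01[of L x] mult_mono[of "w L x" 1 "1 + Re (c * cis (g x))" 2] by simp_all
    qed
    have split: "(LINT x|K. ?A c x * cis (t * f x)) = (LINT x|K. w L x * cis (t * f x))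
          + (c / 2 * (LINT x|K. w L x * cis (g x + t * f x)) + cnj c / 2 * (LINT x|K. w L x * cis (t * f x - g x)))"
      if K: "finite_measure K" and KN [measurable_cong]: "sets K = sets N" for K t c
    proof -
      have "?A c x * cis (t * f x) = w L x * cis (t * f x)
          + (c / 2 * (w L x * cis (g x + t * f x)) + cnj c / 2 * (w L x * cis (t * f x - g x)))" for x
        by (simp add: complex_eq_iff cos_add cos_diff sin_add sin_diff algebra_simps) (simp add: field_simps)?
      then show ?thesis using K KN by (simp add: int)
    qed
    have A_eq: "?L M c = ?L N c"
      if c: "cmod c \<le> 1" for c
    proof (rule integral_indicator_eqI_fourier[OF fin sets _ _ _ A[OF c]])
      show "(LINT x|M. ?A c x * cis (t * f x)) = (LINT x|N. ?A c x * cis (t * f x))" for t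
        by (simp only: split[OF fin(1) sets] split[OF fin(2) refl] eqL tf)
    qed measurable
    \<comment> \<open>the weights for \<open>c\<close> equal to 1, 0 and \<open>- \<i>\<close> recombine to the factor \<open>cis (g x)\<close>\<close>
    have dec: "(LINT x|K. w (fC # L) x * cis (g x))
        = Complex (?L K 1 - ?L K 0)
            (?L K (- \<i>) - ?L K 0)"
      if K: "finite_measure K" and [measurable_cong]: "sets K = sets N" for K
    proof -
      have i: "integrable K (\<lambda>x. ?J c x)" if "cmod c \<le> 1" for c
        using A[OF that] by (intro finite_measure.integrable_const_bound[OF K, of _ 2]) (auto simp: indicator_def abs_of_nonneg)
      have "w (fC # L) x * cis (g x) = of_real (?J 1 x - ?J 0 x)
          + \<i> * of_real (?J (- \<i>) x - ?J 0 x)" for x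
        by (simp add: w_def complex_eq_iff algebra_simps)
      then have "(LINT x|K. w (fC # L) x * cis (g x))
          = (LINT x|K. of_real (?J 1 x - ?J 0 x)
            + \<i> * of_real (?J (- \<i>) x - ?J 0 x))"
        by (simp only:)
      also have "\<dots> = of_real (LINT x|K. ?J 1 x - ?J 0 x)
          + \<i> * of_real (LINT x|K. ?J (- \<i>) x - ?J 0 x)"
        by (subst Bochner_Integration.integral_add)
          (auto simp only: integral_complex_of_real integral_mult_right_zero norm_one norm_zero norm_minus_cancel norm_ii
            order_refl zero_le_one intro!: i integrable_of_real integrable_mult_right Bochner_Integration.integrable_diff)
      also have "\<dots> = Complex (?L K 1 - ?L K 0)
            (?L K (- \<i>) - ?L K 0)"
        unfolding Complex_eq
        by (subst (1 2) Bochner_Integration.integral_diff) (auto simp only: norm_one norm_zero norm_minus_cancel norm_ii order_refl zero_le_one intro!: i)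
      finally show ?thesis .
    qed
    show ?case
      unfolding dec[OF fin(1) sets] dec[OF fin(2) refl] by (subst (1 2 3 4) A_eq) simp_all
  qed
  let ?E = "{(\<Inter>(f, C)\<in>set L. f -` C) \<inter> space N | L. set L \<subseteq> V \<times> sets borel}"
  have wint: "w L x = indicator (\<Inter>(f, C)\<in>set L. f -` C) x" for L x
    unfolding w_def by (induction L) (auto simp: indicator_def)
  have Emeas: "E \<in> sets N" if "E \<in> ?E" for E
  proof -
    from that obtain L where L: "E = (\<Inter>(f, C)\<in>set L. f -` C) \<inter> space N" "set L \<subseteq> V \<times> sets borel" by auto
    have "E = w L -` {1} \<inter> space N" by (auto simp: L wint indicator_def)
    then show ?thesis using wmeas[OF L(2)] by simp
  qed
  have sp: "space M = space N" using sets by (rule sets_eq_imp_space_eq)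
  show ?thesis
  proof (rule measure_eqI_generator_eq_countable[where E = ?E and \<Omega> = "space N" and A = "{space N}"])
    show "Int_stable ?E"
    proof (rule Int_stableI)
      fix a b assume "a \<in> ?E" "b \<in> ?E"
      then obtain L L' where "a = (\<Inter>(f, C)\<in>set L. f -` C) \<inter> space N" "set L \<subseteq> V \<times> sets borel"
        "b = (\<Inter>(f, C)\<in>set L'. f -` C) \<inter> space N" "set L' \<subseteq> V \<times> sets borel" by auto
      then show "a \<inter> b \<in> ?E" by (intro CollectI exI[of _ "L @ L'"]) auto
    qed
    show "sets N = sigma_sets (space N) ?E"
    proof (rule antisym)
      show "sets N \<subseteq> sigma_sets (space N) ?E"
        unfolding gen
      proof (rule sigma_sets_mono')
        show "{f -` C \<inter> space N |f C. f \<in> V \<and> C \<in> sets borel} \<subseteq> ?E"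
        proof safe
          fix f and C :: "real set" assume "f \<in> V" "C \<in> sets borel"
          then show "\<exists>L. f -` C \<inter> space N = (\<Inter>(f, C)\<in>set L. f -` C) \<inter> space N \<and> set L \<subseteq> V \<times> sets borel"
            by (intro exI[of _ "[(f, C)]"]) auto
        qed
      qed
      show "sigma_sets (space N) ?E \<subseteq> sets N"
        by (intro sets.sigma_sets_subset subsetI Emeas)
    qed
    then show "sets M = sigma_sets (space N) ?E" by (rule trans[OF sets])
    fix E assume "E \<in> ?E"
    then obtain L where L: "E = (\<Inter>(f, C)\<in>set L. f -` C) \<inter> space N" "set L \<subseteq> V \<times> sets borel" by auto
    have "measure K E = Re (LINT x|K. w L x * cis 0)" if "sets K = sets N" for K
    proof -
      have "space K = space N" using that by (rule sets_eq_imp_space_eq)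
      then have "(LINT x|K. w L x) = (LINT x|K. indicator E x)"
        by (intro Bochner_Integration.integral_cong) (auto simp: wint L indicator_def)
      then show ?thesis
        using Emeas[OF \<open>E \<in> ?E\<close>] that by simp
    qed
    then have "measure M E = measure N E"
      using main[OF L(2) V(2)] sets by simp
    then show "emeasure M E = emeasure N E"
      by (simp add: M.emeasure_eq_measure N.emeasure_eq_measure)
  next
    show "{space N} \<subseteq> ?E" by (auto intro!: exI[of _ "[]"])
    show "\<And>a. a \<in> {space N} \<Longrightarrow> emeasure M a \<noteq> \<infinity>"
      by (simp add: M.emeasure_eq_measure)
  qed (simp_all, blast)
qed

section \<open>The Borel sets of the space of tempered distributions\<close>

abbreviation schwartz_weight :: "nat \<Rightarrow> nat \<Rightarrow> schwartz \<Rightarrow> schwartz" where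
  "schwartz_weight a b \<phi> \<equiv> (schwartz_times ^^ a) ((schwartz_deriv ^^ b) \<phi>)"

definition schwartz_norm :: "nat \<Rightarrow> schwartz \<Rightarrow> real" where
  "schwartz_norm N \<phi> = (\<Sum>a\<le>N. \<Sum>b\<le>N. schwartz_seminorm a b \<phi>)"

text \<open>A finite record of \<open>\<theta>\<close>: its values on the part of the grid of mesh \<open>1/n\<close> that lies in \<open>[-n, n]\<close>, rounded
  down to multiples of \<open>1/n\<close>.\<close>

definition schwartz_code :: "nat \<Rightarrow> schwartz \<Rightarrow> (int \<times> int) list" where
  "schwartz_code n \<theta> = map (\<lambda>k. (\<lfloor>n * Re (schwartz_fun \<theta> (k / n))\<rfloor>, \<lfloor>n * Im (schwartz_fun \<theta> (k / n))\<rfloor>))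
     [- (int n)\<^sup>2..(int n)\<^sup>2]"

lemma schwartz_fun_deriv_funpow: "schwartz_fun ((schwartz_deriv ^^ b) \<phi>) = nth_vderiv b (schwartz_fun \<phi>)"
  by (induction b) (auto simp: schwartz_deriv.rep_eq)

lemma schwartz_fun_times_funpow: "schwartz_fun ((schwartz_times ^^ a) \<phi>) x = of_real x ^ a * schwartz_fun \<phi> x"
  by (induction a) (auto simp: schwartz_times.rep_eq)

lemma schwartz_fun_weight: "schwartz_fun (schwartz_weight a b \<phi>) x = of_real x ^ a * nth_vderiv b (schwartz_fun \<phi>) x"
  by (simp add: schwartz_fun_times_funpow schwartz_fun_deriv_funpow)

lemma nth_vderiv_diff:
  "nth_vderiv n (schwartz_fun (\<phi> - \<psi>)) x = nth_vderiv n (schwartz_fun \<phi>) x - nth_vderiv n (schwartz_fun \<psi>) x"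
  using nth_vderiv_add[of n "\<phi> - \<psi>" \<psi> x] by simp

lemma schwartz_seminorm_minus_commute: "schwartz_seminorm a b (\<phi> - \<psi>) = schwartz_seminorm a b (\<psi> - \<phi>)"
  by (simp add: schwartz_seminorm_def nth_vderiv_diff norm_minus_commute)

lemma schwartz_fun_lipschitz:
  "cmod (schwartz_fun \<theta> x - schwartz_fun \<theta> y) \<le> schwartz_seminorm 0 1 \<theta> * \<bar>x - y\<bar>"
proof -
  have "norm (schwartz_fun \<theta> x - schwartz_fun \<theta> y) \<le> schwartz_seminorm 0 1 \<theta> * norm (x - y)"
  proof (rule differentiable_bound[of UNIV _ "\<lambda>x h. h *\<^sub>R nth_vderiv 1 (schwartz_fun \<theta>) x"])
    show "(schwartz_fun \<theta> has_derivative (\<lambda>h. h *\<^sub>R nth_vderiv 1 (schwartz_fun \<theta>) x)) (at x within UNIV)" for x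
      using schwartz_fun_deriv[of 0 \<theta> x] by (simp add: has_vector_derivative_def)
    show "onorm (\<lambda>h. h *\<^sub>R nth_vderiv 1 (schwartz_fun \<theta>) x) \<le> schwartz_seminorm 0 1 \<theta>" for x
      using schwartz_seminorm_upper[of x 0 1 \<theta>]
      by (intro onorm_le) (simp add: mult.commute[of "\<bar>_\<bar>"] mult_right_mono)
  qed auto
  then show ?thesis by simp
qed

text \<open>Outside \<open>[-n, n]\<close> the decay bound makes both functions small; inside, the derivative bound controls
  them between neighbouring grid points, where they are known up to \<open>1/n\<close>.\<close>

lemma schwartz_code_eq_imp_close:
  assumes n: "n > 0" and code: "schwartz_code n \<theta> = schwartz_code n \<theta>'"
    and M: "schwartz_seminorm 1 0 \<theta> \<le> M" "schwartz_seminorm 0 1 \<theta> \<le> M"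
      "schwartz_seminorm 1 0 \<theta>' \<le> M" "schwartz_seminorm 0 1 \<theta>' \<le> M"
  shows "cmod (schwartz_fun \<theta> x - schwartz_fun \<theta>' x) \<le> (2 + 2 * M) / n"
proof (cases "\<bar>x\<bar> \<ge> n")
  case True
  have *: "cmod (schwartz_fun \<eta> x) \<le> M / n" if "schwartz_seminorm 1 0 \<eta> \<le> M" for \<eta>
  proof -
    have "n * cmod (schwartz_fun \<eta> x) \<le> \<bar>x\<bar> * cmod (schwartz_fun \<eta> x)"
      using True by (intro mult_right_mono) auto
    also have "\<dots> \<le> M"
      using schwartz_seminorm_upper[of x 1 0 \<eta>] that by simp
    finally show ?thesis using n by (simp add: field_simps)
  qed
  have "cmod (schwartz_fun \<theta> x - schwartz_fun \<theta>' x) \<le> M / n + M / n"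
    by (rule order_trans[OF norm_triangle_ineq4]) (intro add_mono * M)
  also have "\<dots> \<le> (2 + 2 * M) / n"
    using n by (simp add: field_simps)
  finally show ?thesis .
next
  case False
  \<comment> \<open>the grid point to the left of \<open>x\<close>\<close>
  define k where "k = \<lfloor>n * x\<rfloor>"
  have k: "of_int k \<le> n * x" "n * x < of_int k + 1" by (simp_all add: k_def)
  have close: "\<bar>x - k / n\<bar> \<le> 1 / n"
  proof -
    have "n * (x - k / n) = n * x - k" using n by (simp add: field_simps)
    then have "\<bar>n * (x - k / n)\<bar> \<le> 1" using k by simp
    then have "real n * \<bar>x - k / n\<bar> \<le> 1" by (simp only: abs_mult abs_of_nat)
    then show ?thesis using n by (subst pos_le_divide_eq) (simp_all add: mult.commute)
  qed
  have "\<bar>n * x\<bar> < n * n"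
    using False n by (simp add: abs_mult)
  then have "- ((int n)\<^sup>2) \<le> k" "k \<le> (int n)\<^sup>2"
  proof -
    have "- (real n * real n) < n * x" "n * x < real n * real n"
      using \<open>\<bar>n * x\<bar> < n * n\<close> unfolding abs_less_iff of_nat_mult by linarith+
    moreover have "real_of_int ((int n)\<^sup>2) = real n * real n" by (simp add: power2_eq_square)
    ultimately show "- ((int n)\<^sup>2) \<le> k" "k \<le> (int n)\<^sup>2"
      unfolding k_def le_floor_iff floor_le_iff of_int_minus by linarith+
  qed
  then have "k \<in> set [- (int n)\<^sup>2..(int n)\<^sup>2]" by simp
  with code have fl: "\<lfloor>n * Re (schwartz_fun \<theta> (k / n))\<rfloor> = \<lfloor>n * Re (schwartz_fun \<theta>' (k / n))\<rfloor>"
    "\<lfloor>n * Im (schwartz_fun \<theta> (k / n))\<rfloor> = \<lfloor>n * Im (schwartz_fun \<theta>' (k / n))\<rfloor>"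
    unfolding schwartz_code_def map_eq_conv by blast+
  have fl1: "\<bar>u - v\<bar> \<le> 1 / n" if "\<lfloor>n * u\<rfloor> = \<lfloor>n * v\<rfloor>" for u v :: real
  proof -
    have "\<bar>n * u - n * v\<bar> \<le> 1" using that by linarith
    then have "n * \<bar>u - v\<bar> \<le> 1" by (simp add: abs_mult right_diff_distrib[symmetric])
    then show ?thesis using n by (simp add: field_simps)
  qed
  have mid: "cmod (schwartz_fun \<theta> (k / n) - schwartz_fun \<theta>' (k / n)) \<le> 1 / n + 1 / n"
    using fl1[OF fl(1)] fl1[OF fl(2)] by (intro order_trans[OF cmod_le] add_mono) auto
  have lip: "cmod (schwartz_fun \<eta> x - schwartz_fun \<eta> (k / n)) \<le> M / n" if "schwartz_seminorm 0 1 \<eta> \<le> M" for \<eta>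
  proof -
    have "cmod (schwartz_fun \<eta> x - schwartz_fun \<eta> (k / n)) \<le> schwartz_seminorm 0 1 \<eta> * \<bar>x - k / n\<bar>"
      by (rule schwartz_fun_lipschitz)
    also have "\<dots> \<le> M * (1 / n)"
      using that close schwartz_seminorm_nonneg[of 0 1 \<eta>] by (intro mult_mono) auto
    finally show ?thesis by simp
  qed
  have "cmod (schwartz_fun \<theta> x - schwartz_fun \<theta>' x) \<le> M / n + ((1 / n + 1 / n) + M / n)"
  proof -
    have "schwartz_fun \<theta> x - schwartz_fun \<theta>' x = (schwartz_fun \<theta> x - schwartz_fun \<theta> (k / n))
      + ((schwartz_fun \<theta> (k / n) - schwartz_fun \<theta>' (k / n)) - (schwartz_fun \<theta>' x - schwartz_fun \<theta>' (k / n)))"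
      by simp
    also have "cmod \<dots> \<le> M / n + ((1 / n + 1 / n) + M / n)"
      by (rule order_trans[OF norm_triangle_ineq add_mono[OF lip[OF M(2)]
            order_trans[OF norm_triangle_ineq4 add_mono[OF mid lip[OF M(4)]]]]])
    finally show ?thesis .
  qed
  also have "\<dots> = (2 + 2 * M) / n" using n by (simp add: field_simps)
  finally show ?thesis .
qed

text \<open>Codes range over a countable type. One representative is chosen from each class of functions that share
  their codes and their bounds, and the functions of one class are close to each other.\<close>

lemma schwartz_separable:
  obtains D :: "schwartz set" where "countable D"
    "\<And>\<phi> N \<epsilon>. \<epsilon> > 0 \<Longrightarrow> \<exists>d\<in>D. \<forall>a\<le>N. \<forall>b\<le>N. schwartz_seminorm a b (\<phi> - d) < \<epsilon>"
proof -
  define codes where "codes N n \<phi> = map (\<lambda>a. map (\<lambda>b. schwartz_code n (schwartz_weight a b \<phi>)) [0..<Suc N]) [0..<Suc N]"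
    for N n \<phi>
  define cl where "cl = (\<lambda>(N, n, M, c). {\<phi>. codes N n \<phi> = c \<and>
      (\<forall>a\<le>N. \<forall>b\<le>N. schwartz_seminorm 1 0 (schwartz_weight a b \<phi>) \<le> real M
         \<and> schwartz_seminorm 0 1 (schwartz_weight a b \<phi>) \<le> real M)})"
  define rep where "rep key = (SOME \<phi>. \<phi> \<in> cl key)" for key :: "nat \<times> nat \<times> nat \<times> (int \<times> int) list list list"
  show ?thesis
  proof
    show "countable (range rep)" by simp
    fix \<phi> N and \<epsilon> :: real assume "\<epsilon> > 0"
    let ?t = "\<lambda>(a, b). schwartz_seminorm 1 0 (schwartz_weight a b \<phi>) + schwartz_seminorm 0 1 (schwartz_weight a b \<phi>)"
    \<comment> \<open>bounds decay and slope of every function that is coded\<close>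
    obtain M where Max_le: "Max (?t ` ({..N} \<times> {..N})) \<le> real M" using real_arch_simple by blast
    have M: "schwartz_seminorm 1 0 (schwartz_weight a b \<phi>) \<le> real M
         \<and> schwartz_seminorm 0 1 (schwartz_weight a b \<phi>) \<le> real M" if "a \<le> N" "b \<le> N" for a b
    proof -
      have "?t (a, b) \<le> real M" using that by (intro order_trans[OF Max_ge Max_le]) auto
      then show ?thesis
        using schwartz_seminorm_nonneg[of 1 0 "schwartz_weight a b \<phi>"]
          schwartz_seminorm_nonneg[of 0 1 "schwartz_weight a b \<phi>"] by (simp only: prod.case) linarith
    qed
    obtain n where n: "real n > (2 + 2 * real M) / \<epsilon>" using reals_Archimedean2 by blast
    have "(2 + 2 * real M) / \<epsilon> > 0" using \<open>\<epsilon> > 0\<close> by simp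
    with n have "n > 0" by (metis of_nat_0_less_iff order_less_trans)
    with n \<open>\<epsilon> > 0\<close> have n\<epsilon>: "(2 + 2 * real M) / n < \<epsilon>" by (simp add: field_simps)
    define d where "d = rep (N, n, M, codes N n \<phi>)"
    have "\<phi> \<in> cl (N, n, M, codes N n \<phi>)" using M by (simp add: cl_def)
    then have d: "d \<in> cl (N, n, M, codes N n \<phi>)" unfolding d_def rep_def by (rule someI)
    have "schwartz_seminorm a b (\<phi> - d) < \<epsilon>" if ab: "a \<le> N" "b \<le> N" for a b
    proof -
      have "codes N n d = codes N n \<phi>" using d by (simp add: cl_def)
      then have "codes N n d ! a ! b = codes N n \<phi> ! a ! b" by simp
      then have code: "schwartz_code n (schwartz_weight a b \<phi>) = schwartz_code n (schwartz_weight a b d)"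
        using ab by (simp add: codes_def nth_append del: upt_Suc)
      have "schwartz_seminorm a b (\<phi> - d) \<le> (2 + 2 * real M) / n"
      proof (rule schwartz_seminorm_least)
        fix x
        have "\<bar>x\<bar> ^ a * cmod (nth_vderiv b (schwartz_fun (\<phi> - d)) x)
            = cmod (schwartz_fun (schwartz_weight a b \<phi>) x - schwartz_fun (schwartz_weight a b d) x)"
          by (simp add: nth_vderiv_diff schwartz_fun_weight right_diff_distrib[symmetric] norm_mult norm_power)
        also have "\<dots> \<le> (2 + 2 * real M) / n"
          using M[OF ab] d ab by (intro schwartz_code_eq_imp_close \<open>n > 0\<close> code) (auto simp: cl_def)
        finally show "\<bar>x\<bar> ^ a * cmod (nth_vderiv b (schwartz_fun (\<phi> - d)) x) \<le> (2 + 2 * real M) / n" .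
      qed
      with n\<epsilon> show ?thesis by linarith
    qed
    then show "\<exists>d\<in>range rep. \<forall>a\<le>N. \<forall>b\<le>N. schwartz_seminorm a b (\<phi> - d) < \<epsilon>"
      unfolding d_def by blast
  qed
qed

lemma tempered_apply_add: "tempered_apply T (\<phi> + \<psi>) = tempered_apply T \<phi> + tempered_apply T \<psi>"
  and tempered_apply_scale: "tempered_apply T (schwartz_scale c \<phi>) = c * tempered_apply T \<phi>"
  and continuous_on_tempered_apply: "continuous_on UNIV (tempered_apply T)"
  using tempered_apply[of T] by auto

lemma tempered_apply_diff: "tempered_apply T (\<phi> - \<psi>) = tempered_apply T \<phi> - tempered_apply T \<psi>"
  using tempered_apply_add[of T "\<phi> - \<psi>" \<psi>] by simp

lemma tempered_apply_zero: "tempered_apply T 0 = 0"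
  using tempered_apply_add[of T 0 0] by simp

text \<open>The subbasic open sets are balls of single seminorms around arbitrary centres. By the triangle
  inequality they contain balls around each of their points, and finitely many seminorms are dominated by
  those with indices up to some \<open>N\<close>.\<close>

lemma open_schwartz_neighbourhood:
  assumes "open U" "\<psi>0 \<in> U"
  shows "\<exists>N. \<exists>\<delta>>0. \<forall>\<psi>. (\<forall>a\<le>N. \<forall>b\<le>N. schwartz_seminorm a b (\<psi> - \<psi>0) < \<delta>) \<longrightarrow> \<psi> \<in> U"
  using assms unfolding open_schwartz_def
proof (induction arbitrary: \<psi>0 rule: generate_topology.induct)
  case UNIV
  show ?case by (auto intro: exI[of _ 1])
next
  case (Int U V)
  obtain N \<delta> where 1: "\<delta> > 0" "\<And>\<psi>. (\<forall>a\<le>N. \<forall>b\<le>N. schwartz_seminorm a b (\<psi> - \<psi>0) < \<delta>) \<Longrightarrow> \<psi> \<in> U"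
    using Int.IH(1)[of \<psi>0] Int.prems by auto
  obtain N' \<delta>' where 2: "\<delta>' > 0" "\<And>\<psi>. (\<forall>a\<le>N'. \<forall>b\<le>N'. schwartz_seminorm a b (\<psi> - \<psi>0) < \<delta>') \<Longrightarrow> \<psi> \<in> V"
    using Int.IH(2)[of \<psi>0] Int.prems by auto
  show ?case
    by (rule exI[of _ "max N N'"], rule exI[of _ "min \<delta> \<delta>'"]) (use 1 2 in auto)
next
  case (UN K)
  then obtain U where "U \<in> K" "\<psi>0 \<in> U" by auto
  with UN.IH[of U \<psi>0] show ?case by (meson UnionI)
next
  case (Basis U)
  then obtain a b \<phi> r where U: "U = {\<psi>. schwartz_seminorm a b (\<psi> - \<phi>) < r}" by auto
  let ?\<delta> = "r - schwartz_seminorm a b (\<psi>0 - \<phi>)"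
  have "\<psi> \<in> U" if "\<forall>a'\<le>max a b. \<forall>b'\<le>max a b. schwartz_seminorm a' b' (\<psi> - \<psi>0) < ?\<delta>" for \<psi>
  proof -
    have "schwartz_seminorm a b (\<psi> - \<psi>0) < ?\<delta>" using that by simp
    moreover have "schwartz_seminorm a b (\<psi> - \<phi>) \<le> schwartz_seminorm a b (\<psi> - \<psi>0) + schwartz_seminorm a b (\<psi>0 - \<phi>)"
      using schwartz_seminorm_add[of a b "\<psi> - \<psi>0" "\<psi>0 - \<phi>"] by simp
    ultimately show ?thesis by (simp add: U)
  qed
  then show ?case using Basis.prems
    by (intro exI[of _ "max a b"] exI[of _ ?\<delta>]) (auto simp: U)
qed

lemma schwartz_seminorm_le_norm: "a \<le> N \<Longrightarrow> b \<le> N \<Longrightarrow> schwartz_seminorm a b \<phi> \<le> schwartz_norm N \<phi>"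
proof -
  assume ab: "a \<le> N" "b \<le> N"
  have "schwartz_seminorm a b \<phi> \<le> (\<Sum>b\<le>N. schwartz_seminorm a b \<phi>)"
    using ab by (intro member_le_sum) (auto intro!: schwartz_seminorm_nonneg)
  also have "\<dots> \<le> schwartz_norm N \<phi>"
    unfolding schwartz_norm_def
    using ab by (intro member_le_sum[of a _ "\<lambda>a. \<Sum>b\<le>N. schwartz_seminorm a b \<phi>"])
      (auto intro!: schwartz_seminorm_nonneg sum_nonneg)
  finally show ?thesis .
qed

lemma schwartz_norm_nonneg: "schwartz_norm N \<phi> \<ge> 0"
  unfolding schwartz_norm_def by (intro sum_nonneg schwartz_seminorm_nonneg)

lemma schwartz_norm_mono: "M \<le> N \<Longrightarrow> schwartz_norm M \<phi> \<le> schwartz_norm N \<phi>"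
proof -
  assume "M \<le> N"
  then have "schwartz_norm M \<phi> \<le> (\<Sum>a\<le>M. \<Sum>b\<le>N. schwartz_seminorm a b \<phi>)"
    unfolding schwartz_norm_def by (intro sum_mono sum_mono2) (auto simp: schwartz_seminorm_nonneg)
  also have "\<dots> \<le> schwartz_norm N \<phi>"
    unfolding schwartz_norm_def
    using \<open>M \<le> N\<close> by (intro sum_mono2) (auto simp: schwartz_seminorm_nonneg sum_nonneg)
  finally show ?thesis .
qed

lemma schwartz_norm_add: "schwartz_norm N (\<phi> + \<psi>) \<le> schwartz_norm N \<phi> + schwartz_norm N \<psi>"
  unfolding schwartz_norm_def sum.distrib[symmetric] by (intro sum_mono schwartz_seminorm_add)

lemma schwartz_norm_le:
  assumes "\<And>a b. a \<le> N \<Longrightarrow> b \<le> N \<Longrightarrow> schwartz_seminorm a b \<phi> \<le> c"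
  shows "schwartz_norm N \<phi> \<le> (real N + 1)\<^sup>2 * c"
proof -
  have "schwartz_norm N \<phi> \<le> (\<Sum>a\<le>N. \<Sum>b\<le>N. c)"
    unfolding schwartz_norm_def by (intro sum_mono assms) auto
  also have "\<dots> = (real N + 1)\<^sup>2 * c"
    by (simp add: power2_eq_square algebra_simps)
  finally show ?thesis .
qed

text \<open>Equicontinuous sets of tempered distributions. They exhaust the space, and on each of them convergence
  can be tested on a dense set of Schwartz functions.\<close>

definition tempered_polar :: "nat \<Rightarrow> tempered set" where
  "tempered_polar N = {T. \<forall>\<psi>. cmod (tempered_apply T \<psi>) \<le> real N * schwartz_norm N \<psi>}"

text \<open>Continuity at zero bounds the distribution on a neighbourhood given by finitely many seminorms, and
  scaling turns this into an estimate by their sum.\<close>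

lemma tempered_in_polar: "\<exists>N. T \<in> tempered_polar N"
proof -
  have "open (tempered_apply T -` ball 0 1)"
    using continuous_on_tempered_apply[of T] open_ball
    by (auto simp: continuous_on_open_vimage[OF open_UNIV])
  then obtain N \<delta> where \<delta>: "\<delta> > 0"
    "\<And>\<psi>. (\<forall>a\<le>N. \<forall>b\<le>N. schwartz_seminorm a b \<psi> < \<delta>) \<Longrightarrow> cmod (tempered_apply T \<psi>) < 1"
    using open_schwartz_neighbourhood[of "tempered_apply T -` ball 0 1" 0] by (auto simp: tempered_apply_zero)
  have bd: "cmod (tempered_apply T \<psi>) \<le> schwartz_norm N \<psi> / \<delta>" for \<psi>
  proof (rule field_le_epsilon)
    fix e :: real assume "e > 0"
    \<comment> \<open>the summand with \<open>e\<close> keeps the scaling factor finite when all seminorms vanish\<close>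
    define s where "s = schwartz_norm N \<psi> + e * \<delta>"
    have "s > 0" using \<open>e > 0\<close> \<delta>(1) schwartz_norm_nonneg[of N \<psi>] by (simp add: s_def add_nonneg_pos)
    have "cmod (tempered_apply T (schwartz_scale (of_real (\<delta> / s)) \<psi>)) < 1"
    proof (intro \<delta>(2) allI impI)
      fix a b assume "a \<le> N" "b \<le> N"
      have "schwartz_seminorm a b (schwartz_scale (of_real (\<delta> / s)) \<psi>) \<le> (\<delta> / s) * schwartz_seminorm a b \<psi>"
        using schwartz_seminorm_scale[of a b "of_real (\<delta> / s)" \<psi>] \<delta>(1) \<open>s > 0\<close> by (simp add: norm_divide)
      also have "\<dots> \<le> (\<delta> / s) * schwartz_norm N \<psi>"
        using \<open>a \<le> N\<close> \<open>b \<le> N\<close> \<delta>(1) \<open>s > 0\<close> by (intro mult_left_mono schwartz_seminorm_le_norm) auto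
      also have "\<dots> < (\<delta> / s) * s"
        using \<open>e > 0\<close> \<delta>(1) \<open>s > 0\<close> by (intro mult_strict_left_mono) (auto simp: s_def)
      also have "\<dots> = \<delta>" using \<open>s > 0\<close> by simp
      finally show "schwartz_seminorm a b (schwartz_scale (of_real (\<delta> / s)) \<psi>) < \<delta>" .
    qed
    then have "(\<delta> / s) * cmod (tempered_apply T \<psi>) < 1"
      using \<delta>(1) \<open>s > 0\<close> by (simp add: tempered_apply_scale norm_mult norm_divide)
    then have "cmod (tempered_apply T \<psi>) < s / \<delta>"
      using \<delta>(1) \<open>s > 0\<close> by (simp add: field_simps)
    also have "s / \<delta> = schwartz_norm N \<psi> / \<delta> + e"
      using \<delta>(1) by (simp add: s_def field_simps)
    finally show "cmod (tempered_apply T \<psi>) \<le> schwartz_norm N \<psi> / \<delta> + e" by simp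
  qed
  define K where "K = max N (nat \<lceil>1 / \<delta>\<rceil>)"
  have "T \<in> tempered_polar K"
    unfolding tempered_polar_def
  proof safe
    fix \<psi>
    have "cmod (tempered_apply T \<psi>) \<le> (1 / \<delta>) * schwartz_norm N \<psi>" using bd[of \<psi>] by simp
    also have "\<dots> \<le> real K * schwartz_norm K \<psi>"
    proof (intro mult_mono schwartz_norm_mono schwartz_norm_nonneg)
      have "1 / \<delta> \<le> real (nat \<lceil>1 / \<delta>\<rceil>)" by linarith
      also have "\<dots> \<le> real K" by (simp add: K_def)
      finally show "1 / \<delta> \<le> real K" .
    qed (auto simp: K_def)
    finally show "cmod (tempered_apply T \<psi>) \<le> real K * schwartz_norm K \<psi>" .
  qed
  then show ?thesis ..
qed

text \<open>With a countable dense set the polar sets become countable intersections of conditions on single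
  evaluations, hence measurable for the \<open>\<sigma>\<close>-algebra that the evaluations generate.\<close>

lemma tempered_polar_eq_dense:
  assumes D: "\<And>\<phi> N \<epsilon>. \<epsilon> > 0 \<Longrightarrow> \<exists>d\<in>D. \<forall>a\<le>N. \<forall>b\<le>N. schwartz_seminorm a b (\<phi> - d) < \<epsilon>"
  shows "tempered_polar N = {T. \<forall>d\<in>D. cmod (tempered_apply T d) \<le> real N * schwartz_norm N d}"
proof safe
  fix T assume T: "\<forall>d\<in>D. cmod (tempered_apply T d) \<le> real N * schwartz_norm N d"
  obtain M where M: "\<And>\<psi>. cmod (tempered_apply T \<psi>) \<le> real M * schwartz_norm M \<psi>"
    using tempered_in_polar[of T] by (auto simp: tempered_polar_def)
  have "cmod (tempered_apply T \<psi>) \<le> real N * schwartz_norm N \<psi>" for \<psi>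
  proof (rule field_le_epsilon)
    fix e :: real assume "e > 0"
    \<comment> \<open>the total weight of the seminorms of \<open>\<psi> - d\<close> in the estimate below\<close>
    define C where "C = real N * (real N + 1)\<^sup>2 + real M * (real M + 1)\<^sup>2 + 1"
    have "C > 0" unfolding C_def by (intro add_nonneg_pos) auto
    obtain d where d: "d \<in> D" "\<And>a b. a \<le> max N M \<Longrightarrow> b \<le> max N M \<Longrightarrow> schwartz_seminorm a b (\<psi> - d) < e / C"
      using D[of "e / C" "max N M" \<psi>] \<open>C > 0\<close> \<open>e > 0\<close> by auto
    have small: "schwartz_norm K (\<psi> - d) \<le> (real K + 1)\<^sup>2 * (e / C)" if "K \<le> max N M" for K
      using that by (intro schwartz_norm_le less_imp_le[OF d(2)]) auto
    have sym: "schwartz_norm K (d - \<psi>) = schwartz_norm K (\<psi> - d)" for K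
      by (simp add: schwartz_norm_def schwartz_seminorm_minus_commute[of _ _ d \<psi>])
    have "cmod (tempered_apply T \<psi>) \<le> cmod (tempered_apply T d) + cmod (tempered_apply T (\<psi> - d))"
      using norm_triangle_ineq[of "tempered_apply T d" "tempered_apply T (\<psi> - d)"] by (simp add: tempered_apply_diff)
    also have "\<dots> \<le> real N * (schwartz_norm N \<psi> + schwartz_norm N (d - \<psi>)) + real M * schwartz_norm M (\<psi> - d)"
    proof (intro add_mono M)
      have "schwartz_norm N d \<le> schwartz_norm N \<psi> + schwartz_norm N (d - \<psi>)"
        using schwartz_norm_add[of N \<psi> "d - \<psi>"] by simp
      then show "cmod (tempered_apply T d) \<le> real N * (schwartz_norm N \<psi> + schwartz_norm N (d - \<psi>))"
        using T \<open>d \<in> D\<close> by (meson mult_left_mono of_nat_0_le_iff order_trans)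
    qed
    also have "\<dots> \<le> real N * (schwartz_norm N \<psi> + (real N + 1)\<^sup>2 * (e / C)) + real M * ((real M + 1)\<^sup>2 * (e / C))"
      unfolding sym by (intro add_mono mult_left_mono small) auto
    also have "\<dots> = real N * schwartz_norm N \<psi> + (C - 1) * (e / C)"
    proof -
      have *: "real N * (S + A * q) + real M * (B * q) = real N * S + (real N * A + real M * B) * q" for S A B q
        by (simp add: algebra_simps)
      have "C - 1 = real N * (real N + 1)\<^sup>2 + real M * (real M + 1)\<^sup>2" by (simp add: C_def)
      then show ?thesis by (simp only: *)
    qed
    also have "\<dots> \<le> real N * schwartz_norm N \<psi> + e"
      using \<open>C > 0\<close> \<open>e > 0\<close> by (simp add: field_simps)
    finally show "cmod (tempered_apply T \<psi>) \<le> real N * schwartz_norm N \<psi> + e" .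
  qed
  then show "T \<in> tempered_polar N" by (simp add: tempered_polar_def)
qed (auto simp: tempered_polar_def)

lemma continuous_on_tempered_eval: "continuous_on UNIV (\<lambda>T. tempered_apply T \<phi>)"
  unfolding continuous_on_open_vimage[OF open_UNIV]
  by (auto simp: open_tempered_def vimage_def intro!: generate_topology.Basis)

lemma tempered_eval_measurable [measurable]: "(\<lambda>T. tempered_apply T \<phi>) \<in> borel_measurable borel"
  by (rule borel_measurable_continuous_onI[OF continuous_on_tempered_eval])

abbreviation re_eval :: "schwartz \<Rightarrow> tempered \<Rightarrow> real" where
  "re_eval \<phi> T \<equiv> Re (tempered_apply T \<phi>)"

text \<open>The weak-* topology has no countable base, so an open set need not be a countable union of
  cylinder sets. Its intersection with a polar set is one, relative to the polar set: by equicontinuity the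
  conditions can be moved to test functions from a countable dense set and to a countable base of the complex plane.
  Countably many polar sets cover the space. Real parts suffice because the imaginary part of \<open>T \<phi>\<close> is the
  real part of \<open>T (- \<i> \<phi>)\<close>.\<close>

lemma sets_borel_tempered:
  "sets (borel :: tempered measure)
    = sigma_sets UNIV {f -` C | f C. f \<in> range re_eval \<and> C \<in> sets borel}"
  (is "_ = sigma_sets UNIV ?G")
proof (rule antisym)
  show "sigma_sets UNIV ?G \<subseteq> sets borel"
  proof (rule sets.sigma_sets_subset[of _ borel, simplified])
    show "?G \<subseteq> sets borel"
      by (auto intro!: measurable_sets_borel[of _ borel])
  qed
next
  define S where "S = sigma (UNIV :: tempered set) ?G"
  have S: "sets S = sigma_sets UNIV ?G" "space S = UNIV" by (simp_all add: S_def)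
  have Re: "(re_eval \<phi>) \<in> borel_measurable S" for \<phi>
    by (intro measurableI) (auto simp only: S vimage_UNIV Int_UNIV_right space_borel intro!: sigma_sets.Basic)
  have "(\<lambda>T. Complex (Re (tempered_apply T \<phi>)) (Re (tempered_apply T (schwartz_scale (- \<i>) \<phi>)))) \<in> borel_measurable S" for \<phi>
    unfolding Complex_eq using Re by measurable
  then have [measurable]: "(\<lambda>T. tempered_apply T \<phi>) \<in> borel_measurable S" for \<phi>
    by (simp add: tempered_apply_scale)
  obtain D where cD: "countable D"
    and D: "\<And>\<phi> N \<epsilon>. \<epsilon> > 0 \<Longrightarrow> \<exists>d\<in>D. \<forall>a\<le>N. \<forall>b\<le>N. schwartz_seminorm a b (\<phi> - d) < \<epsilon>"
    using schwartz_separable by blast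
  obtain B :: "complex set set" where B: "countable B" "topological_basis B"
    using ex_countable_basis by auto
  \<comment> \<open>cylinder sets with base points in \<open>D\<close>; only countably many of them occur\<close>
  define V where "V F = {T. \<forall>(d, O')\<in>F. tempered_apply T d \<in> O'}" for F :: "(schwartz \<times> complex set) set"
  let ?F = "{F. F \<subseteq> D \<times> B \<and> finite F}"
  have cF: "countable ?F"
    using countable_Collect_finite_subset[of "D \<times> B"] cD B(1) by (simp add: conj_commute)
  have polar_meas: "tempered_polar N \<in> sets S" for N
  proof -
    have "{T \<in> space S. \<forall>d\<in>D. cmod (tempered_apply T d) \<le> real N * schwartz_norm N d} \<in> sets S"
      by (rule sets.sets_Collect_countable_All'[OF _ cD]) measurable
    then show ?thesis using tempered_polar_eq_dense[OF D, of N] S(2) by simp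
  qed
  have V_meas: "V F \<in> sets S" if "F \<in> ?F" for F
  proof -
    have "{T \<in> space S. \<forall>x\<in>F. tempered_apply T (fst x) \<in> snd x} \<in> sets S"
    proof (rule sets.sets_Collect_countable_All')
      fix x assume "x \<in> F"
      then have "snd x \<in> B" using that by auto
      then have [measurable]: "snd x \<in> sets borel"
        using topological_basis_open[OF B(2)] by auto
      show "{T \<in> space S. tempered_apply T (fst x) \<in> snd x} \<in> sets S" by measurable
    qed (use that in \<open>auto intro: countable_finite\<close>)
    then show ?thesis using S(2) by (simp add: V_def case_prod_beta)
  qed
  have local: "\<exists>F\<in>?F. T \<in> V F \<and> V F \<inter> tempered_polar N \<subseteq> U"
    if "open U" "T \<in> U" "T \<in> tempered_polar N" for U T N
    using that(1,2) unfolding open_tempered_def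
  proof (induction rule: generate_topology.induct)
    case UNIV
    show ?case by (intro bexI[of _ "{}"]) (auto simp: V_def)
  next
    case (Int X Y)
    then obtain F G where "F \<in> ?F" "T \<in> V F" "V F \<inter> tempered_polar N \<subseteq> X"
      "G \<in> ?F" "T \<in> V G" "V G \<inter> tempered_polar N \<subseteq> Y" by auto
    moreover have "V (F \<union> G) = V F \<inter> V G" by (auto simp: V_def)
    ultimately show ?case by (intro bexI[of _ "F \<union> G"]) auto
  next
    case (UN K)
    then obtain X where X: "X \<in> K" "T \<in> X" by auto
    from UN.IH[OF X] obtain F where "F \<in> ?F" "T \<in> V F" "V F \<inter> tempered_polar N \<subseteq> X" by blast
    with X(1) show ?case by (intro bexI[of _ F]) auto
  next
    case (Basis X)
    then obtain \<phi> O' where X: "X = {T. tempered_apply T \<phi> \<in> O'}" "open O'" by auto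
    with Basis.prems obtain \<rho> where \<rho>: "\<rho> > 0" "ball (tempered_apply T \<phi>) \<rho> \<subseteq> O'"
      by (auto simp: open_contains_ball)
    \<comment> \<open>moving the condition from \<open>\<phi>\<close> to \<open>d\<close> costs \<open>\<rho> / 3\<close> on each side, uniformly on the polar set\<close>
    define e where "e = \<rho> / 3 / (real N * (real N + 1)\<^sup>2 + 1)"
    have pos: "real N * (real N + 1)\<^sup>2 + 1 > 0" by (intro add_nonneg_pos) auto
    have "e > 0" using \<rho> pos by (simp add: e_def)
    then obtain d where d: "d \<in> D" "\<And>a b. a \<le> N \<Longrightarrow> b \<le> N \<Longrightarrow> schwartz_seminorm a b (\<phi> - d) < e"
      using D[of e N \<phi>] by auto
    have close: "cmod (tempered_apply T' \<phi> - tempered_apply T' d) < \<rho> / 3" if "T' \<in> tempered_polar N" for T'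
    proof -
      have "cmod (tempered_apply T' \<phi> - tempered_apply T' d) \<le> real N * schwartz_norm N (\<phi> - d)"
        using that by (simp add: tempered_polar_def tempered_apply_diff[symmetric])
      also have "\<dots> \<le> real N * ((real N + 1)\<^sup>2 * e)"
        by (intro mult_left_mono schwartz_norm_le less_imp_le[OF d(2)]) auto
      also have "\<dots> < (real N * (real N + 1)\<^sup>2 + 1) * e"
        using \<open>e > 0\<close> by (simp add: algebra_simps)
      also have "\<dots> = \<rho> / 3" 
      proof -
        have "y * (\<rho> / 3 / y) = \<rho> / 3" if "y > 0" for y using that by simp
        from this[OF pos] show ?thesis unfolding e_def .
      qed
      finally show ?thesis .
    qed
    obtain Q where Q: "Q \<in> B" "tempered_apply T d \<in> Q" "Q \<subseteq> ball (tempered_apply T d) (\<rho> / 3)"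
      using topological_basisE[OF B(2), of "ball (tempered_apply T d) (\<rho> / 3)" "tempered_apply T d"] \<rho>(1)
      by auto
    have "V {(d, Q)} \<inter> tempered_polar N \<subseteq> X"
    proof safe
      fix T' assume T': "T' \<in> V {(d, Q)}" "T' \<in> tempered_polar N"
      have "dist (tempered_apply T d) (tempered_apply T' d) < \<rho> / 3"
        using T'(1) Q(3) by (auto simp: V_def)
      then have "dist (tempered_apply T \<phi>) (tempered_apply T' \<phi>) < \<rho>"
        using close[OF that(3)] close[OF T'(2)]
          dist_triangle[of "tempered_apply T \<phi>" "tempered_apply T' \<phi>" "tempered_apply T d"]
          dist_triangle[of "tempered_apply T d" "tempered_apply T' \<phi>" "tempered_apply T' d"]
        by (simp add: dist_norm norm_minus_commute)
      then show "T' \<in> X" using \<rho>(2) by (auto simp: X)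
    qed
    then show ?case using d(1) Q by (intro bexI[of _ "{(d, Q)}"]) (auto simp: V_def)
  qed
  have "U \<in> sets S" if "open U" for U
  proof -
    have "U = (\<Union>N. \<Union>F\<in>{F\<in>?F. V F \<inter> tempered_polar N \<subseteq> U}. V F \<inter> tempered_polar N)"
    proof (intro antisym subsetI)
      fix T assume "T \<in> U"
      obtain N where "T \<in> tempered_polar N" using tempered_in_polar by blast
      with local[OF that \<open>T \<in> U\<close> this]
      show "T \<in> (\<Union>N. \<Union>F\<in>{F\<in>?F. V F \<inter> tempered_polar N \<subseteq> U}. V F \<inter> tempered_polar N)" by blast
    qed blast
    also have "\<dots> \<in> sets S"
      by (intro sets.countable_UN' sets.countable_UN'' sets.Int V_meas polar_meas countable_subset[OF _ cF]) auto
    finally show ?thesis .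
  qed
  then have "sigma_sets UNIV (Collect open) \<subseteq> sets S"
    by (intro sets.sigma_sets_subset[of _ S, unfolded S(2)]) auto
  then show "sets borel \<subseteq> sigma_sets UNIV ?G"
    by (simp add: borel_def S)
qed

lemma measurable_temperedI:
  assumes "\<And>\<phi>. (\<lambda>x. Re (tempered_apply (f x) \<phi>)) \<in> borel_measurable M"
  shows "f \<in> borel_measurable M"
proof (rule measurable_sigma_sets[OF sets_borel_tempered])
  fix A assume "A \<in> {f -` C |f C. f \<in> range re_eval \<and> C \<in> sets borel}"
  then obtain \<phi> C where A: "A = (re_eval \<phi>) -` C" "C \<in> sets borel" by blast
  show "f -` A \<inter> space M \<in> sets M"
    using measurable_sets[OF assms A(2), of \<phi>] by (simp add: A vimage_def)
qed auto

lemma measurable_plus_tempered [measurable]: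
  assumes [measurable]: "f \<in> borel_measurable M" "g \<in> borel_measurable M"
  shows "(\<lambda>x. f x + g x :: tempered) \<in> borel_measurable M"
  by (rule measurable_temperedI) (simp add: plus_tempered.rep_eq)

section \<open>Fourier inversion\<close>

text \<open>The Fourier transform of the centered normal density with standard deviation \<open>\<delta>\<close>.\<close>

abbreviation gauss_weight :: "real \<Rightarrow> real \<Rightarrow> real" where
  "gauss_weight \<delta> \<xi> \<equiv> exp (- (2 * pi * \<delta> * \<xi>)\<^sup>2 / 2)"

abbreviation gauss_smooth :: "real \<Rightarrow> (real \<Rightarrow> complex) \<Rightarrow> real \<Rightarrow> complex" where
  "gauss_smooth \<delta> h x \<equiv> (LINT y|lborel. h y * normal_density 0 \<delta> (x - y))"

lemma fourier_normal_density:
  assumes "\<sigma> > 0"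
  shows "(LINT x|lborel. cis (t * x) * normal_density 0 \<sigma> x) = of_real (exp (- (\<sigma> * t)\<^sup>2 / 2))"
proof -
  have "(LINT x|lborel. cis (t * x) * normal_density 0 \<sigma> x)
      = \<bar>\<sigma>\<bar> *\<^sub>R (LINT x|lborel. cis (t * (0 + \<sigma> * x)) * normal_density 0 \<sigma> (0 + \<sigma> * x))"
    using assms by (intro lborel_integral_real_affine) auto
  also have "\<dots> = (LINT x|lborel. \<sigma> *\<^sub>R (cis (t * (0 + \<sigma> * x)) * normal_density 0 \<sigma> (0 + \<sigma> * x)))"
    using assms by simp
  also have "\<dots> = (LINT x|lborel. std_normal_density x *\<^sub>R iexp (\<sigma> * t * x))"
  proof (intro Bochner_Integration.integral_cong refl)
    fix x
    have "\<sigma> * normal_density 0 \<sigma> (\<sigma> * x) = std_normal_density x"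
      using assms by (simp add: normal_density_def real_sqrt_mult power_mult_distrib)
    moreover have "\<sigma> *\<^sub>R (cis (t * (0 + \<sigma> * x)) * normal_density 0 \<sigma> (0 + \<sigma> * x))
      = of_real (\<sigma> * normal_density 0 \<sigma> (\<sigma> * x)) * cis (t * (\<sigma> * x))"
      by (simp add: scaleR_conv_of_real)
    ultimately show "\<sigma> *\<^sub>R (cis (t * (0 + \<sigma> * x)) * normal_density 0 \<sigma> (0 + \<sigma> * x))
        = std_normal_density x *\<^sub>R iexp (\<sigma> * t * x)"
      by (simp only: scaleR_conv_of_real cis_conv_exp) (simp add: mult_ac)
  qed
  also have "\<dots> = char std_normal_distribution (\<sigma> * t)"
    unfolding char_def by (subst integral_density) auto
  also have "\<dots> = of_real (exp (- (\<sigma> * t)\<^sup>2 / 2))"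
    by (simp add: char_std_normal_distribution)
  finally show ?thesis .
qed

lemma gauss_weight_conv_normal_density:
  assumes "\<delta> > 0"
  shows "gauss_weight \<delta> \<xi> = 1 / (sqrt (2 * pi) * \<delta>) * normal_density 0 (1 / (2 * pi * \<delta>)) \<xi>"
proof -
  have "sqrt (2 * pi * (1 / (2 * pi * \<delta>))\<^sup>2) = sqrt (2 * pi) * (1 / (2 * pi * \<delta>))"
    using assms by (subst real_sqrt_mult) simp
  also have "\<dots> = 1 / (sqrt (2 * pi) * \<delta>)"
  proof -
    have "s * (1 / (s * s * \<delta>)) = 1 / (s * \<delta>)" if "s > 0" for s :: real
      using that by simp
    from this[of "sqrt (2 * pi)"] show ?thesis by simp
  qed
  finally have "sqrt (2 * pi * (1 / (2 * pi * \<delta>))\<^sup>2) = 1 / (sqrt (2 * pi) * \<delta>)" .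
  moreover have "sqrt (2 * pi) * \<delta> > 0" using assms by simp
  moreover have "- (2 * pi * \<delta> * \<xi>)\<^sup>2 / 2 = - (\<xi> - 0)\<^sup>2 / (2 * (1 / (2 * pi * \<delta>))\<^sup>2)"
    using assms by (simp add: power_mult_distrib power_divide)
  ultimately show ?thesis
    using assms unfolding normal_density_def by simp
qed

lemma fourier_gauss_weight:
  assumes "\<delta> > 0"
  shows "(LINT \<xi>|lborel. cis (2 * pi * x * \<xi>) * gauss_weight \<delta> \<xi>) = normal_density 0 \<delta> x"
proof -
  have "(LINT \<xi>|lborel. cis (2 * pi * x * \<xi>) * gauss_weight \<delta> \<xi>)
      = (LINT \<xi>|lborel. of_real (1 / (sqrt (2 * pi) * \<delta>)) * (cis ((2 * pi * x) * \<xi>) * normal_density 0 (1 / (2 * pi * \<delta>)) \<xi>))"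
    unfolding gauss_weight_conv_normal_density[OF assms] by (intro Bochner_Integration.integral_cong) auto
  also have "\<dots> = of_real (1 / (sqrt (2 * pi) * \<delta>)) * of_real (exp (- (1 / (2 * pi * \<delta>) * (2 * pi * x))\<^sup>2 / 2))"
    using assms by (subst integral_mult_right_zero, subst fourier_normal_density) auto
  also have "\<dots> = normal_density 0 \<delta> x"
    using assms by (simp add: normal_density_def real_sqrt_mult power_divide power_mult_distrib)
  finally show ?thesis .
qed

lemma integrable_gauss_weight: "\<delta> > 0 \<Longrightarrow> integrable lborel (gauss_weight \<delta>)"
  unfolding gauss_weight_conv_normal_density by (intro integrable_mult_right) simp

lemma normal_density_0_le: "normal_density 0 \<delta> x \<le> 1 / sqrt (2 * pi * \<delta>\<^sup>2)"
proof -
  have "exp (- (x - 0)\<^sup>2 / (2 * \<delta>\<^sup>2)) \<le> 1" by (simp add: divide_nonpos_nonneg)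
  then have "1 / sqrt (2 * pi * \<delta>\<^sup>2) * exp (- (x - 0)\<^sup>2 / (2 * \<delta>\<^sup>2)) \<le> 1 / sqrt (2 * pi * \<delta>\<^sup>2) * 1"
    by (intro mult_left_mono) auto
  then show ?thesis unfolding normal_density_def by simp
qed

lemma integrable_mult_bounded:
  fixes h k :: "'a \<Rightarrow> complex"
  assumes "integrable M h" "k \<in> borel_measurable M" "\<And>x. cmod (k x) \<le> B"
  shows "integrable M (\<lambda>x. h x * k x)"
proof (rule Bochner_Integration.integrable_bound[of _ "\<lambda>x. B * cmod (h x)"])
  show "integrable M (\<lambda>x. B * cmod (h x))" using assms(1) by auto
  show "AE x in M. norm (h x * k x) \<le> norm (B * cmod (h x))"
  proof (rule AE_I2)
    fix x
    have "cmod (h x) * cmod (k x) \<le> cmod (h x) * B" by (intro mult_left_mono assms) auto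
    moreover have "B \<ge> 0" using assms(3)[of x] norm_ge_zero order_trans by blast
    ultimately show "norm (h x * k x) \<le> norm (B * cmod (h x))"
      by (simp add: norm_mult mult.commute)
  qed
qed (use assms in auto)

lemma Fubini_bounded_kernel:
  fixes h k :: "real \<Rightarrow> complex" and u :: "real \<Rightarrow> real \<Rightarrow> complex"
  assumes h: "integrable lborel h" and k: "integrable lborel k"
    and u [measurable]: "case_prod u \<in> borel_measurable (borel \<Otimes>\<^sub>M borel)" and u1: "\<And>x y. cmod (u x y) \<le> 1"
  shows "(LINT y|lborel. LINT x|lborel. h x * k y * u x y) = (LINT x|lborel. LINT y|lborel. h x * k y * u x y)"
proof (rule lborel_pair.Fubini_integral)
  have [measurable]: "h \<in> borel_measurable borel" "k \<in> borel_measurable borel"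
    using h k by auto
  show "integrable (lborel \<Otimes>\<^sub>M lborel) (\<lambda>(x, y). h x * k y * u x y)"
  proof (rule Bochner_Integration.integrable_bound)
    show "integrable (lborel \<Otimes>\<^sub>M lborel) (\<lambda>p. cmod (h (fst p)) * cmod (k (snd p)))"
      using lborel_pair.Fubini_integrable[of "\<lambda>p. cmod (h (fst p)) * cmod (k (snd p))"] h k
      by (auto intro!: lborel_pair.Fubini_integrable)
    show "AE p in lborel \<Otimes>\<^sub>M lborel. norm (case p of (x, y) \<Rightarrow> h x * k y * u x y) \<le> norm (cmod (h (fst p)) * cmod (k (snd p)))"
      using u1 by (auto intro!: AE_I2 mult_left_le simp: norm_mult)
  qed measurable
qed

lemma fourier_integral_measurable [measurable]:
  assumes [measurable]: "h \<in> borel_measurable borel"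
  shows "fourier_integral h \<in> borel_measurable borel"
  unfolding fourier_integral_def[abs_def] by measurable

lemma cmod_fourier_integral_le: "cmod (fourier_integral h \<xi>) \<le> (LINT x|lborel. cmod (h x))"
  unfolding fourier_integral_def by (rule order_trans[OF integral_norm_bound]) (simp add: norm_mult)

text \<open>The Gaussian weight makes the inversion integral absolutely convergent. Exchanging the integrals then
  replaces the weight by its own transform, a normal density.\<close>

lemma fourier_regularization:
  assumes h: "integrable lborel h" and "\<delta> > 0"
  shows "(LINT \<xi>|lborel. fourier_integral h \<xi> * gauss_weight \<delta> \<xi> * cis (2 * pi * x * \<xi>)) = gauss_smooth \<delta> h x"
proof -
  let ?k = "\<lambda>\<xi> y. h y * of_real (gauss_weight \<delta> \<xi>) * cis (2 * pi * (x - y) * \<xi>)"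
  have "(LINT \<xi>|lborel. fourier_integral h \<xi> * gauss_weight \<delta> \<xi> * cis (2 * pi * x * \<xi>))
     = (LINT \<xi>|lborel. LINT y|lborel. ?k \<xi> y)"
    unfolding fourier_integral_def
  proof (intro Bochner_Integration.integral_cong refl)
    fix \<xi>
    have "(LINT y|lborel. ?k \<xi> y)
      = (LINT y|lborel. (of_real (gauss_weight \<delta> \<xi>) * cis (2 * pi * x * \<xi>)) * (cis (- (2 * pi * y * \<xi>)) * h y))"
    proof (intro Bochner_Integration.integral_cong refl)
      fix y
      have "cis (2 * pi * (x - y) * \<xi>) = cis (2 * pi * x * \<xi>) * cis (- (2 * pi * y * \<xi>))"
        unfolding cis_mult by (simp add: algebra_simps)
      then show "?k \<xi> y
        = (of_real (gauss_weight \<delta> \<xi>) * cis (2 * pi * x * \<xi>)) * (cis (- (2 * pi * y * \<xi>)) * h y)"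
        by simp
    qed
    also have "\<dots> = (LINT x|lborel. cis (- (2 * pi * x * \<xi>)) * h x) * of_real (gauss_weight \<delta> \<xi>) * cis (2 * pi * x * \<xi>)"
      unfolding integral_mult_right_zero by simp
    finally show "(LINT x|lborel. cis (- (2 * pi * x * \<xi>)) * h x) * of_real (gauss_weight \<delta> \<xi>) * cis (2 * pi * x * \<xi>)
      = (LINT y|lborel. ?k \<xi> y)" ..
  qed
  also have "\<dots> = (LINT y|lborel. LINT \<xi>|lborel. ?k \<xi> y)"
    using integrable_gauss_weight[OF \<open>\<delta> > 0\<close>]
    by (intro Fubini_bounded_kernel[OF h, where k = "\<lambda>\<xi>. of_real (gauss_weight \<delta> \<xi>)"]
        integrable_of_real) auto
  also have "\<dots> = gauss_smooth \<delta> h x"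
  proof (intro Bochner_Integration.integral_cong refl)
    fix y
    have "(LINT \<xi>|lborel. ?k \<xi> y)
      = (LINT \<xi>|lborel. h y * (cis (2 * pi * (x - y) * \<xi>) * of_real (gauss_weight \<delta> \<xi>)))"
      by (intro Bochner_Integration.integral_cong) auto
    also have "\<dots> = h y * of_real (normal_density 0 \<delta> (x - y))"
      by (simp only: integral_mult_right_zero fourier_gauss_weight[OF \<open>\<delta> > 0\<close>])
    finally show "(LINT \<xi>|lborel. ?k \<xi> y)
      = h y * of_real (normal_density 0 \<delta> (x - y))" .
  qed
  finally show ?thesis .
qed

lemma gauss_smooth_affine:
  assumes "\<delta> > 0"
  shows "gauss_smooth \<delta> h x = (LINT u|lborel. h (x - \<delta> * u) * std_normal_density u)"
proof -
  have "gauss_smooth \<delta> h x = \<bar>- \<delta>\<bar> *\<^sub>R (LINT u|lborel. h (x + - \<delta> * u) * normal_density 0 \<delta> (x - (x + - \<delta> * u)))"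
    using assms by (intro lborel_integral_real_affine) auto
  also have "\<dots> = (LINT u|lborel. \<delta> *\<^sub>R (h (x + - \<delta> * u) * normal_density 0 \<delta> (x - (x + - \<delta> * u))))"
    using assms by simp
  also have "\<dots> = (LINT u|lborel. h (x - \<delta> * u) * std_normal_density u)"
  proof (intro Bochner_Integration.integral_cong refl)
    fix u
    have "\<delta> * normal_density 0 \<delta> (\<delta> * u) = std_normal_density u"
      using assms by (simp add: normal_density_def real_sqrt_mult power_mult_distrib)
    then have "of_real \<delta> * of_real (normal_density 0 \<delta> (\<delta> * u)) = (of_real (std_normal_density u) :: complex)"
      by (simp only: of_real_mult[symmetric])
    then show "\<delta> *\<^sub>R (h (x + - \<delta> * u) * normal_density 0 \<delta> (x - (x + - \<delta> * u))) = h (x - \<delta> * u) * std_normal_density u"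
      by (simp add: scaleR_conv_of_real mult.left_commute)
  qed
  finally show ?thesis .
qed

abbreviation vanishing :: "nat \<Rightarrow> real" where
  "vanishing n \<equiv> 1 / (real n + 1)"

lemma vanishing_tendsto: "vanishing \<longlonglongrightarrow> 0"
  by real_asymp

lemma gauss_smooth_tendsto:
  assumes k: "continuous_on UNIV k" "\<And>x. cmod (k x) \<le> B"
  shows "(\<lambda>n. gauss_smooth (vanishing n) k x) \<longlonglongrightarrow> k x"
proof -
  have [measurable]: "k \<in> borel_measurable borel"
    by (rule borel_measurable_continuous_onI[OF k(1)])
  have "(\<lambda>n. LINT u|lborel. k (x - vanishing n * u) * std_normal_density u)
      \<longlonglongrightarrow> (LINT u|lborel. k x * std_normal_density u)"
  proof (rule integral_dominated_convergence[where w = "\<lambda>u. B * std_normal_density u"])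
    show "AE u in lborel. (\<lambda>n. k (x - vanishing n * u) * std_normal_density u) \<longlonglongrightarrow> k x * std_normal_density u"
    proof (rule AE_I2)
      fix u
      have "(\<lambda>n. x - vanishing n * u) \<longlonglongrightarrow> x - 0 * u"
        by (intro tendsto_intros vanishing_tendsto)
      then have "(\<lambda>n. k (x - vanishing n * u)) \<longlonglongrightarrow> k x"
        using k(1) by (intro continuous_on_tendsto_compose[of UNIV k]) auto
      then show "(\<lambda>n. k (x - vanishing n * u) * std_normal_density u) \<longlonglongrightarrow> k x * std_normal_density u"
        by (intro tendsto_intros)
    qed
    show "\<And>n. AE u in lborel. norm (k (x - vanishing n * u) * std_normal_density u) \<le> B * std_normal_density u"
      by (auto simp: norm_mult intro!: AE_I2 mult_right_mono k)
  qed auto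
  also have "(LINT u|lborel. k x * std_normal_density u) = k x"
    by (simp add: integral_mult_right_zero)
  finally show ?thesis
    by (subst gauss_smooth_affine) auto
qed

lemma gauss_weight_vanishing_tendsto: "(\<lambda>n. gauss_weight (vanishing n) \<xi>) \<longlonglongrightarrow> 1"
proof -
  have "(\<lambda>n. exp (- (2 * pi * vanishing n * \<xi>)\<^sup>2 / 2)) \<longlonglongrightarrow> exp (- (2 * pi * 0 * \<xi>)\<^sup>2 / 2)"
    by (intro tendsto_intros vanishing_tendsto) auto
  then show ?thesis by simp
qed

lemma schwartz_fun_le_seminorm: "cmod (schwartz_fun \<phi> x) \<le> schwartz_seminorm 0 0 \<phi>"
  using schwartz_seminorm_upper[of x 0 0 \<phi>] by simp

text \<open>Both sides are limits of the regularized formula as the Gaussian weight tends to one.\<close>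

lemma schwartz_fourier_inversion:
  "schwartz_fun \<phi> x = (LINT \<xi>|lborel. schwartz_fun (schwartz_fourier \<phi>) \<xi> * cis (2 * pi * x * \<xi>))"
proof (rule LIMSEQ_unique)
  show "(\<lambda>n. gauss_smooth (vanishing n) (schwartz_fun \<phi>) x) \<longlonglongrightarrow> schwartz_fun \<phi> x"
    by (rule gauss_smooth_tendsto[OF schwartz_fun_continuous schwartz_fun_le_seminorm])
  have "(\<lambda>n. LINT \<xi>|lborel. fourier_integral (schwartz_fun \<phi>) \<xi> * gauss_weight (vanishing n) \<xi> * cis (2 * pi * x * \<xi>))
      \<longlonglongrightarrow> (LINT \<xi>|lborel. schwartz_fun (schwartz_fourier \<phi>) \<xi> * cis (2 * pi * x * \<xi>))"
  proof (rule integral_dominated_convergence[where w = "\<lambda>\<xi>. cmod (schwartz_fun (schwartz_fourier \<phi>) \<xi>)"])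
    show "integrable lborel (\<lambda>\<xi>. cmod (schwartz_fun (schwartz_fourier \<phi>) \<xi>))"
      by (intro integrable_norm schwartz_fun_integrable)
    show "AE \<xi> in lborel. (\<lambda>n. fourier_integral (schwartz_fun \<phi>) \<xi> * gauss_weight (vanishing n) \<xi> * cis (2 * pi * x * \<xi>))
        \<longlonglongrightarrow> schwartz_fun (schwartz_fourier \<phi>) \<xi> * cis (2 * pi * x * \<xi>)"
    proof (rule AE_I2)
      fix \<xi>
      have "(\<lambda>n. fourier_integral (schwartz_fun \<phi>) \<xi> * of_real (gauss_weight (vanishing n) \<xi>) * cis (2 * pi * x * \<xi>))
        \<longlonglongrightarrow> schwartz_fun (schwartz_fourier \<phi>) \<xi> * of_real 1 * cis (2 * pi * x * \<xi>)"
        unfolding schwartz_fourier.rep_eq by (intro tendsto_intros gauss_weight_vanishing_tendsto)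
      then show "(\<lambda>n. fourier_integral (schwartz_fun \<phi>) \<xi> * gauss_weight (vanishing n) \<xi> * cis (2 * pi * x * \<xi>))
        \<longlonglongrightarrow> schwartz_fun (schwartz_fourier \<phi>) \<xi> * cis (2 * pi * x * \<xi>)" by simp
    qed
    show "AE \<xi> in lborel. norm (fourier_integral (schwartz_fun \<phi>) \<xi> * gauss_weight (vanishing n) \<xi> * cis (2 * pi * x * \<xi>))
        \<le> cmod (schwartz_fun (schwartz_fourier \<phi>) \<xi>)" for n
      by (auto intro!: AE_I2 mult_left_le simp: norm_mult schwartz_fourier.rep_eq)
  qed measurable
  then show "(\<lambda>n. gauss_smooth (vanishing n) (schwartz_fun \<phi>) x)
      \<longlonglongrightarrow> (LINT \<xi>|lborel. schwartz_fun (schwartz_fourier \<phi>) \<xi> * cis (2 * pi * x * \<xi>))"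
    by (subst (asm) fourier_regularization) (auto simp: schwartz_fun_integrable)
qed

text \<open>By inversion, two Fourier transforms amount to a reflection.\<close>

lemma schwartz_fourier_surj: "\<exists>\<psi>. schwartz_fourier \<psi> = \<phi>"
proof -
  have "schwartz_fourier (schwartz_fourier (schwartz_reflect \<phi>)) = \<phi>"
  proof -
    have "schwartz_fun (schwartz_fourier (schwartz_fourier (schwartz_reflect \<phi>))) x = schwartz_fun \<phi> x" for x
    proof -
      have "schwartz_fun \<phi> x = schwartz_fun (schwartz_reflect \<phi>) (- x)"
        by (simp add: schwartz_reflect_at.rep_eq)
      also have "\<dots> = schwartz_fun (schwartz_fourier (schwartz_fourier (schwartz_reflect \<phi>))) x"
        unfolding schwartz_fourier_inversion[of "schwartz_reflect \<phi>"] schwartz_fourier.rep_eq[of "schwartz_fourier _"]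
          fourier_integral_def[of "schwartz_fun (schwartz_fourier _)"]
        by (intro Bochner_Integration.integral_cong) (auto simp: mult_ac)
      finally show ?thesis ..
    qed
    then show ?thesis by (simp add: schwartz_fun_inject[symmetric] fun_eq_iff)
  qed
  then show ?thesis ..
qed

section \<open>The Plancherel theorem\<close>

text \<open>First \<open>h\<close> is truncated in height and support. The truncated function is almost everywhere a limit of
  continuous functions; clamping these to the same height and essentially the same support makes the convergence dominated.\<close>

lemma L2_dense_continuous:
  fixes h :: "real \<Rightarrow> complex"
  assumes [measurable]: "h \<in> borel_measurable borel" and h2: "integrable lborel (\<lambda>x. (cmod (h x))\<^sup>2)" and "e > 0"
  obtains k B where "continuous_on UNIV k" "\<And>x. cmod (k x) \<le> B"
    "integrable lborel (\<lambda>x. (cmod (h x - k x))\<^sup>2)" "(LBINT x. (cmod (h x - k x))\<^sup>2) < e"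
proof -
  define hK where "hK n x = (if \<bar>x\<bar> \<le> real (Suc n) \<and> cmod (h x) \<le> real (Suc n) then h x else 0)" for n x
  have [measurable]: "hK n \<in> borel_measurable borel" for n
    unfolding hK_def[abs_def] by measurable
  have "(\<lambda>n. LBINT x. (cmod (h x - hK n x))\<^sup>2) \<longlonglongrightarrow> (LINT x|(lborel :: real measure). 0)"
  proof (rule integral_dominated_convergence[where w = "\<lambda>x. (cmod (h x))\<^sup>2"])
    show "AE x in lborel. (\<lambda>n. (cmod (h x - hK n x))\<^sup>2) \<longlonglongrightarrow> 0"
    proof (rule AE_I2, rule tendsto_eventually)
      fix x
      obtain m where "max \<bar>x\<bar> (cmod (h x)) \<le> real m" using real_arch_simple by blast
      then show "\<forall>\<^sub>F n in sequentially. (cmod (h x - hK n x))\<^sup>2 = 0"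
        by (auto simp: eventually_sequentially hK_def intro!: exI[of _ m])
    qed
  qed (use h2 in \<open>auto simp: hK_def\<close>)
  then have "(\<lambda>n. LBINT x. (cmod (h x - hK n x))\<^sup>2) \<longlonglongrightarrow> 0" by simp
  then have "\<forall>\<^sub>F n in sequentially. (LBINT x. (cmod (h x - hK n x))\<^sup>2) < e / 4"
    using \<open>e > 0\<close> by (intro order_tendstoD) auto
  then obtain n where n: "(LBINT x. (cmod (h x - hK n x))\<^sup>2) < e / 4"
    by (auto simp: eventually_sequentially)
  define K where "K = real (Suc n)"
  have "K > 0" by (simp add: K_def)
  have hK0: "hK n x = 0" if "\<bar>x\<bar> > K" for x using that by (simp add: hK_def K_def)
  have hKb: "cmod (hK n x) \<le> K" for x by (simp add: hK_def K_def)
  have int1: "integrable lborel (\<lambda>x. (cmod (h x - hK n x))\<^sup>2)"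
    by (rule Bochner_Integration.integrable_bound[OF h2]) (auto simp: hK_def)
  \<comment> \<open>the radial retraction onto the disc of radius \<open>K\<close>\<close>
  define c where "c z = z / of_real (max 1 (cmod z / K))" for z :: complex
  have c_cont: "continuous_on UNIV c"
    unfolding c_def[abs_def] using \<open>K > 0\<close> by (intro continuous_intros) (auto simp: max_def)
  have c_le: "cmod (c z) \<le> K" for z
    using \<open>K > 0\<close> by (auto simp: c_def norm_divide max_def field_simps)
  have c_id: "c z = z" if "cmod z \<le> K" for z
    using \<open>K > 0\<close> that by (simp add: c_def max_def field_simps)
  define cut where "cut x = max 0 (min 1 (K + 1 - \<bar>x\<bar>))" for x :: real
  have "hK n \<in> borel_measurable (lebesgue_on UNIV)"
    by (simp add: borel_measurable_if_I lebesgue_on_UNIV_eq) (auto intro!: measurable_completion)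
  then have "hK n measurable_on UNIV"
    by (simp add: measurable_on_iff_borel_measurable)
  then obtain Z g where Z: "negligible Z" and g: "\<And>m. continuous_on UNIV (g m)"
    "\<And>x. x \<notin> Z \<Longrightarrow> (\<lambda>m. g m x) \<longlonglongrightarrow> hK n x"
    unfolding measurable_on_def by auto
  define k where "k m x = cut x *\<^sub>R c (g m x)" for m x
  let ?d = "\<lambda>m x. (cmod (hK n x - k m x))\<^sup>2"
  have k_cont: "continuous_on UNIV (k m)" for m
    unfolding k_def[abs_def] cut_def
    by (intro continuous_intros continuous_on_compose2[OF c_cont g(1)]) auto
  have [measurable]: "k m \<in> borel_measurable borel" for m
    by (rule borel_measurable_continuous_onI[OF k_cont])
  have k_le: "cmod (k m x) \<le> K" for m x
  proof -
    have "\<bar>cut x\<bar> * cmod (c (g m x)) \<le> 1 * K" by (intro mult_mono c_le) (auto simp: cut_def)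
    then show ?thesis by (simp add: k_def)
  qed
  have bd: "?d m x \<le> (2 * K)\<^sup>2 * indicator {-(K+1)..K+1} x" for m x
  proof (cases "\<bar>x\<bar> \<le> K + 1")
    case True
    have "cmod (hK n x - k m x) \<le> K + K"
      by (rule order_trans[OF norm_triangle_ineq4 add_mono[OF hKb k_le]])
    then have "?d m x \<le> (2 * K)\<^sup>2" by (intro power_mono) auto
    with True show ?thesis by (simp add: indicator_def abs_le_iff)
  next
    case False
    then show ?thesis by (simp add: hK0 k_def cut_def)
  qed
  have iw: "integrable lborel (\<lambda>x. (2 * K)\<^sup>2 * indicator {-(K+1)..K+1} x :: real)"
    by (intro integrable_mult_right integrable_real_indicator) (use emeasure_bounded_finite[of "{- (K + 1)..K + 1}"] in simp_all)
  have int2: "integrable lborel (\<lambda>x. ?d m x)" for m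
    by (rule Bochner_Integration.integrable_bound[OF iw]) (use bd in \<open>auto intro!: AE_I2\<close>)
  have "(\<lambda>m. LBINT x. ?d m x) \<longlonglongrightarrow> (LINT x|(lborel :: real measure). 0)"
  proof (rule integral_dominated_convergence[OF _ _ iw])
    have "AE x in lebesgue. x \<notin> Z"
      using Z by (intro AE_not_in) (simp only: negligible_iff_null_sets)
    then have "AE x in lborel. x \<notin> Z"
      by (simp only: AE_completion_iff)
    then show "AE x in lborel. (\<lambda>m. ?d m x) \<longlonglongrightarrow> 0"
    proof eventually_elim
      case (elim x)
      have "(\<lambda>m. c (g m x)) \<longlonglongrightarrow> c (hK n x)"
        using c_cont g(2)[OF elim] by (intro continuous_on_tendsto_compose[of UNIV c]) auto
      then have "(\<lambda>m. (cmod (hK n x - cut x *\<^sub>R c (g m x)))\<^sup>2) \<longlonglongrightarrow> (cmod (hK n x - cut x *\<^sub>R c (hK n x)))\<^sup>2"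
        by (intro tendsto_intros)
      moreover have "cut x *\<^sub>R c (hK n x) = hK n x"
        using c_id[OF hKb, of x] hK0[of x] by (cases "\<bar>x\<bar> \<le> K") (auto simp: cut_def)
      ultimately show ?case by (simp add: k_def)
    qed
  qed (use bd in \<open>auto intro!: AE_I2\<close>)
  then have "(\<lambda>m. LBINT x. ?d m x) \<longlonglongrightarrow> 0" by simp
  then have "\<forall>\<^sub>F m in sequentially. (LBINT x. ?d m x) < e / 4"
    using \<open>e > 0\<close> by (intro order_tendstoD) auto
  then obtain m where m: "(LBINT x. ?d m x) < e / 4"
    by (auto simp: eventually_sequentially)
  let ?w = "\<lambda>x. 2 * (cmod (h x - hK n x))\<^sup>2 + 2 * ?d m x"
  have le: "(cmod (h x - k m x))\<^sup>2 \<le> ?w x" for x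
  proof -
    have "cmod (h x - k m x) \<le> cmod (h x - hK n x) + cmod (hK n x - k m x)"
      using norm_triangle_ineq[of "h x - hK n x" "hK n x - k m x"] by simp
    then have "(cmod (h x - k m x))\<^sup>2 \<le> (cmod (h x - hK n x) + cmod (hK n x - k m x))\<^sup>2"
      by (intro power_mono) auto
    also have "\<dots> \<le> ?w x"
      using sum_squares_bound[of "cmod (h x - hK n x)" "cmod (hK n x - k m x)"] by (simp add: power2_sum)
    finally show ?thesis .
  qed
  have iw': "integrable lborel ?w"
    by (intro Bochner_Integration.integrable_add integrable_mult_right int1 int2)
  have i: "integrable lborel (\<lambda>x. (cmod (h x - k m x))\<^sup>2)"
    by (rule Bochner_Integration.integrable_bound[OF iw']) (use le in \<open>auto intro!: AE_I2\<close>)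
  have "(LBINT x. (cmod (h x - k m x))\<^sup>2) \<le> (LBINT x. ?w x)"
    by (intro integral_mono i iw' le)
  also have "\<dots> < e" using n m by (simp add: int1 int2)
  finally show ?thesis
    using that[OF k_cont k_le i] by blast
qed

lemma gauss_smooth_measurable [measurable]:
  assumes [measurable]: "h \<in> borel_measurable borel"
  shows "gauss_smooth \<delta> h \<in> borel_measurable borel"
  by measurable

lemma norm_integral_le_nn_integral:
  fixes f :: "'a \<Rightarrow> 'b::{banach, second_countable_topology}"
  shows "ennreal (norm (integral\<^sup>L M f)) \<le> (\<integral>\<^sup>+ x. norm (f x) \<partial>M)"
  by (cases "integrable M f") (auto intro: integral_norm_bound_ennreal simp: not_integrable_integral_eq)

lemma mult_le_weighted_squares:
  fixes a b :: real assumes "t > 0" shows "a * b \<le> (t * a\<^sup>2 + b\<^sup>2 / t) / 2"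
proof -
  have "0 \<le> (t * a - b)\<^sup>2 / t" using assms by simp
  also have "\<dots> = t * a\<^sup>2 + b\<^sup>2 / t - 2 * (a * b)"
    using assms by (simp add: power2_eq_square field_simps)
  finally show ?thesis by simp
qed

text \<open>Smoothing averages translates of \<open>m\<close>, which all have the same norm. The product of norms from the
  Cauchy-Schwarz inequality appears here as a weighted arithmetic mean with free weight \<open>t\<close>; what matters is that the
  bound does not depend on \<open>\<delta>\<close>.\<close>

lemma nn_integral_mult_gauss_smooth_le:
  fixes h m :: "real \<Rightarrow> complex"
  assumes [measurable]: "h \<in> borel_measurable borel" "m \<in> borel_measurable borel"
    and h2: "integrable lborel (\<lambda>x. (cmod (h x))\<^sup>2)" and m2: "integrable lborel (\<lambda>x. (cmod (m x))\<^sup>2)"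
    and pos: "t > 0" "\<delta> > 0"
  shows "(\<integral>\<^sup>+ x. ennreal (cmod (h x) * cmod (gauss_smooth \<delta> m x)) \<partial>lborel)
    \<le> ennreal ((t * (LBINT x. (cmod (h x))\<^sup>2) + (LBINT x. (cmod (m x))\<^sup>2) / t) / 2)" (is "_ \<le> ennreal ?C")
proof -
  let ?f = "\<lambda>x u. (t * (cmod (h x))\<^sup>2 + (cmod (m (x - \<delta> * u)))\<^sup>2 / t) / 2"
  let ?g = "\<lambda>x u. ennreal (std_normal_density u) * ennreal (?f x u)"
  have "(\<integral>\<^sup>+ x. ennreal (cmod (h x) * cmod (gauss_smooth \<delta> m x)) \<partial>lborel)
    \<le> (\<integral>\<^sup>+ x. \<integral>\<^sup>+ u. ?g x u \<partial>lborel \<partial>lborel)"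
  proof (rule nn_integral_mono)
    fix x
    have "ennreal (cmod (h x) * cmod (gauss_smooth \<delta> m x))
      = ennreal (cmod (h x)) * ennreal (cmod (LINT u|lborel. m (x - \<delta> * u) * std_normal_density u))"
      unfolding gauss_smooth_affine[OF pos(2)] by (simp add: ennreal_mult)
    also have "\<dots> \<le> ennreal (cmod (h x)) * (\<integral>\<^sup>+ u. norm (m (x - \<delta> * u) * std_normal_density u) \<partial>lborel)"
      by (intro mult_left_mono norm_integral_le_nn_integral) auto
    also have "\<dots> = (\<integral>\<^sup>+ u. ennreal (cmod (h x)) * norm (m (x - \<delta> * u) * std_normal_density u) \<partial>lborel)"
      by (subst nn_integral_cmult) auto
    also have "\<dots> \<le> (\<integral>\<^sup>+ u. ?g x u \<partial>lborel)"
    proof (rule nn_integral_mono)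
      fix u
      have "cmod (h x) * norm (m (x - \<delta> * u) * std_normal_density u) = std_normal_density u * (cmod (h x) * cmod (m (x - \<delta> * u)))"
        by (simp add: norm_mult)
      also have "\<dots> \<le> std_normal_density u * ?f x u"
        by (intro mult_left_mono mult_le_weighted_squares pos) auto
      finally show "ennreal (cmod (h x)) * norm (m (x - \<delta> * u) * std_normal_density u) \<le> ?g x u"
        using pos by (simp add: ennreal_mult[symmetric] ennreal_leI)
    qed
    finally show "ennreal (cmod (h x) * cmod (gauss_smooth \<delta> m x)) \<le> (\<integral>\<^sup>+ u. ?g x u \<partial>lborel)" .
  qed
  also have "\<dots> = (\<integral>\<^sup>+ u. \<integral>\<^sup>+ x. ?g x u \<partial>lborel \<partial>lborel)"
    by (rule lborel_pair.Fubini') measurable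
  also have "\<dots> = (\<integral>\<^sup>+ u. ennreal (std_normal_density u) * ennreal ?C \<partial>lborel)"
  proof (rule nn_integral_cong)
    fix u
    have sh: "integrable lborel (\<lambda>x. (cmod (m (x - \<delta> * u)))\<^sup>2)"
      using lborel_integrable_real_affine[OF m2, of 1 "- \<delta> * u"] by (simp add: algebra_simps)
    have "(LBINT x. (cmod (m (x - \<delta> * u)))\<^sup>2) = (LBINT x. (cmod (m x))\<^sup>2)"
      using lborel_integral_real_affine[of 1 "\<lambda>x. (cmod (m x))\<^sup>2" "- \<delta> * u"] by (simp add: algebra_simps)
    then have "(LBINT x. ?f x u) = ?C"
      using sh h2 by simp
    moreover have "integrable lborel (\<lambda>x. ?f x u)"
      using sh h2 by simp
    moreover have "\<And>x. 0 \<le> ?f x u" using pos by simp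
    ultimately have "(\<integral>\<^sup>+ x. ennreal (?f x u) \<partial>lborel) = ennreal ?C"
      by (subst nn_integral_eq_integral) auto
    then show "(\<integral>\<^sup>+ x. ?g x u \<partial>lborel) = ennreal (std_normal_density u) * ennreal ?C"
      by (subst nn_integral_cmult) auto
  qed
  also have "\<dots> = ennreal ?C"
    by (subst nn_integral_multc) (auto simp: nn_integral_eq_integral)
  finally show ?thesis .
qed

text \<open>For a bounded continuous function smoothing converges pointwise and boundedly. Replacing the \<open>h\<close> that
  is smoothed by such a function costs little, uniformly in \<open>n\<close>.\<close>

lemma gauss_smooth_L2_tendsto:
  assumes h: "integrable lborel h" and h2: "integrable lborel (\<lambda>x. (cmod (h x))\<^sup>2)"
  shows "(\<lambda>n. LINT x|lborel. cnj (h x) * gauss_smooth (vanishing n) h x) \<longlonglongrightarrow> of_real (LBINT x. (cmod (h x))\<^sup>2)"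
proof (rule LIMSEQ_I)
  fix e :: real assume "e > 0"
  have [measurable]: "h \<in> borel_measurable borel" using h by auto
  define H where "H = (LBINT x. (cmod (h x))\<^sup>2)"
  have "H \<ge> 0" by (simp add: H_def)
  \<comment> \<open>this weight makes the uniform pairing bound at most \<open>e / 4\<close>\<close>
  define t where "t = e / (2 * (H + 1))"
  have "t > 0" using \<open>e > 0\<close> \<open>H \<ge> 0\<close> by (simp add: t_def)
  obtain k B where k: "continuous_on UNIV k" "\<And>x. cmod (k x) \<le> B"
    and m2: "integrable lborel (\<lambda>x. (cmod (h x - k x))\<^sup>2)" and m: "(LBINT x. (cmod (h x - k x))\<^sup>2) < t\<^sup>2"
    using L2_dense_continuous[OF _ h2, of "t\<^sup>2"] \<open>t > 0\<close> by auto
  have [measurable]: "k \<in> borel_measurable borel"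
    by (rule borel_measurable_continuous_onI[OF k(1)])
  let ?e = "LBINT x. (cmod (h x - k x))\<^sup>2"
  have small: "(t * H + ?e / t) / 2 \<le> e / 4"
  proof -
    have "?e / t \<le> t"
      using m \<open>t > 0\<close> by (simp add: field_simps power2_eq_square)
    then have "t * H + ?e / t \<le> t * (H + 1)"
      by (simp add: distrib_left)
    then have "(t * H + ?e / t) / 2 \<le> t * (H + 1) / 2"
      by (rule divide_right_mono) simp
    also have "\<dots> = e / 4" 
    proof -
      have "e / (2 * y) * y / 2 = e / 4" if "y > 0" for y using that by simp
      from this[of "H + 1"] show ?thesis using \<open>H \<ge> 0\<close> by (simp only: t_def)
    qed
    finally show ?thesis .
  qed
  let ?G = "\<lambda>n. gauss_smooth (vanishing n)"
  let ?m = "\<lambda>x. h x - k x"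
  let ?p = "\<lambda>u. LINT x|lborel. cnj (h x) * u x"
  have iN: "integrable lborel (\<lambda>y. complex_of_real (normal_density 0 \<delta> (x - y)))" if "\<delta> > 0" for \<delta> x
  proof -
    have "normal_density 0 \<delta> (x - y) = normal_density x \<delta> y" for y
      by (simp add: normal_density_def power2_commute)
    then show ?thesis using that by (simp add: integrable_of_real)
  qed
  have ih: "integrable lborel (\<lambda>y. h y * normal_density 0 (vanishing n) (x - y))" for n x
    by (rule integrable_mult_bounded[OF h, where B = "1 / sqrt (2 * pi * (vanishing n)\<^sup>2)"])
       (use normal_density_0_le in auto)
  have ik: "integrable lborel (\<lambda>y. k y * normal_density 0 (vanishing n) (x - y))" for n x
    unfolding mult.commute[of "k _"] by (rule integrable_mult_bounded[OF iN _ k(2)]) auto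
  have Gm: "?G n ?m x = ?G n h x - ?G n k x" for n x
    unfolding left_diff_distrib by (rule Bochner_Integration.integral_diff[OF ih ik])
  have Gk_le: "cmod (?G n k x) \<le> B" for n x
  proof -
    have "B \<ge> 0" using k(2)[of 0] norm_ge_zero order_trans by blast
    have "cmod (?G n k x) = cmod (LINT u|lborel. k (x - vanishing n * u) * std_normal_density u)"
      by (subst gauss_smooth_affine) auto
    also have "\<dots> \<le> (LBINT u. B * std_normal_density u)"
    proof (rule order_trans[OF integral_norm_bound], rule integral_mono')
      show "norm (k (x - vanishing n * u) * std_normal_density u) \<le> B * std_normal_density u" for u
        by (auto simp: norm_mult intro!: mult_right_mono k)
      show "0 \<le> B * std_normal_density u" for u using \<open>B \<ge> 0\<close> by simp
    qed simp
    finally have "cmod (?G n k x) \<le> (LBINT u. B * std_normal_density u)" .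
    then show ?thesis by simp
  qed
  have Gh_le: "cmod (?G n h x) \<le> (LBINT y. 1 / sqrt (2 * pi * (vanishing n)\<^sup>2) * cmod (h y))" for n x
  proof (rule order_trans[OF integral_norm_bound], rule integral_mono')
    show "integrable lborel (\<lambda>y. 1 / sqrt (2 * pi * (vanishing n)\<^sup>2) * cmod (h y))"
      using h by (intro integrable_mult_right integrable_norm)
    show "norm (h y * normal_density 0 (vanishing n) (x - y)) \<le> 1 / sqrt (2 * pi * (vanishing n)\<^sup>2) * cmod (h y)" for y
      using mult_right_mono[OF normal_density_0_le, of "cmod (h y)" "vanishing n" "x - y"]
      by (simp add: norm_mult mult.commute)
  qed auto
  have ch: "integrable lborel (\<lambda>x. cnj (h x))" using h by simp
  have iGh: "integrable lborel (\<lambda>x. cnj (h x) * ?G n h x)" for n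
    by (rule integrable_mult_bounded[OF ch _ Gh_le]) measurable
  have iGk: "integrable lborel (\<lambda>x. cnj (h x) * ?G n k x)" for n
    by (rule integrable_mult_bounded[OF ch _ Gk_le]) measurable
  have ik': "integrable lborel (\<lambda>x. cnj (h x) * k x)"
    by (rule integrable_mult_bounded[where k = k and B = B, OF ch _ k(2)]) measurable
  have i2: "integrable lborel (\<lambda>x. cnj (h x) * h x)"
    using integrable_of_real[OF h2, where 'a = complex] unfolding complex_norm_square by (simp add: mult.commute)
  have lim: "(\<lambda>n. ?p (?G n k)) \<longlonglongrightarrow> (?p k)"
  proof (rule integral_dominated_convergence[where w = "\<lambda>x. cmod (h x) * B"])
    show "AE x in lborel. (\<lambda>n. cnj (h x) * ?G n k x) \<longlonglongrightarrow> cnj (h x) * k x"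
      by (intro AE_I2 tendsto_intros gauss_smooth_tendsto[where B = B, OF k])
    show "AE x in lborel. norm (cnj (h x) * ?G n k x) \<le> cmod (h x) * B" for n
      using Gk_le by (auto intro!: AE_I2 mult_left_mono simp: norm_mult)
    show "(\<lambda>x. cnj (h x) * k x) \<in> borel_measurable lborel"
      "\<And>n. (\<lambda>x. cnj (h x) * ?G n k x) \<in> borel_measurable lborel" by measurable
  qed (use h in simp)
  then obtain n0 where n0: "\<And>n. n \<ge> n0 \<Longrightarrow> cmod ((?p (?G n k)) - (?p k)) < e / 2"
    using LIMSEQ_D[OF lim, of "e / 2"] \<open>e > 0\<close> by auto
  have t1: "cmod (?p (?G n ?m)) \<le> e / 4" for n
  proof -
    have "ennreal (cmod (?p (?G n ?m))) \<le> (\<integral>\<^sup>+ x. ennreal (cmod (h x) * cmod (?G n ?m x)) \<partial>lborel)"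
      using norm_integral_le_nn_integral[of lborel "\<lambda>x. cnj (h x) * ?G n ?m x"] by (simp only: norm_mult complex_mod_cnj)
    also have "\<dots> \<le> ennreal ((t * H + ?e / t) / 2)"
      unfolding H_def by (intro nn_integral_mult_gauss_smooth_le h2 m2 \<open>t > 0\<close>) auto
    also have "\<dots> \<le> ennreal (e / 4)" by (rule ennreal_leI[OF small])
    finally show ?thesis using \<open>e > 0\<close> by simp
  qed
  have t2: "cmod (?p ?m) \<le> e / 4"
  proof -
    have "cmod (?p ?m) \<le> (LBINT x. (t * (cmod (h x))\<^sup>2 + (cmod (?m x))\<^sup>2 / t) / 2)"
    proof (rule order_trans[OF integral_norm_bound], rule integral_mono')
      show "integrable lborel (\<lambda>x. (t * (cmod (h x))\<^sup>2 + (cmod (?m x))\<^sup>2 / t) / 2)"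
        using h2 m2 by simp
      show "norm (cnj (h x) * ?m x) \<le> (t * (cmod (h x))\<^sup>2 + (cmod (?m x))\<^sup>2 / t) / 2" for x
        using mult_le_weighted_squares[OF \<open>t > 0\<close>, of "cmod (h x)" "cmod (?m x)"] by (simp add: norm_mult)
    qed (use \<open>t > 0\<close> in auto)
    also have "\<dots> = (t * H + ?e / t) / 2"
      using h2 m2 by (simp add: H_def)
    finally show ?thesis using small by linarith
  qed
  show "\<exists>n0. \<forall>n\<ge>n0. norm ((?p (?G n h)) - of_real (LBINT x. (cmod (h x))\<^sup>2)) < e"
  proof (intro exI[of _ n0] allI impI)
    fix n assume "n \<ge> n0"
    have sq: "of_real (LBINT x. (cmod (h x))\<^sup>2) = (?p h)"
      unfolding integral_complex_of_real[symmetric] by (simp only: complex_norm_square mult.commute)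
    have "(?p (?G n ?m)) = (?p (?G n h)) - (?p (?G n k))"
      unfolding Gm right_diff_distrib by (rule Bochner_Integration.integral_diff[OF iGh iGk])
    moreover have "(?p ?m) = (?p h) - (?p k)"
      unfolding right_diff_distrib by (rule Bochner_Integration.integral_diff[OF i2 ik'])
    ultimately have "(?p (?G n h)) - of_real (LBINT x. (cmod (h x))\<^sup>2)
      = ((?p (?G n k)) - (?p k))
        + ((?p (?G n ?m)) - (?p ?m))"
      unfolding sq by simp
    also have "cmod \<dots> < e / 2 + (e / 4 + e / 4)"
      by (rule order.strict_trans1[OF norm_triangle_ineq add_less_le_mono[OF n0[OF \<open>n \<ge> n0\<close>]
              order_trans[OF norm_triangle_ineq4 add_mono[OF t1 t2]]]])
    finally show "norm ((?p (?G n h)) - of_real (LBINT x. (cmod (h x))\<^sup>2)) < e"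
      by simp
  qed
qed

text \<open>By the regularized inversion formula, the integral of \<open>|F h|\<^sup>2\<close> against the Gaussian weight is the pairing
  of \<open>h\<close> with its smoothing. As the weight increases to one, the former converges by monotone convergence and the
  latter by \<open>gauss_smooth_L2_tendsto\<close>, which yields integrability and equality at once.\<close>

lemma fourier_plancherel:
  assumes h: "integrable lborel h" and h2: "integrable lborel (\<lambda>x. (cmod (h x))\<^sup>2)"
  shows "integrable lborel (\<lambda>\<xi>. (cmod (fourier_integral h \<xi>))\<^sup>2)"
    and "(LBINT \<xi>. (cmod (fourier_integral h \<xi>))\<^sup>2) = (LBINT x. (cmod (h x))\<^sup>2)"
proof -
  have [measurable]: "h \<in> borel_measurable borel" using h by auto
  let ?F = "fourier_integral h"
  let ?w = "\<lambda>n. gauss_weight (vanishing n)"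
  let ?k = "\<lambda>n x \<xi>. cnj (h x) * (?F \<xi> * ?w n \<xi>) * cis (2 * pi * x * \<xi>)"
  let ?s = "\<lambda>n \<xi>. (cmod (?F \<xi>))\<^sup>2 * ?w n \<xi>"
  have iw: "integrable lborel (\<lambda>\<xi>. complex_of_real (?w n \<xi>))" for n
    by (intro integrable_of_real integrable_gauss_weight) auto
  have iF: "integrable lborel (\<lambda>\<xi>. ?F \<xi> * ?w n \<xi>)" for n
    unfolding mult.commute[of "?F _"]
    by (rule integrable_mult_bounded[OF iw _ cmod_fourier_integral_le]) measurable
  have eq: "(LINT \<xi>|lborel. of_real (?s n \<xi>)) = (LINT x|lborel. cnj (h x) * gauss_smooth (vanishing n) h x)" for n
  proof -
    have "(LINT \<xi>|lborel. of_real (?s n \<xi>))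
      = (LINT \<xi>|lborel. LINT x|lborel. ?k n x \<xi>)"
    proof (intro Bochner_Integration.integral_cong refl)
      fix \<xi>
      have "cnj (?F \<xi>) = (LINT x|lborel. cnj (h x) * cis (2 * pi * x * \<xi>))"
        unfolding fourier_integral_def by (subst Bochner_Integration.integral_cnj[symmetric]) (simp add: cis_cnj mult.commute)
      have "complex_of_real (?s n \<xi>) = (?F \<xi> * ?w n \<xi>) * cnj (?F \<xi>)"
        unfolding of_real_mult complex_norm_square by simp
      also have "\<dots> = (LINT x|lborel. (?F \<xi> * ?w n \<xi>) * (cnj (h x) * cis (2 * pi * x * \<xi>)))"
        unfolding \<open>cnj (?F \<xi>) = _\<close> integral_mult_right_zero ..
      also have "\<dots> = (LINT x|lborel. ?k n x \<xi>)"
        by (simp only: mult_ac)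
      finally show "complex_of_real (?s n \<xi>)
        = (LINT x|lborel. ?k n x \<xi>)" .
    qed
    also have "\<dots> = (LINT x|lborel. LINT \<xi>|lborel. ?k n x \<xi>)"
      using h by (intro Fubini_bounded_kernel[OF _ iF]) auto
    also have "\<dots> = (LINT x|lborel. cnj (h x) * gauss_smooth (vanishing n) h x)"
    proof (intro Bochner_Integration.integral_cong refl)
      fix x
      have "(LINT \<xi>|lborel. ?k n x \<xi>)
          = cnj (h x) * (LINT \<xi>|lborel. ?F \<xi> * ?w n \<xi> * cis (2 * pi * x * \<xi>))"
        unfolding integral_mult_right_zero[symmetric] by (simp only: mult.assoc)
      also have "(LINT \<xi>|lborel. ?F \<xi> * ?w n \<xi> * cis (2 * pi * x * \<xi>)) = gauss_smooth (vanishing n) h x"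
        by (rule fourier_regularization[OF h]) simp
      finally show "(LINT \<xi>|lborel. ?k n x \<xi>) = cnj (h x) * gauss_smooth (vanishing n) h x" .
    qed
    finally show ?thesis .
  qed
  have iFF: "integrable lborel (\<lambda>\<xi>. ?s n \<xi>)" for n
  proof (rule Bochner_Integration.integrable_bound)
    show "integrable lborel (\<lambda>\<xi>. (LINT x|lborel. cmod (h x))\<^sup>2 * ?w n \<xi>)"
      by (intro integrable_mult_right integrable_gauss_weight) auto
    show "AE \<xi> in lborel. norm (?s n \<xi>) \<le> norm ((LINT x|lborel. cmod (h x))\<^sup>2 * ?w n \<xi>)"
      by (auto intro!: AE_I2 mult_right_mono power_mono cmod_fourier_integral_le simp: abs_mult)
  qed measurable
  have "(\<lambda>n. complex_of_real (LBINT \<xi>. ?s n \<xi>)) \<longlonglongrightarrow> of_real (LBINT x. (cmod (h x))\<^sup>2)"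
    using gauss_smooth_L2_tendsto[OF h h2] unfolding eq[symmetric] integral_complex_of_real .
  then have lim: "(\<lambda>n. LBINT \<xi>. ?s n \<xi>) \<longlonglongrightarrow> (LBINT x. (cmod (h x))\<^sup>2)"
    unfolding tendsto_of_real_iff .
  have "(\<lambda>n. \<integral>\<^sup>+ \<xi>. ennreal (?s n \<xi>) \<partial>lborel) \<longlonglongrightarrow> (\<integral>\<^sup>+ \<xi>. ennreal ((cmod (?F \<xi>))\<^sup>2) \<partial>lborel)"
  proof (rule nn_integral_LIMSEQ)
    show "incseq (\<lambda>n \<xi>. ennreal (?s n \<xi>))"
    proof (intro incseq_SucI le_funI ennreal_leI mult_left_mono)
      fix n \<xi>
      have "vanishing (Suc n) \<le> vanishing n" by (simp add: field_simps)
      then have "\<bar>2 * pi * vanishing (Suc n) * \<xi>\<bar> \<le> \<bar>2 * pi * vanishing n * \<xi>\<bar>"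
        unfolding abs_mult by (intro mult_right_mono mult_left_mono) auto
      then have "(2 * pi * vanishing (Suc n) * \<xi>)\<^sup>2 \<le> (2 * pi * vanishing n * \<xi>)\<^sup>2"
        by (simp only: abs_le_square_iff)
      then show "?w n \<xi> \<le> ?w (Suc n) \<xi>" by simp
    qed auto
    show "(\<lambda>n. ennreal (?s n \<xi>)) \<longlonglongrightarrow> ennreal ((cmod (?F \<xi>))\<^sup>2)" for \<xi>
    proof -
      have "(\<lambda>n. ennreal (?s n \<xi>)) \<longlonglongrightarrow> ennreal ((cmod (?F \<xi>))\<^sup>2 * 1)"
        by (intro tendsto_intros tendsto_ennrealI gauss_weight_vanishing_tendsto)
      then show ?thesis by simp
    qed
  qed measurable
  moreover have "(\<integral>\<^sup>+ \<xi>. ennreal (?s n \<xi>) \<partial>lborel) = ennreal (LBINT \<xi>. ?s n \<xi>)" for n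
    by (intro nn_integral_eq_integral iFF) auto
  ultimately have "(\<lambda>n. ennreal (LBINT \<xi>. ?s n \<xi>)) \<longlonglongrightarrow> (\<integral>\<^sup>+ \<xi>. ennreal ((cmod (?F \<xi>))\<^sup>2) \<partial>lborel)"
    by simp
  from LIMSEQ_unique[OF this tendsto_ennrealI[OF lim]]
  have nn: "(\<integral>\<^sup>+ \<xi>. ennreal ((cmod (?F \<xi>))\<^sup>2) \<partial>lborel) = ennreal (LBINT x. (cmod (h x))\<^sup>2)" .
  show i: "integrable lborel (\<lambda>\<xi>. (cmod (?F \<xi>))\<^sup>2)"
    by (rule integrableI_nn_integral_finite[OF _ _ nn]) auto
  show "(LBINT \<xi>. (cmod (?F \<xi>))\<^sup>2) = (LBINT x. (cmod (h x))\<^sup>2)"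
    using nn by (subst (asm) nn_integral_eq_integral[OF i]) auto
qed

section \<open>Smooth multipliers and cutoffs\<close>

text \<open>The iterated derivatives of a function are carried along as explicit data, so that products and
  rescalings of smooth functions can be written down with all their derivatives.\<close>

definition smooth_family :: "(nat \<Rightarrow> real \<Rightarrow> complex) \<Rightarrow> bool" where
  "smooth_family F \<longleftrightarrow> (\<forall>n x. (F n has_vector_derivative F (Suc n) x) (at x))"

definition leibniz :: "(nat \<Rightarrow> real \<Rightarrow> complex) \<Rightarrow> (nat \<Rightarrow> real \<Rightarrow> complex) \<Rightarrow> nat \<Rightarrow> real \<Rightarrow> complex" where
  "leibniz F G n x = (\<Sum>k\<le>n. of_nat (n choose k) * (F k x * G (n - k) x))"

lemma sum_binomial_Suc:
  fixes a :: "nat \<Rightarrow> nat \<Rightarrow> 'a::comm_ring_1"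
  shows "(\<Sum>k\<le>n. of_nat (n choose k) * (a (Suc k) (n - k) + a k (Suc (n - k))))
    = (\<Sum>k\<le>Suc n. of_nat (Suc n choose k) * a k (Suc n - k))"
proof -
  have "(\<Sum>k\<le>Suc n. of_nat (Suc n choose k) * a k (Suc n - k))
      = a 0 (Suc n) + (\<Sum>k\<le>n. of_nat (Suc n choose Suc k) * a (Suc k) (n - k))"
    by (subst sum.atMost_Suc_shift) simp
  also have "(\<Sum>k\<le>n. of_nat (Suc n choose Suc k) * a (Suc k) (n - k))
      = (\<Sum>k\<le>n. of_nat (n choose k) * a (Suc k) (n - k)) + (\<Sum>k\<le>n. of_nat (n choose Suc k) * a (Suc k) (n - k))"
    by (simp add: sum.distrib[symmetric] distrib_right)
  also have "a 0 (Suc n) + (\<dots>)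
      = (\<Sum>k\<le>n. of_nat (n choose k) * a (Suc k) (n - k)) + (\<Sum>k\<le>Suc n. of_nat (n choose k) * a k (Suc n - k))"
    by (subst sum.atMost_Suc_shift) simp
  also have "(\<Sum>k\<le>Suc n. of_nat (n choose k) * a k (Suc n - k)) = (\<Sum>k\<le>n. of_nat (n choose k) * a k (Suc (n - k)))"
    by (simp add: Suc_diff_le binomial_eq_0)
  finally show ?thesis
    by (simp add: sum.distrib[symmetric] distrib_left)
qed

lemma smooth_family_leibniz:
  assumes "smooth_family F" "smooth_family G"
  shows "smooth_family (leibniz F G)"
  unfolding smooth_family_def
proof safe
  fix n x
  have "((\<lambda>x. \<Sum>k\<le>n. of_nat (n choose k) * (F k x * G (n - k) x)) has_vector_derivative
      (\<Sum>k\<le>n. of_nat (n choose k) * (F k x * G (Suc (n - k)) x + F (Suc k) x * G (n - k) x))) (at x)"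
    using assms by (intro has_vector_derivative_sum has_vector_derivative_mult_right has_vector_derivative_mult)
      (auto simp: smooth_family_def)
  then show "(leibniz F G n has_vector_derivative leibniz F G (Suc n) x) (at x)"
    unfolding leibniz_def[abs_def] sum_binomial_Suc[of n "\<lambda>i j. F i x * G j x", symmetric] by (simp add: add.commute)
qed

lemma leibniz_0: "leibniz F G 0 x = F 0 x * G 0 x"
  by (simp add: leibniz_def)

lemma smooth_family_affine:
  assumes "smooth_family F"
  shows "smooth_family (\<lambda>n x. of_real r ^ n * F n (r * x + c))"
  unfolding smooth_family_def
proof safe
  fix n x
  have "((F n \<circ> (\<lambda>x. r * x + c)) has_vector_derivative r *\<^sub>R F (Suc n) (r * x + c)) (at x)"
    using assms by (intro vector_diff_chain_at) (auto simp: smooth_family_def intro!: derivative_eq_intros)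
  from has_vector_derivative_mult_right[OF this, of "of_real r ^ n"]
  show "((\<lambda>x. of_real r ^ n * F n (r * x + c)) has_vector_derivative of_real r ^ Suc n * F (Suc n) (r * x + c)) (at x)"
    by (simp add: o_def scaleR_conv_of_real mult_ac)
qed

lemma smooth_family_schwartz: "smooth_family (\<lambda>n. nth_vderiv n (schwartz_fun \<phi>))"
  unfolding smooth_family_def by (blast intro: schwartz_fun_deriv)

lemma smooth_family_continuous: "smooth_family F \<Longrightarrow> continuous_on A (F n)"
  by (auto simp: smooth_family_def intro!: continuous_at_imp_continuous_on has_vector_derivative_continuous)

text \<open>Linear growth covers the multipliers used below: characters, and the difference of one and a cutoff.\<close>

definition moderate_family :: "(nat \<Rightarrow> real \<Rightarrow> complex) \<Rightarrow> bool" where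
  "moderate_family F \<longleftrightarrow> smooth_family F \<and> (\<forall>n. \<exists>C. \<forall>x. cmod (F n x) \<le> C * (1 + \<bar>x\<bar>))"

text \<open>The bound is linear in \<open>C\<close>, so multipliers whose constants tend to zero send every Schwartz function to
  zero in the Schwartz topology.\<close>

lemma leibniz_weighted_bound:
  assumes F: "\<And>k x. k \<le> b \<Longrightarrow> cmod (F k x) \<le> C * (1 + \<bar>x\<bar>)" and "C \<ge> 0"
  shows "\<bar>x\<bar> ^ a * cmod (leibniz F (\<lambda>n. nth_vderiv n (schwartz_fun \<phi>)) b x)
    \<le> C * (\<Sum>k\<le>b. real (b choose k) * (schwartz_seminorm a (b - k) \<phi> + schwartz_seminorm (Suc a) (b - k) \<phi>))"
proof -
  let ?G = "\<lambda>n. nth_vderiv n (schwartz_fun \<phi>)"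
  have "cmod (leibniz F ?G b x) \<le> (\<Sum>k\<le>b. real (b choose k) * (cmod (F k x) * cmod (?G (b - k) x)))"
    unfolding leibniz_def by (rule order_trans[OF norm_sum]) (simp add: norm_mult)
  then have "\<bar>x\<bar> ^ a * cmod (leibniz F ?G b x) \<le> \<bar>x\<bar> ^ a * (\<Sum>k\<le>b. real (b choose k) * (cmod (F k x) * cmod (?G (b - k) x)))"
    by (intro mult_left_mono) auto
  also have "\<dots> = (\<Sum>k\<le>b. real (b choose k) * (cmod (F k x) * (\<bar>x\<bar> ^ a * cmod (?G (b - k) x))))"
    by (simp add: sum_distrib_left mult_ac)
  also have "\<dots> \<le> (\<Sum>k\<le>b. real (b choose k) * (C * (1 + \<bar>x\<bar>) * (\<bar>x\<bar> ^ a * cmod (?G (b - k) x))))"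
    by (intro sum_mono mult_left_mono mult_right_mono F) auto
  also have "\<dots> = C * (\<Sum>k\<le>b. real (b choose k) * (\<bar>x\<bar> ^ a * cmod (?G (b - k) x) + \<bar>x\<bar> ^ Suc a * cmod (?G (b - k) x)))"
    by (simp add: sum_distrib_left algebra_simps)
  also have "\<dots> \<le> C * (\<Sum>k\<le>b. real (b choose k) * (schwartz_seminorm a (b - k) \<phi> + schwartz_seminorm (Suc a) (b - k) \<phi>))"
    using \<open>C \<ge> 0\<close> by (intro mult_left_mono sum_mono add_mono schwartz_seminorm_upper) auto
  finally show ?thesis .
qed

definition schwartz_mult :: "(real \<Rightarrow> complex) \<Rightarrow> schwartz \<Rightarrow> schwartz" where
  "schwartz_mult m \<phi> = Schwartz (\<lambda>x. m x * schwartz_fun \<phi> x)"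

lemma moderate_family_bounds:
  assumes "moderate_family F"
  obtains C where "C \<ge> 0" "\<And>k x. k \<le> b \<Longrightarrow> cmod (F k x) \<le> C * (1 + \<bar>x\<bar>)"
proof -
  obtain c where c: "\<And>n x. cmod (F n x) \<le> c n * (1 + \<bar>x\<bar>)"
    using assms unfolding moderate_family_def by metis
  have "c n \<ge> 0" for n
    using order_trans[OF norm_ge_zero c[of n 0]] by simp
  then have le: "c k \<le> (\<Sum>k\<le>b. c k)" if "k \<le> b" for k using that by (intro member_le_sum) auto
  show ?thesis
  proof
    show "(\<Sum>k\<le>b. c k) \<ge> 0" using \<open>\<And>n. c n \<ge> 0\<close> by (intro sum_nonneg)
    show "cmod (F k x) \<le> (\<Sum>k\<le>b. c k) * (1 + \<bar>x\<bar>)" if "k \<le> b" for k x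
      using order_trans[OF c mult_right_mono[OF le[OF that]]] by simp
  qed
qed

lemma schwartz_mult_moderate:
  assumes "moderate_family F"
  shows schwartz_fun_mult: "schwartz_fun (schwartz_mult (F 0) \<phi>) = (\<lambda>x. F 0 x * schwartz_fun \<phi> x)"
    and nth_vderiv_schwartz_mult: "nth_vderiv n (schwartz_fun (schwartz_mult (F 0) \<phi>))
      = leibniz F (\<lambda>n. nth_vderiv n (schwartz_fun \<phi>)) n"
proof -
  let ?L = "leibniz F (\<lambda>n. nth_vderiv n (schwartz_fun \<phi>))"
  have sm: "smooth_family ?L"
    using assms by (intro smooth_family_leibniz smooth_family_schwartz) (simp add: moderate_family_def)
  have L0: "?L 0 = (\<lambda>x. F 0 x * schwartz_fun \<phi> x)" by (simp add: fun_eq_iff leibniz_0)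
  have "(\<lambda>x. F 0 x * schwartz_fun \<phi> x) \<in> schwartz_functions"
  proof (rule schwartz_functionsI[where F = ?L])
    fix a b
    obtain C where "C \<ge> 0" "\<And>k x. k \<le> b \<Longrightarrow> cmod (F k x) \<le> C * (1 + \<bar>x\<bar>)"
      using moderate_family_bounds[OF assms] by blast
    from leibniz_weighted_bound[where F = F and C = C and b = b and a = a and \<phi> = \<phi>, OF this(2,1)]
    show "\<exists>C. \<forall>x. \<bar>x\<bar> ^ a * cmod (?L b x) \<le> C" by blast
  qed (use sm L0 in \<open>auto simp: smooth_family_def\<close>)
  then show eq: "schwartz_fun (schwartz_mult (F 0) \<phi>) = (\<lambda>x. F 0 x * schwartz_fun \<phi> x)"
    by (simp add: schwartz_mult_def Schwartz_inverse)
  show "nth_vderiv n (schwartz_fun (schwartz_mult (F 0) \<phi>)) = ?L n"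
    by (rule nth_vderiv_eqI) (use sm eq L0 in \<open>auto simp: smooth_family_def\<close>)
qed

lemma schwartz_seminorm_mult_le:
  assumes "moderate_family F" "\<And>k x. k \<le> b \<Longrightarrow> cmod (F k x) \<le> C * (1 + \<bar>x\<bar>)" "C \<ge> 0"
  shows "schwartz_seminorm a b (schwartz_mult (F 0) \<phi>)
    \<le> C * (\<Sum>k\<le>b. real (b choose k) * (schwartz_seminorm a (b - k) \<phi> + schwartz_seminorm (Suc a) (b - k) \<phi>))"
  by (rule schwartz_seminorm_least, subst nth_vderiv_schwartz_mult[OF assms(1)])
     (rule leibniz_weighted_bound[OF assms(2,3)])

lemma moderate_family_cis: "moderate_family (\<lambda>n x. (\<i> * of_real t) ^ n * cis (t * x))"
proof -
  have "((\<lambda>x. (\<i> * of_real t) ^ n * cis (t * x)) has_vector_derivative (\<i> * of_real t) ^ Suc n * cis (t * x)) (at x)" for n x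
  proof -
    have "((iexp \<circ> (\<lambda>x. t * x)) has_vector_derivative t *\<^sub>R (\<i> * iexp (t * x))) (at x)"
      by (intro vector_diff_chain_at has_vector_derivative_iexp) (auto intro!: derivative_eq_intros)
    from has_vector_derivative_mult_right[OF this, of "(\<i> * of_real t) ^ n"]
    show ?thesis by (simp add: o_def cis_conv_exp scaleR_conv_of_real mult_ac)
  qed
  moreover have "\<exists>C. \<forall>x. cmod ((\<i> * of_real t) ^ n * cis (t * x)) \<le> C * (1 + \<bar>x\<bar>)" for n
    by (rule exI[of _ "\<bar>t\<bar> ^ n"]) (auto simp: norm_mult norm_power mult_le_cancel_left1)
  ultimately show ?thesis by (simp add: moderate_family_def smooth_family_def)
qed

text \<open>The flat function \<open>exp (- 1/x)\<close>, times a polynomial in \<open>1/x\<close>: a class that is closed under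
  differentiation.\<close>

definition flat_fun :: "real poly \<Rightarrow> real \<Rightarrow> real" where
  "flat_fun p x = (if x > 0 then poly p (1 / x) * exp (- (1 / x)) else 0)"

definition flat_deriv :: "real poly \<Rightarrow> real poly" where
  "flat_deriv p = [:0, 0, 1:] * (p - pderiv p)"

lemma poly_times_exp_tendsto_0: "((\<lambda>y. poly p y * exp (- y)) \<longlongrightarrow> (0::real)) at_top"
proof -
  have "((\<lambda>y. \<Sum>i\<le>degree p. coeff p i * (y ^ i / exp y)) \<longlongrightarrow> (\<Sum>i\<le>degree p. coeff p i * 0)) at_top"
    by (intro tendsto_intros tendsto_power_div_exp_0)
  then show ?thesis
    by (simp add: poly_altdef sum_distrib_right exp_minus divide_inverse mult.assoc)
qed

lemma flat_fun_deriv: "(flat_fun p has_real_derivative flat_fun (flat_deriv p) x) (at x)"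
proof -
  consider "x > 0" | "x < 0" | "x = 0" by linarith
  then show ?thesis
  proof cases
    case 1
    have "((\<lambda>x. poly p (1 / x) * exp (- (1 / x))) has_real_derivative flat_fun (flat_deriv p) x) (at x)"
      using 1 by (auto intro!: derivative_eq_intros poly_DERIV[THEN DERIV_chain2]
        simp: flat_fun_def flat_deriv_def field_simps power2_eq_square)
    then show ?thesis
      by (rule DERIV_cong_ev[THEN iffD1, rotated -1])
         (use 1 in \<open>auto simp: flat_fun_def intro!: eventually_mono[OF eventually_nhds_in_open[of "{0<..}"]]\<close>)
  next
    case 2
    have "((\<lambda>x. 0) has_real_derivative flat_fun (flat_deriv p) x) (at x)"
      using 2 by (simp add: flat_fun_def)
    then show ?thesis
      by (rule DERIV_cong_ev[THEN iffD1, rotated -1])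
         (use 2 in \<open>auto simp: flat_fun_def intro!: eventually_mono[OF eventually_nhds_in_open[of "{..<0}"]]\<close>)
  next
    case 3
    have "((\<lambda>h. flat_fun p h / h) \<longlongrightarrow> 0) (at 0)"
    proof (rule filterlim_split_at)
      show "((\<lambda>h. flat_fun p h / h) \<longlongrightarrow> 0) (at_left 0)"
        by (rule tendsto_eventually) (auto simp: flat_fun_def eventually_at_filter)
      have "((\<lambda>h. poly (pCons 0 p) (inverse h) * exp (- inverse h)) \<longlongrightarrow> 0) (at_right 0)"
        by (rule filterlim_compose[OF poly_times_exp_tendsto_0 filterlim_inverse_at_top_right])
      then show "((\<lambda>h. flat_fun p h / h) \<longlongrightarrow> 0) (at_right 0)"
        by (rule Lim_transform_eventually)
           (auto simp: flat_fun_def eventually_at_filter field_simps)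
    qed
    then show ?thesis
      by (simp add: 3 DERIV_def flat_fun_def)
  qed
qed

definition flat_family :: "nat \<Rightarrow> real \<Rightarrow> complex" where
  "flat_family n x = of_real (flat_fun ((flat_deriv ^^ n) 1) x)"

lemma smooth_family_flat: "smooth_family flat_family"
  unfolding smooth_family_def flat_family_def
  by (auto intro!: has_vector_derivative_of_real simp: flat_fun_deriv has_real_derivative_iff_has_vector_derivative[symmetric])

definition bump_family :: "nat \<Rightarrow> real \<Rightarrow> complex" where
  "bump_family = leibniz (\<lambda>n x. of_real (- 1) ^ n * flat_family n (- 1 * x + 1)) (\<lambda>n x. of_real 1 ^ n * flat_family n (1 * x + 1))"

definition bump :: "real \<Rightarrow> real" where
  "bump x = flat_fun 1 (1 - x) * flat_fun 1 (1 + x)"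

lemma smooth_family_bump: "smooth_family bump_family"
  unfolding bump_family_def by (intro smooth_family_leibniz smooth_family_affine smooth_family_flat)

lemma bump_family_0: "bump_family 0 x = of_real (bump x)"
  by (simp add: bump_family_def leibniz_0 bump_def flat_family_def add.commute)

lemma bump_family_eq_0: "\<bar>x\<bar> \<ge> 1 \<Longrightarrow> bump_family n x = 0"
  unfolding bump_family_def leibniz_def
  by (intro sum.neutral) (auto simp: flat_family_def flat_fun_def)

lemma bump_continuous: "continuous_on UNIV bump"
proof -
  have "continuous_on UNIV (\<lambda>x. Re (bump_family 0 x))"
    by (intro continuous_intros smooth_family_continuous smooth_family_bump)
  then show ?thesis by (simp add: bump_family_0)
qed

lemma bump_measurable [measurable]: "bump \<in> borel_measurable borel"
  by (rule borel_measurable_continuous_onI[OF bump_continuous])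

lemma bump_eq_0: "\<bar>x\<bar> \<ge> 1 \<Longrightarrow> bump x = 0"
  using bump_family_eq_0[of x 0] by (simp add: bump_family_0)

lemma bump_nonneg: "bump x \<ge> 0"
  by (simp add: bump_def flat_fun_def)

lemma bump_pos: "\<bar>x\<bar> < 1 \<Longrightarrow> bump x > 0"
  by (simp add: bump_def flat_fun_def abs_less_iff)

lemma bump_family_bounded: "\<exists>B\<ge>0. \<forall>x. cmod (bump_family n x) \<le> B"
proof -
  have "compact (bump_family n ` {-1..1})"
    by (intro compact_continuous_image smooth_family_continuous smooth_family_bump compact_Icc)
  then obtain B where B: "\<And>x. x \<in> {-1..1} \<Longrightarrow> cmod (bump_family n x) \<le> B"
    by (metis bounded_iff compact_imp_bounded imageI)
  have "cmod (bump_family n x) \<le> max B 0" for x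
  proof (cases "\<bar>x\<bar> \<le> 1")
    case True
    then show ?thesis using B[of x] by (auto simp: abs_le_iff intro: max.coboundedI1)
  next
    case False
    then show ?thesis by (simp add: bump_family_eq_0)
  qed
  then show ?thesis by (intro exI[of _ "max B 0"]) auto
qed

definition cutoff_family :: "nat \<Rightarrow> nat \<Rightarrow> real \<Rightarrow> complex" where
  "cutoff_family r n x = of_real (1 / real (Suc r)) ^ n * bump_family n (1 / real (Suc r) * x + 0)"

lemma cutoff_family_0: "cutoff_family r 0 x = of_real (bump (x / real (Suc r)))"
  by (simp add: cutoff_family_def bump_family_0 del: of_nat_Suc)

lemma smooth_family_cutoff: "smooth_family (cutoff_family r)"
  unfolding cutoff_family_def[abs_def] by (intro smooth_family_affine smooth_family_bump)

lemma cutoff_family_eq_0: "\<bar>x\<bar> \<ge> real (Suc r) \<Longrightarrow> cutoff_family r n x = 0"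
  by (simp add: cutoff_family_def bump_family_eq_0 field_simps del: of_nat_Suc)

lemma cutoff_family_le:
  assumes "\<And>x. cmod (bump_family n x) \<le> B"
  shows "cmod (cutoff_family r n x) \<le> (1 / real (Suc r)) ^ n * B"
  using mult_left_mono[OF assms[of "1 / real (Suc r) * x + 0"], of "(1 / real (Suc r)) ^ n"]
  by (simp add: cutoff_family_def norm_mult norm_power norm_divide del: of_nat_Suc)

lemma compactly_supportedI:
  assumes "\<And>x. \<bar>x\<bar> > R \<Longrightarrow> schwartz_fun \<phi> x = 0"
  shows "compactly_supported \<phi>"
proof -
  have "{x. schwartz_fun \<phi> x \<noteq> 0} \<subseteq> {-R..R}"
    using assms by (force simp: abs_le_iff[symmetric] not_le[symmetric])
  then have "bounded {x. schwartz_fun \<phi> x \<noteq> 0}"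
    by (rule bounded_subset[rotated]) simp
  then show ?thesis
    unfolding compactly_supported_def by (simp add: compact_eq_bounded_closed bounded_closure)
qed

text \<open>As \<open>bump\<close> is Lipschitz, the rescaled quotient \<open>bump (x / (r + 1)) / bump 0\<close> differs from one by at most a
  multiple of \<open>|x| / (r + 1)\<close>, so the bump needs no plateau around the origin. Each derivative brings a factor \<open>1 / (r + 1)\<close>.\<close>

lemma schwartz_cutoff_tendsto:
  defines "m \<equiv> \<lambda>r x. 1 - complex_of_real (bump (x / real (Suc r)) / bump 0)"
  shows "(\<lambda>r. schwartz_seminorm a b (schwartz_mult (m r) \<phi>)) \<longlonglongrightarrow> 0"
    and "schwartz_fun (schwartz_mult (m r) \<phi>) = (\<lambda>x. m r x * schwartz_fun \<phi> x)"
proof -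
  \<comment> \<open>the derivatives of one minus the normalized cutoff\<close>
  define F where "F r n x = (if n = 0 then 1 else 0) - (1 / of_real (bump 0)) * cutoff_family r n x" for r n x
  have b0: "bump 0 > 0" by (rule bump_pos) simp
  have sm: "smooth_family (F r)" for r
    unfolding smooth_family_def F_def
  proof safe
    fix n x
    have "((\<lambda>x. (if n = 0 then 1 else 0) - (1 / of_real (bump 0)) * cutoff_family r n x) has_vector_derivative
      0 - (1 / of_real (bump 0)) * cutoff_family r (Suc n) x) (at x)"
      using smooth_family_cutoff[of r]
      by (intro has_vector_derivative_diff has_vector_derivative_mult_right has_vector_derivative_const)
         (simp add: smooth_family_def)
    then show "((\<lambda>x. (if n = 0 then 1 else 0) - (1 / of_real (bump 0)) * cutoff_family r n x) has_vector_derivative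
      (if Suc n = 0 then 1 else 0) - (1 / of_real (bump 0)) * cutoff_family r (Suc n) x) (at x)"
      by simp
  qed
  obtain B where B0: "\<And>n. B n \<ge> 0" and B: "\<And>n x. cmod (bump_family n x) \<le> B n"
    using bump_family_bounded by metis
  define K where "K b = (\<Sum>k\<le>Suc b. B k) / bump 0" for b
  have BK: "B k / bump 0 \<le> K b" if "k \<le> Suc b" for k b
    unfolding K_def using that b0 B0 by (intro divide_right_mono member_le_sum) auto
  have K0: "K b \<ge> 0" for b
    unfolding K_def using b0 B0 by (intro divide_nonneg_pos sum_nonneg) auto
  have bound: "cmod (F r k x) \<le> (K b / real (Suc r)) * (1 + \<bar>x\<bar>)" if "k \<le> b" for r k b x
  proof (cases k)
    case 0
    have "cmod (bump_family 0 0 - bump_family 0 (x / real (Suc r))) \<le> B 1 * norm (0 - x / real (Suc r))"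
    proof (rule differentiable_bound[of UNIV _ "\<lambda>x h. h *\<^sub>R bump_family 1 x"])
      show "(bump_family 0 has_derivative (\<lambda>h. h *\<^sub>R bump_family 1 x)) (at x within UNIV)" for x
        using smooth_family_bump by (simp add: smooth_family_def has_vector_derivative_def)
      show "onorm (\<lambda>h. h *\<^sub>R bump_family 1 x) \<le> B 1" for x
        using B[of 1 x] by (intro onorm_le) (simp add: mult.commute[of "\<bar>_\<bar>"] mult_right_mono)
    qed auto
    then have *: "cmod (of_real (bump 0) - cutoff_family r 0 x) \<le> B 1 * (\<bar>x\<bar> / real (Suc r))"
      by (simp add: bump_family_0 cutoff_family_0 del: of_nat_Suc)
    have "F r k x = (of_real (bump 0) - cutoff_family r 0 x) / of_real (bump 0)"
      using b0 by (simp add: F_def 0 field_simps)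
    then have "cmod (F r k x) = cmod (of_real (bump 0) - cutoff_family r 0 x) / bump 0"
      using b0 by (simp add: norm_divide)
    also have "\<dots> \<le> B 1 * (\<bar>x\<bar> / real (Suc r)) / bump 0"
      using b0 by (intro divide_right_mono *) auto
    also have "\<dots> = (B 1 / bump 0) * (\<bar>x\<bar> / real (Suc r))" by simp
    also have "\<dots> \<le> K b * ((1 + \<bar>x\<bar>) / real (Suc r))"
      using B0[of 1] b0 BK[of 1 b] K0[of b] by (intro mult_mono divide_right_mono) auto
    finally show ?thesis by simp
  next
    case (Suc j)
    have "cmod (F r k x) = cmod (cutoff_family r k x) / bump 0"
      using b0 by (simp add: F_def Suc norm_mult norm_divide)
    also have "\<dots> \<le> (1 / real (Suc r)) ^ k * B k / bump 0"
      using b0 by (intro divide_right_mono cutoff_family_le B) auto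
    also have "\<dots> = (1 / real (Suc r)) ^ k * (B k / bump 0)" by simp
    also have "\<dots> \<le> (1 / real (Suc r)) * K b"
    proof (intro mult_mono BK)
      have "(1 / real (Suc r)) ^ j \<le> 1" by (intro power_le_one) auto
      then show "(1 / real (Suc r)) ^ k \<le> 1 / real (Suc r)"
        using mult_left_mono[of "(1 / real (Suc r)) ^ j" 1 "1 / real (Suc r)"] by (simp add: Suc del: of_nat_Suc)
    qed (use that b0 B0 in \<open>auto simp del: of_nat_Suc\<close>)
    also have "\<dots> \<le> (K b / real (Suc r)) * (1 + \<bar>x\<bar>)"
    proof -
      have "(K b / real (Suc r)) * 1 \<le> (K b / real (Suc r)) * (1 + \<bar>x\<bar>)"
        using K0[of b] by (intro mult_left_mono) auto
      then show ?thesis by simp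
    qed
    finally show ?thesis .
  qed
  have mod: "moderate_family (F r)" for r
    unfolding moderate_family_def using sm bound by blast
  have m: "m r = F r 0" for r
    by (simp add: fun_eq_iff m_def F_def cutoff_family_0 del: of_nat_Suc)
  show "schwartz_fun (schwartz_mult (m r) \<phi>) = (\<lambda>x. m r x * schwartz_fun \<phi> x)"
    unfolding m by (rule schwartz_fun_mult[OF mod])
  define S where "S = (\<Sum>k\<le>b. real (b choose k) * (schwartz_seminorm a (b - k) \<phi> + schwartz_seminorm (Suc a) (b - k) \<phi>))"
  have "schwartz_seminorm a b (schwartz_mult (m r) \<phi>) \<le> (K b / real (Suc r)) * S" for r
    unfolding m S_def by (rule schwartz_seminorm_mult_le[OF mod bound]) (use K0 in auto)
  then have "\<forall>\<^sub>F r in sequentially. norm (schwartz_seminorm a b (schwartz_mult (m r) \<phi>)) \<le> (K b / real (Suc r)) * S"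
    unfolding real_norm_def abs_of_nonneg[OF schwartz_seminorm_nonneg] by (intro always_eventually allI)
  moreover have "(\<lambda>r. (K b / real (Suc r)) * S) \<longlonglongrightarrow> 0"
    by real_asymp
  ultimately show "(\<lambda>r. schwartz_seminorm a b (schwartz_mult (m r) \<phi>)) \<longlonglongrightarrow> 0"
    by (rule Lim_null_comparison)
qed

section \<open>Waveforms as Fourier multipliers\<close>

lemma locally_integrable_measurable:
  assumes "locally_integrable g"
  shows "g \<in> borel_measurable borel"
proof (rule borel_measurable_LIMSEQ_metric)
  show "(\<lambda>x. indicator {- real n..real n} x *\<^sub>R g x) \<in> borel_measurable borel" for n
    using assms borel_measurable_integrable[of lborel "\<lambda>x. indicator {- real n..real n} x *\<^sub>R g x"]
    by (simp add: locally_integrable_def set_integrable_def)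
  show "(\<lambda>n. indicator {- real n..real n} x *\<^sub>R g x) \<longlonglongrightarrow> g x" for x
  proof (rule tendsto_eventually)
    obtain m where "\<bar>x\<bar> \<le> real m" using real_arch_simple by blast
    then show "\<forall>\<^sub>F n in sequentially. indicator {- real n..real n} x *\<^sub>R g x = g x"
      by (auto simp: eventually_sequentially indicator_def intro!: exI[of _ m])
  qed
qed

lemma tempered_apply_tendsto_0:
  assumes "\<And>a b. (\<lambda>r. schwartz_seminorm a b (\<psi> r)) \<longlonglongrightarrow> 0"
  shows "(\<lambda>r. tempered_apply T (\<psi> r)) \<longlonglongrightarrow> 0"
proof -
  obtain N where N: "\<And>\<psi>. cmod (tempered_apply T \<psi>) \<le> real N * schwartz_norm N \<psi>"
    using tempered_in_polar[of T] by (auto simp: tempered_polar_def)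
  have "(\<lambda>r. real N * schwartz_norm N (\<psi> r)) \<longlonglongrightarrow> real N * (\<Sum>a\<le>N. \<Sum>b\<le>N. 0)"
    unfolding schwartz_norm_def by (intro tendsto_intros assms)
  then have "(\<lambda>r. real N * schwartz_norm N (\<psi> r)) \<longlonglongrightarrow> 0" by simp
  then show ?thesis
    by (rule Lim_null_comparison[rotated]) (intro always_eventually allI N)
qed

lemma bump_tendsto: "(\<lambda>r. bump (x / real (Suc r))) \<longlonglongrightarrow> bump 0"
proof -
  have "(\<lambda>r. x / real (Suc r)) \<longlonglongrightarrow> 0" by real_asymp
  then show ?thesis by (intro continuous_on_tendsto_compose[OF bump_continuous]) auto
qed

lemma bump_bounded: "\<exists>B. \<forall>x. bump x \<le> B"
proof -
  obtain B where "\<And>x. cmod (bump_family 0 x) \<le> B" using bump_family_bounded by blast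
  then have "bump x \<le> B" for x using complex_Re_le_cmod[of "bump_family 0 x"] by (auto simp: bump_family_0 intro: order_trans)
  then show ?thesis by blast
qed

text \<open>By definition the identity holds for compactly supported test functions. It extends along cutoffs, by
  continuity of \<open>T\<close> on the left and by dominated convergence on the right.\<close>

lemma given_by_function_integral:
  assumes T: "given_by_function T g" and int: "\<And>\<psi>. integrable lborel (\<lambda>x. g x * schwartz_fun \<psi> x)"
  shows "tempered_apply T \<theta> = (LINT x|lborel. g x * schwartz_fun \<theta> x)"
proof -
  have [measurable]: "g \<in> borel_measurable borel"
    using T by (intro locally_integrable_measurable) (simp add: given_by_function_def)
  define c where "c r x = bump (x / real (Suc r)) / bump 0" for r x
  let ?s = "\<lambda>r x. g x * (of_real (c r x) * schwartz_fun \<theta> x)"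
  have b0: "bump 0 > 0" by (rule bump_pos) simp
  define \<theta>c where "\<theta>c r = schwartz_mult (\<lambda>x. 1 - complex_of_real (c r x)) \<theta>" for r
  have cut: "(\<lambda>r. schwartz_seminorm a b (\<theta>c r)) \<longlonglongrightarrow> 0" for a b
    unfolding \<theta>c_def c_def by (rule schwartz_cutoff_tendsto)
  have cut_fun: "schwartz_fun (\<theta>c r) = (\<lambda>x. (1 - of_real (c r x)) * schwartz_fun \<theta> x)" for r
    unfolding \<theta>c_def c_def by (rule schwartz_cutoff_tendsto)
  have fun_eq: "schwartz_fun (\<theta> - \<theta>c r) x = of_real (c r x) * schwartz_fun \<theta> x" for r x
  proof -
    have "schwartz_fun (\<theta> - \<theta>c r) x = schwartz_fun \<theta> x - schwartz_fun (\<theta>c r) x"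
      using nth_vderiv_diff[of 0 \<theta> "\<theta>c r" x] by simp
    then show ?thesis by (simp add: cut_fun left_diff_distrib)
  qed
  have "compactly_supported (\<theta> - \<theta>c r)" for r
    by (rule compactly_supportedI[of "real (Suc r)"])
       (simp add: fun_eq c_def bump_eq_0 field_simps del: of_nat_Suc)
  then have eq: "tempered_apply T (\<theta> - \<theta>c r) = (LINT x|lborel. ?s r x)" for r
    using T by (simp add: given_by_function_def fun_eq)
  have "(\<lambda>r. tempered_apply T \<theta> - tempered_apply T (\<theta>c r)) \<longlonglongrightarrow> tempered_apply T \<theta> - 0"
    by (intro tendsto_intros tempered_apply_tendsto_0 cut)
  then have lim1: "(\<lambda>r. LINT x|lborel. ?s r x) \<longlonglongrightarrow> tempered_apply T \<theta>"
    by (simp add: tempered_apply_diff[symmetric] eq)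
  obtain B where B: "\<And>x. bump x \<le> B" using bump_bounded by blast
  have c0: "0 \<le> c r x" and cB: "c r x \<le> B / bump 0" for r x
    using b0 B bump_nonneg by (auto simp: c_def divide_right_mono simp del: of_nat_Suc)
  have [measurable]: "c r \<in> borel_measurable borel" for r
    unfolding c_def[abs_def] by measurable
  have "(\<lambda>r. LINT x|lborel. ?s r x) \<longlonglongrightarrow> (LINT x|lborel. g x * schwartz_fun \<theta> x)"
  proof (rule integral_dominated_convergence[where w = "\<lambda>x. B / bump 0 * cmod (g x * schwartz_fun \<theta> x)"])
    show "AE x in lborel. (\<lambda>r. ?s r x) \<longlonglongrightarrow> g x * schwartz_fun \<theta> x"
    proof (rule AE_I2)
      fix x
      have "(\<lambda>r. c r x) \<longlonglongrightarrow> bump 0 / bump 0"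
        unfolding c_def using b0 by (intro tendsto_intros bump_tendsto) auto
      then have "(\<lambda>r. ?s r x) \<longlonglongrightarrow> g x * (of_real (bump 0 / bump 0) * schwartz_fun \<theta> x)"
        by (intro tendsto_intros)
      then show "(\<lambda>r. ?s r x) \<longlonglongrightarrow> g x * schwartz_fun \<theta> x"
        using b0 by simp
    qed
    show "AE x in lborel. norm (?s r x) \<le> B / bump 0 * cmod (g x * schwartz_fun \<theta> x)" for r
    proof (rule AE_I2)
      fix x
      have "norm (?s r x) = c r x * cmod (g x * schwartz_fun \<theta> x)"
        using c0 by (simp add: norm_mult)
      also have "\<dots> \<le> B / bump 0 * cmod (g x * schwartz_fun \<theta> x)"
        by (intro mult_right_mono cB) auto
      finally show "norm (?s r x) \<le> B / bump 0 * cmod (g x * schwartz_fun \<theta> x)" .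
    qed
    show "integrable lborel (\<lambda>x. B / bump 0 * cmod (g x * schwartz_fun \<theta> x))"
      using int by (intro integrable_mult_right integrable_norm)
  qed measurable
  from LIMSEQ_unique[OF lim1 this] show ?thesis .
qed

lemma cutoff_schwartz: "cutoff_family r 0 \<in> schwartz_functions"
proof (rule schwartz_functionsI[where F = "cutoff_family r"])
  fix a b
  obtain B where "B \<ge> 0" and B: "\<And>x. cmod (bump_family b x) \<le> B" using bump_family_bounded by blast
  let ?R = "real (Suc r)"
  have "\<bar>x\<bar> ^ a * cmod (cutoff_family r b x) \<le> ?R ^ a * ((1 / ?R) ^ b * B)" for x
  proof (cases "\<bar>x\<bar> \<le> ?R")
    case True
    then show ?thesis
      using \<open>B \<ge> 0\<close> by (intro mult_mono power_mono cutoff_family_le B) auto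
  next
    case False
    then have "cutoff_family r b x = 0" by (intro cutoff_family_eq_0) simp
    then show ?thesis using \<open>B \<ge> 0\<close> by simp
  qed
  then show "\<exists>C. \<forall>x. \<bar>x\<bar> ^ a * cmod (cutoff_family r b x) \<le> C" by blast
qed (use smooth_family_cutoff in \<open>auto simp: smooth_family_def\<close>)

text \<open>A bump multiplied by a character is a test function, and testing \<open>u\<close> with it gives the Fourier transform
  of the finite measure with density \<open>u\<close> times the bump. Uniqueness identifies these measures for \<open>u\<close> and \<open>v\<close>,
  on intervals that exhaust the line.\<close>

lemma AE_eq_if_equal_as_distributions:
  fixes u v :: "real \<Rightarrow> real"
  assumes u: "locally_integrable (\<lambda>x. of_real (u x))" "\<And>x. u x \<ge> 0"
    and v: "locally_integrable (\<lambda>x. of_real (v x))" "\<And>x. v x \<ge> 0"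
    and eq: "equal_as_distributions (\<lambda>x. of_real (u x)) (\<lambda>x. of_real (v x))"
  shows "AE x in lborel. u x = v x"
proof -
  let ?T = "\<lambda>r t. schwartz_mult (\<lambda>x. cis (t * x)) (Schwartz (cutoff_family r 0))"
  define w where "w r x = bump (x / real (Suc r))" for r x
  have w_meas [measurable]: "w r \<in> borel_measurable borel" for r
    unfolding w_def[abs_def] by measurable
  have w0: "w r x \<ge> 0" for r x by (simp add: w_def bump_nonneg)
  have meas: "f \<in> borel_measurable borel" if "locally_integrable (\<lambda>x. of_real (f x))" for f :: "real \<Rightarrow> real"
  proof -
    note [measurable] = locally_integrable_measurable[OF that]
    have "(\<lambda>x. Re (complex_of_real (f x))) \<in> borel_measurable borel" by measurable
    then show ?thesis by simp
  qed
  note [measurable] = meas[OF u(1)] meas[OF v(1)]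
  obtain B where B: "\<And>x. bump x \<le> B" using bump_bounded by blast
  have int: "integrable lborel (\<lambda>x. f x * w r x)" if f: "locally_integrable (\<lambda>x. of_real (f x))" "\<And>x. f x \<ge> 0" for f r
  proof -
    note [measurable] = meas[OF f(1)]
    let ?K = "{- real (Suc r)..real (Suc r)}"
    let ?n = "\<lambda>x. B * cmod (indicator ?K x *\<^sub>R complex_of_real (f x))"
    have "integrable lborel (\<lambda>x. indicator ?K x *\<^sub>R complex_of_real (f x))"
      using f(1) by (simp add: locally_integrable_def set_integrable_def)
    then have "integrable lborel ?n"
      by (intro integrable_mult_right integrable_norm)
    then show ?thesis
    proof (rule Bochner_Integration.integrable_bound)
      show "AE x in lborel. norm (f x * w r x) \<le> norm (?n x)"
      proof (rule AE_I2)
        fix x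
        show "norm (f x * w r x) \<le> norm (?n x)"
        proof (cases "x \<in> ?K")
          case True
          have "w r x \<le> \<bar>B\<bar>" using B[of "x / real (Suc r)"] by (simp add: w_def del: of_nat_Suc)
          then show ?thesis using True f(2)[of x] w0[of r x]
            by (simp add: abs_mult mult.commute[of "f x"] mult_right_mono)
        next
          case False
          then have "w r x = 0"
            by (auto simp: w_def field_simps abs_le_iff not_le simp del: of_nat_Suc intro!: bump_eq_0)
          then show ?thesis by simp
        qed
      qed
    qed measurable
  qed
  let ?D = "\<lambda>f r. density lborel (\<lambda>x. ennreal (f x * w r x))"
  have fin: "finite_measure (?D f r)" if f: "locally_integrable (\<lambda>x. of_real (f x))" "\<And>x. f x \<ge> 0" for f r
  proof (rule finite_measureI)
    note [measurable] = meas[OF f(1)]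
    have "emeasure (?D f r) (space (?D f r)) = (\<integral>\<^sup>+ x. ennreal (f x * w r x) \<partial>lborel)"
      by (subst emeasure_density) auto
    also have "\<dots> = ennreal (LBINT x. f x * w r x)"
      using f(2) w0 by (intro nn_integral_eq_integral int f) (auto intro!: AE_I2 mult_nonneg_nonneg)
    finally show "emeasure (?D f r) (space (?D f r)) \<noteq> \<infinity>" by simp
  qed
  have four: "(LINT x|?D f r. cis (t * x)) = (LINT x|lborel. of_real (f x) * schwartz_fun (?T r t) x)"
    if f: "locally_integrable (\<lambda>x. of_real (f x))" "\<And>x. f x \<ge> 0" for f r t
  proof -
    note [measurable] = meas[OF f(1)]
    have "schwartz_fun (?T r t) x = cis (t * x) * of_real (w r x)" for x
      using schwartz_fun_mult[OF moderate_family_cis, of t "Schwartz (cutoff_family r 0)"]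
      by (simp add: Schwartz_inverse[OF cutoff_schwartz] cutoff_family_0 w_def del: of_nat_Suc)
    then show ?thesis
      using f(2) w0 by (subst integral_density) (auto simp: scaleR_conv_of_real mult_ac)
  qed
  have comp: "compactly_supported (?T r t)" for t r
    by (rule compactly_supportedI[of "real (Suc r)"])
       (use schwartz_fun_mult[OF moderate_family_cis, of t "Schwartz (cutoff_family r 0)"] in
         \<open>simp add: Schwartz_inverse[OF cutoff_schwartz] cutoff_family_eq_0 del: of_nat_Suc\<close>)
  have "?D u r = ?D v r" for r
  proof (rule finite_measure_eqI_fourier)
    show "(LINT x|?D u r. cis (t * x)) = (LINT x|?D v r. cis (t * x))" for t
      using eq comp[of t r] unfolding four[OF u] four[OF v] equal_as_distributions_def by blast
  qed (simp_all add: fin u v)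
  then have "AE x in lborel. ennreal (u x * w r x) = ennreal (v x * w r x)" for r
    by (intro sigma_finite_measure.density_unique[OF sigma_finite_lborel]) auto
  then have "AE x in lborel. \<forall>r. ennreal (u x * w r x) = ennreal (v x * w r x)"
    by (simp add: AE_all_countable)
  then show ?thesis
  proof eventually_elim
    case (elim x)
    obtain r where "\<bar>x\<bar> < real r" using reals_Archimedean2 by blast
    then have "\<bar>x / real (Suc r)\<bar> < 1" by simp
    then have "w r x > 0" unfolding w_def by (rule bump_pos)
    have "ennreal (u x * w r x) = ennreal (v x * w r x)" using elim by blast
    then have "u x * w r x = v x * w r x"
      using u(2)[of x] v(2)[of x] w0[of r x] by (subst (asm) ennreal_inj) auto
    with \<open>w r x > 0\<close> show ?case by simp
  qed
qed

text \<open>Every Schwartz function is a Fourier transform, so admissibility says that \<open>\<epsilon>\<close> hat times any Schwartz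
  function is square integrable. Used for \<open>(1 + x\<^sup>2) \<psi>\<close>, it also gives integrability against \<open>\<psi>\<close>, the factor
  \<open>1 / (1 + x\<^sup>2)\<close> being square integrable.\<close>

lemma admissible_fourier_function:
  assumes "admissible \<epsilon>"
  shows "given_by_function (tempered_fourier \<epsilon>) (fourier_function \<epsilon>)"
    and "locally_integrable (fourier_function \<epsilon>)"
    and "integrable lborel (\<lambda>x. (cmod (fourier_function \<epsilon> x * schwartz_fun \<psi> x))\<^sup>2)"
    and "integrable lborel (\<lambda>x. fourier_function \<epsilon> x * schwartz_fun \<psi> x)"
proof -
  let ?g = "fourier_function \<epsilon>"
  show g: "given_by_function (tempered_fourier \<epsilon>) ?g"
    using assms unfolding admissible_def fourier_function_def by (metis someI_ex)
  then show l: "locally_integrable ?g" by (simp add: given_by_function_def)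
  note [measurable] = locally_integrable_measurable[OF l]
  have sq: "integrable lborel (\<lambda>x. (cmod (?g x * schwartz_fun \<psi> x))\<^sup>2)" for \<psi>
  proof -
    obtain \<phi> where \<phi>: "schwartz_fourier \<phi> = \<psi>" using schwartz_fourier_surj by blast
    show ?thesis
      using assms unfolding admissible_def by (simp add: norm_mult power_mult_distrib \<phi>[symmetric])
  qed
  then show "integrable lborel (\<lambda>x. (cmod (?g x * schwartz_fun \<psi> x))\<^sup>2)" .
  \<comment> \<open>the Schwartz function \<open>(1 + x\<^sup>2) \<psi>\<close>\<close>
  define q where "q = \<psi> + schwartz_times (schwartz_times \<psi>)"
  have q: "schwartz_fun q x = of_real (1 + x\<^sup>2) * schwartz_fun \<psi> x" for x
    by (simp add: q_def plus_schwartz.rep_eq schwartz_times.rep_eq algebra_simps power2_eq_square)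
  have "integrable lborel (\<lambda>x. ((cmod (?g x * schwartz_fun q x))\<^sup>2 + inverse (1 + x\<^sup>2)) / 2)"
    by (intro integrable_divide Bochner_Integration.integrable_add sq integrable_inverse_one_plus_square)
  then show "integrable lborel (\<lambda>x. ?g x * schwartz_fun \<psi> x)"
  proof (rule Bochner_Integration.integrable_bound)
    show "AE x in lborel. norm (?g x * schwartz_fun \<psi> x) \<le> norm (((cmod (?g x * schwartz_fun q x))\<^sup>2 + inverse (1 + x\<^sup>2)) / 2)"
    proof (rule AE_I2)
      fix x :: real
      have pos: "1 + x\<^sup>2 > 0" "1 + x\<^sup>2 \<ge> 1" by (auto simp: add_pos_nonneg)
      have "cmod (?g x * schwartz_fun q x) = (1 + x\<^sup>2) * cmod (?g x * schwartz_fun \<psi> x)"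
        using pos unfolding q by (simp add: norm_mult del: of_real_add of_real_power)
      then have "norm (?g x * schwartz_fun \<psi> x) = cmod (?g x * schwartz_fun q x) * inverse (1 + x\<^sup>2)"
      proof -
        have "b = (y * b) * inverse y" if "y > 0" for y b :: real using that by simp
        from this[OF pos(1), of "cmod (?g x * schwartz_fun \<psi> x)"] show ?thesis
          by (simp only: \<open>cmod (?g x * schwartz_fun q x) = _\<close>)
      qed
      also have "\<dots> \<le> (1 * (cmod (?g x * schwartz_fun q x))\<^sup>2 + (inverse (1 + x\<^sup>2))\<^sup>2 / 1) / 2"
        by (rule mult_le_weighted_squares) simp
      also have "\<dots> \<le> ((cmod (?g x * schwartz_fun q x))\<^sup>2 + inverse (1 + x\<^sup>2)) / 2"
      proof -
        have "0 \<le> i \<and> i \<le> 1 \<Longrightarrow> i\<^sup>2 \<le> i" for i :: real by (simp add: power2_eq_square mult_left_le)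
        moreover have "0 \<le> inverse (1 + x\<^sup>2) \<and> inverse (1 + x\<^sup>2) \<le> 1"
          using pos by (simp add: inverse_le_1_iff)
        ultimately have "(inverse (1 + x\<^sup>2))\<^sup>2 \<le> inverse (1 + x\<^sup>2)" by blast
        then show ?thesis by simp
      qed
      finally show "norm (?g x * schwartz_fun \<psi> x) \<le> norm (((cmod (?g x * schwartz_fun q x))\<^sup>2 + inverse (1 + x\<^sup>2)) / 2)"
        by simp
    qed
  qed measurable
qed

text \<open>The convolution at \<open>x\<close> tests \<open>\<epsilon>\<close> on a translate of the Fourier transform of \<open>\<psi>\<close>, that is, on the
  Fourier transform of \<open>\<psi>\<close> times a character.\<close>

lemma tempered_convolution_reflect_fourier:
  assumes "admissible \<epsilon>"
  shows "tempered_convolution (tempered_reflect \<epsilon>) (schwartz_fourier \<psi>)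
    = fourier_integral (\<lambda>x. fourier_function \<epsilon> x * schwartz_fun \<psi> x)"
proof
  fix x
  let ?e = "\<lambda>z. cis (- (2 * pi * x) * z)"
  let ?m = "schwartz_mult ?e \<psi>"
  have mult: "schwartz_fun ?m z = ?e z * schwartz_fun \<psi> z" for z
    using schwartz_fun_mult[OF moderate_family_cis, of "- (2 * pi * x)" \<psi>] by simp
  have "schwartz_reflect (schwartz_reflect_at x (schwartz_fourier \<psi>)) = schwartz_fourier ?m"
  proof -
    have "schwartz_fun (schwartz_reflect (schwartz_reflect_at x (schwartz_fourier \<psi>))) y
      = schwartz_fun (schwartz_fourier ?m) y" for y
    proof -
      have "cis (- (2 * pi * z * (x + y))) = cis (- (2 * pi * z * y)) * ?e z" for z
        unfolding cis_mult by (simp add: algebra_simps)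
      then have e: "cis (- (2 * pi * z * (x + y))) * schwartz_fun \<psi> z
          = cis (- (2 * pi * z * y)) * schwartz_fun ?m z" for z
        unfolding mult by (simp only: mult.assoc)
      have "schwartz_fun (schwartz_reflect (schwartz_reflect_at x (schwartz_fourier \<psi>))) y
          = fourier_integral (schwartz_fun \<psi>) (x + y)"
        by (simp add: schwartz_reflect_at.rep_eq schwartz_fourier.rep_eq)
      also have "\<dots> = schwartz_fun (schwartz_fourier ?m) y"
        unfolding fourier_integral_def schwartz_fourier.rep_eq e ..
      finally show ?thesis .
    qed
    then show ?thesis by (simp add: schwartz_fun_inject[symmetric] fun_eq_iff)
  qed
  then have "tempered_convolution (tempered_reflect \<epsilon>) (schwartz_fourier \<psi>) x
    = tempered_apply (tempered_fourier \<epsilon>) ?m"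
    by (simp add: tempered_convolution_def tempered_reflect.rep_eq tempered_fourier.rep_eq)
  also have "\<dots> = (LINT z|lborel. fourier_function \<epsilon> z * schwartz_fun ?m z)"
    by (intro given_by_function_integral admissible_fourier_function assms)
  also have "\<dots> = fourier_integral (\<lambda>x. fourier_function \<epsilon> x * schwartz_fun \<psi> x) x"
    unfolding fourier_integral_def mult by (intro Bochner_Integration.integral_cong) (auto simp: mult_ac)
  finally show "tempered_convolution (tempered_reflect \<epsilon>) (schwartz_fourier \<psi>) x
    = fourier_integral (\<lambda>x. fourier_function \<epsilon> x * schwartz_fun \<psi> x) x" .
qed

lemma tempered_convolution_square_integrable:
  assumes "admissible \<epsilon>"
  shows "tempered_convolution (tempered_reflect \<epsilon>) \<phi> \<in> square_integrable"
proof -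
  obtain \<psi> where \<psi>: "schwartz_fourier \<psi> = \<phi>" using schwartz_fourier_surj by blast
  have [measurable]: "fourier_function \<epsilon> \<in> borel_measurable borel"
    by (intro locally_integrable_measurable admissible_fourier_function assms)
  have "fourier_integral (\<lambda>x. fourier_function \<epsilon> x * schwartz_fun \<psi> x) \<in> borel_measurable borel"
    by measurable
  then show ?thesis
    unfolding \<psi>[symmetric] tempered_convolution_reflect_fourier[OF assms] square_integrable_def
    using fourier_plancherel(1)[OF admissible_fourier_function(4)[OF assms] admissible_fourier_function(3)[OF assms]] by blast
qed

text \<open>By the Plancherel theorem both sides are integrals of the squared moduli of the transforms, weighted by
  the same \<open>|\<psi>|\<^sup>2\<close>.\<close>

lemma tempered_convolution_norm_eq:
  assumes adm: "admissible \<epsilon>1" "admissible \<epsilon>2"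
    and eq: "equal_as_distributions (\<lambda>x. cmod (fourier_function \<epsilon>1 x)) (\<lambda>x. cmod (fourier_function \<epsilon>2 x))"
  shows "(LBINT x. (cmod (tempered_convolution (tempered_reflect \<epsilon>1) \<phi> x))\<^sup>2)
    = (LBINT x. (cmod (tempered_convolution (tempered_reflect \<epsilon>2) \<phi> x))\<^sup>2)"
proof -
  obtain \<psi> where \<psi>: "schwartz_fourier \<psi> = \<phi>" using schwartz_fourier_surj by blast
  have [measurable]: "fourier_function \<epsilon>1 \<in> borel_measurable borel" "fourier_function \<epsilon>2 \<in> borel_measurable borel"
    by (intro locally_integrable_measurable admissible_fourier_function adm)+
  have loc: "locally_integrable (\<lambda>x. of_real (cmod (g x)))" if "locally_integrable g" for g
    unfolding locally_integrable_def set_integrable_def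
  proof safe
    fix K :: "real set" assume "compact K"
    then have "integrable lborel (\<lambda>x. indicator K x *\<^sub>R g x)"
      using that by (simp add: locally_integrable_def set_integrable_def)
    then have "integrable lborel (\<lambda>x. complex_of_real (cmod (indicator K x *\<^sub>R g x)))"
      by (intro integrable_of_real integrable_norm)
    then show "integrable lborel (\<lambda>x. indicator K x *\<^sub>R complex_of_real (cmod (g x)))"
    proof -
      have "complex_of_real (cmod (indicator K x *\<^sub>R g x)) = indicator K x *\<^sub>R complex_of_real (cmod (g x))" for x
        by (simp add: indicator_def)
      then show ?thesis using \<open>integrable lborel (\<lambda>x. complex_of_real (cmod (indicator K x *\<^sub>R g x)))\<close>
        by (simp only:)
    qed
  qed
  have "AE x in lborel. cmod (fourier_function \<epsilon>1 x) = cmod (fourier_function \<epsilon>2 x)"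
    by (intro AE_eq_if_equal_as_distributions loc admissible_fourier_function adm eq) auto
  then have "(LBINT x. (cmod (fourier_function \<epsilon>1 x * schwartz_fun \<psi> x))\<^sup>2)
      = (LBINT x. (cmod (fourier_function \<epsilon>2 x * schwartz_fun \<psi> x))\<^sup>2)"
    by (intro integral_cong_AE) (auto simp: norm_mult)
  then show ?thesis
    unfolding \<psi>[symmetric] tempered_convolution_reflect_fourier[OF adm(1)] tempered_convolution_reflect_fourier[OF adm(2)]
    by (simp only: fourier_plancherel(2)[OF admissible_fourier_function(4)[OF adm(1)] admissible_fourier_function(3)[OF adm(1)]]
        fourier_plancherel(2)[OF admissible_fourier_function(4)[OF adm(2)] admissible_fourier_function(3)[OF adm(2)]])
qed

section \<open>Conditional laws\<close>

context prob_space
begin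

lemma centered_normal_moments:
  assumes \<sigma>: "0 < \<sigma>" and U: "distributed M lborel U (normal_density 0 \<sigma>)"
  shows "integrable M U" "integrable M (\<lambda>\<omega>. (U \<omega>)\<^sup>2)" "expectation U = 0" "expectation (\<lambda>\<omega>. (U \<omega>)\<^sup>2) = \<sigma>\<^sup>2"
    "(LINT \<omega>|M. cis (t * U \<omega>)) = of_real (exp (- (\<sigma> * t)\<^sup>2 / 2))"
proof -
  have [measurable]: "U \<in> borel_measurable M" using distributed_measurable[OF U] by simp
  show "integrable M U"
    using distributed_integrable[OF U, of "\<lambda>x. x"] integrable_normal_moment[OF \<sigma>, of 0 1] by simp
  show "integrable M (\<lambda>\<omega>. (U \<omega>)\<^sup>2)"
    using distributed_integrable[OF U, of "\<lambda>x. x\<^sup>2"] integrable_normal_moment[OF \<sigma>, of 0 2] by simp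
  show "expectation U = 0" by (rule normal_distributed_expectation[OF \<sigma> U])
  then show "expectation (\<lambda>\<omega>. (U \<omega>)\<^sup>2) = \<sigma>\<^sup>2"
    using normal_distributed_variance[OF \<sigma> U] by simp
  have "(LINT \<omega>|M. cis (t * U \<omega>)) = (LINT x|distr M lborel U. cis (t * x))"
    by (subst integral_distr) auto
  also have "\<dots> = (LINT x|lborel. normal_density 0 \<sigma> x *\<^sub>R cis (t * x))"
    unfolding distributed_distr_eq_density[OF U] by (subst integral_density) auto
  also have "\<dots> = (LINT x|lborel. cis (t * x) * normal_density 0 \<sigma> x)"
    by (simp add: scaleR_conv_of_real mult.commute)
  also have "\<dots> = of_real (exp (- (\<sigma> * t)\<^sup>2 / 2))" by (rule fourier_normal_density[OF \<sigma>])
  finally show "(LINT \<omega>|M. cis (t * U \<omega>)) = of_real (exp (- (\<sigma> * t)\<^sup>2 / 2))" .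
qed

lemma circular_normal_moments:
  assumes \<sigma>: "0 < \<sigma>" and Re: "distributed M lborel (\<lambda>\<omega>. Re (Y \<omega>)) (normal_density 0 \<sigma>)"
    and Im: "distributed M lborel (\<lambda>\<omega>. Im (Y \<omega>)) (normal_density 0 \<sigma>)"
    and ind: "indep_var borel (\<lambda>\<omega>. Re (Y \<omega>)) borel (\<lambda>\<omega>. Im (Y \<omega>))"
  shows "integrable M Y" "expectation Y = 0"
    "integrable M (\<lambda>\<omega>. Y \<omega> * cnj (Y \<omega>))" "(LINT \<omega>|M. Y \<omega> * cnj (Y \<omega>)) = of_real (2 * \<sigma>\<^sup>2)"
    "(LINT \<omega>|M. cis (t * Re (c * Y \<omega>))) = of_real (exp (- t\<^sup>2 * ((cmod c)\<^sup>2 * (2 * \<sigma>\<^sup>2)) / 4))"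
proof -
  note R = centered_normal_moments[OF \<sigma> Re] and I = centered_normal_moments[OF \<sigma> Im]
  have Y: "Y = (\<lambda>\<omega>. of_real (Re (Y \<omega>)) + \<i> * of_real (Im (Y \<omega>)))"
    by (simp add: fun_eq_iff complex_eq[symmetric])
  show "integrable M Y"
    by (subst Y) (intro Bochner_Integration.integrable_add integrable_mult_right integrable_of_real R I)
  show "expectation Y = 0"
    by (subst Y, subst Bochner_Integration.integral_add)
       (simp_all add: R(1,3) I(1,3) integrable_of_real)
  have sq: "Y \<omega> * cnj (Y \<omega>) = of_real ((Re (Y \<omega>))\<^sup>2 + (Im (Y \<omega>))\<^sup>2)" for \<omega>
    by (simp add: complex_mult_cnj)
  have i: "integrable M (\<lambda>\<omega>. (Re (Y \<omega>))\<^sup>2 + (Im (Y \<omega>))\<^sup>2)"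
    by (intro Bochner_Integration.integrable_add R I)
  show "integrable M (\<lambda>\<omega>. Y \<omega> * cnj (Y \<omega>))"
    unfolding sq by (intro integrable_of_real i)
  show "(LINT \<omega>|M. Y \<omega> * cnj (Y \<omega>)) = of_real (2 * \<sigma>\<^sup>2)"
    unfolding sq integral_complex_of_real using R I by simp
  have [measurable]: "(\<lambda>\<omega>. Re (Y \<omega>)) \<in> borel_measurable M" "(\<lambda>\<omega>. Im (Y \<omega>)) \<in> borel_measurable M"
    using distributed_measurable[OF Re] distributed_measurable[OF Im] by simp_all
  have "(LINT \<omega>|M. cis (t * Re (c * Y \<omega>))) = (LINT \<omega>|M. cis ((t * Re c) * Re (Y \<omega>)) * cis ((- t * Im c) * Im (Y \<omega>)))"
    unfolding cis_mult by (simp add: algebra_simps)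
  also have "\<dots> = (LINT \<omega>|M. cis ((t * Re c) * Re (Y \<omega>))) * (LINT \<omega>|M. cis ((- t * Im c) * Im (Y \<omega>)))"
  proof (rule indep_var_lebesgue_integral)
    show "indep_var borel (\<lambda>\<omega>. cis ((t * Re c) * Re (Y \<omega>))) borel (\<lambda>\<omega>. cis ((- t * Im c) * Im (Y \<omega>)))"
      using indep_var_compose[OF ind, of "\<lambda>x. cis ((t * Re c) * x)" borel "\<lambda>x. cis ((- t * Im c) * x)" borel]
      by (simp add: o_def)
  qed (auto intro!: integrable_const_bound[of _ 1])
  also have "\<dots> = of_real (exp (- (\<sigma> * (t * Re c))\<^sup>2 / 2) * exp (- (\<sigma> * (- t * Im c))\<^sup>2 / 2))"
    unfolding R(5) I(5) by simp
  also have "exp (- (\<sigma> * (t * Re c))\<^sup>2 / 2) * exp (- (\<sigma> * (- t * Im c))\<^sup>2 / 2) = exp (- t\<^sup>2 * ((cmod c)\<^sup>2 * (2 * \<sigma>\<^sup>2)) / 4)"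
    unfolding exp_add[symmetric] cmod_power2 by (simp add: power_mult_distrib algebra_simps add_divide_distrib[symmetric])
  finally show "(LINT \<omega>|M. cis (t * Re (c * Y \<omega>))) = of_real (exp (- t\<^sup>2 * ((cmod c)\<^sup>2 * (2 * \<sigma>\<^sup>2)) / 4))" .
qed

text \<open>Independence makes the exponents of the characteristic functions add up. The second moment adds up in the
  same way, since the mixed moments of independent centered variables vanish.\<close>

lemma circular_combination_characteristic:
  assumes Y: "circular_gaussian_vector M n Y"
  shows "(LINT \<omega>|M. cis (t * Re (\<Sum>k<n. a k * Y k \<omega>)))
    = of_real (exp (- t\<^sup>2 * Re (LINT \<omega>|M. (\<Sum>k<n. a k * Y k \<omega>) * cnj (\<Sum>k<n. a k * Y k \<omega>)) / 4))"
proof -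
  let ?S = "\<lambda>\<omega>. \<Sum>k<n. a k * Y k \<omega>"
  have ind: "indep_vars (\<lambda>_. borel) Y {..<n}"
    using Y by (simp add: circular_gaussian_vector_def)
  obtain \<sigma> where \<sigma>: "\<And>k. k < n \<Longrightarrow> 0 < \<sigma> k \<and> distributed M lborel (\<lambda>\<omega>. Re (Y k \<omega>)) (normal_density 0 (\<sigma> k))
      \<and> distributed M lborel (\<lambda>\<omega>. Im (Y k \<omega>)) (normal_density 0 (\<sigma> k))"
    using Y unfolding circular_gaussian_vector_def by metis
  have ri: "indep_var borel (\<lambda>\<omega>. Re (Y k \<omega>)) borel (\<lambda>\<omega>. Im (Y k \<omega>))" if "k < n" for k
    using Y that by (simp add: circular_gaussian_vector_def)
  note mom = circular_normal_moments[OF \<sigma>[THEN conjunct1] \<sigma>[THEN conjunct2, THEN conjunct1] \<sigma>[THEN conjunct2, THEN conjunct2] ri]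
  have [measurable]: "Y k \<in> borel_measurable M" if "k < n" for k
    using ind that by (auto simp: indep_vars_def)
  have cross: "integrable M (\<lambda>\<omega>. Y j \<omega> * cnj (Y k \<omega>))" "(LINT \<omega>|M. Y j \<omega> * cnj (Y k \<omega>)) = 0"
    if "j < n" "k < n" "j \<noteq> k" for j k
  proof -
    \<comment> \<open>conjugates the second factor only, so that the mixed moment is a product over two indices\<close>
    let ?f = "\<lambda>i z. if i = j then z else cnj z"
    have "indep_vars (\<lambda>_. borel) (\<lambda>i \<omega>. ?f i (Y i \<omega>)) {j, k}"
      using that cnj_measurable by (intro indep_vars_compose2[OF indep_vars_subset[OF ind]]) auto
    moreover have int: "integrable M (\<lambda>\<omega>. ?f i (Y i \<omega>))" if "i \<in> {j, k}" for i
      using that \<open>j < n\<close> \<open>k < n\<close> mom(1) by (cases "i = j") auto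
    ultimately have "integrable M (\<lambda>\<omega>. \<Prod>i\<in>{j, k}. ?f i (Y i \<omega>))"
      "(LINT \<omega>|M. (\<Prod>i\<in>{j, k}. ?f i (Y i \<omega>))) = (\<Prod>i\<in>{j, k}. (LINT \<omega>|M. ?f i (Y i \<omega>)))"
      by (intro indep_vars_integrable indep_vars_lebesgue_integral; simp)+
    then show "integrable M (\<lambda>\<omega>. Y j \<omega> * cnj (Y k \<omega>))" "(LINT \<omega>|M. Y j \<omega> * cnj (Y k \<omega>)) = 0"
      using that mom(2)[OF \<open>j < n\<close>] by auto
  qed
  define V where "V = (\<Sum>k<n. (cmod (a k))\<^sup>2 * (2 * (\<sigma> k)\<^sup>2))"
  have "(LINT \<omega>|M. (?S \<omega>) * cnj (?S \<omega>)) = of_real V"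
  proof -
    have int: "integrable M (\<lambda>\<omega>. Y j \<omega> * cnj (Y k \<omega>))" if "j < n" "k < n" for j k
      using cross(1)[OF that] mom(3) that by (cases "j = k") auto
    have "(?S \<omega>) * cnj (?S \<omega>) = (\<Sum>j<n. \<Sum>k<n. (a j * cnj (a k)) * (Y j \<omega> * cnj (Y k \<omega>)))" for \<omega>
      by (simp add: sum_product mult_ac)
    then have "(LINT \<omega>|M. (?S \<omega>) * cnj (?S \<omega>))
        = (LINT \<omega>|M. (\<Sum>j<n. \<Sum>k<n. (a j * cnj (a k)) * (Y j \<omega> * cnj (Y k \<omega>))))"
      by simp
    also have "\<dots> = (\<Sum>j<n. \<Sum>k<n. (a j * cnj (a k)) * (LINT \<omega>|M. Y j \<omega> * cnj (Y k \<omega>)))"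
    proof -
      have int': "integrable M (\<lambda>\<omega>. (a j * cnj (a k)) * (Y j \<omega> * cnj (Y k \<omega>)))" if "j < n" "k < n" for j k
        by (intro integrable_mult_right int that)
      have "(LINT \<omega>|M. (\<Sum>k<n. (a j * cnj (a k)) * (Y j \<omega> * cnj (Y k \<omega>))))
          = (\<Sum>k<n. (a j * cnj (a k)) * (LINT \<omega>|M. Y j \<omega> * cnj (Y k \<omega>)))" if "j < n" for j
        using int'[OF that] by (subst Bochner_Integration.integral_sum) auto
      then show ?thesis
        using int' by (subst Bochner_Integration.integral_sum) (auto intro!: Bochner_Integration.integrable_sum)
    qed
    also have "\<dots> = (\<Sum>j<n. \<Sum>k<n. if k = j then of_real ((cmod (a j))\<^sup>2 * (2 * (\<sigma> j)\<^sup>2)) else 0)"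
      using cross(2) mom(4) by (intro sum.cong refl) (auto simp flip: complex_norm_square)
    also have "\<dots> = of_real V" by (simp add: V_def)
    finally show ?thesis .
  qed
  moreover have "(LINT \<omega>|M. cis (t * Re (?S \<omega>))) = of_real (exp (- t\<^sup>2 * V / 4))"
  proof -
    have "cis (t * Re (\<Sum>k<m. a k * Y k \<omega>)) = (\<Prod>k<m. cis (t * Re (a k * Y k \<omega>)))" for m \<omega>
      by (induction m) (simp_all add: cis_mult[symmetric] distrib_left del: cis_mult times_complex.sel)
    then have "(LINT \<omega>|M. cis (t * Re (?S \<omega>))) = (LINT \<omega>|M. (\<Prod>k<n. cis (t * Re (a k * Y k \<omega>))))"
      by simp
    also have "\<dots> = (\<Prod>k<n. (LINT \<omega>|M. cis (t * Re (a k * Y k \<omega>))))"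
    proof (rule indep_vars_lebesgue_integral)
      show "indep_vars (\<lambda>_. borel) (\<lambda>k \<omega>. cis (t * Re (a k * Y k \<omega>))) {..<n}"
        by (rule indep_vars_compose2[OF ind]) measurable
      show "integrable M (\<lambda>\<omega>. cis (t * Re (a k * Y k \<omega>)))" if "k \<in> {..<n}" for k
      proof -
        have [measurable]: "Y k \<in> borel_measurable M" using that by simp
        show ?thesis by (intro integrable_const_bound[of _ 1]) auto
      qed
    qed simp
    also have "\<dots> = (\<Prod>k<n. of_real (exp (- t\<^sup>2 * ((cmod (a k))\<^sup>2 * (2 * (\<sigma> k)\<^sup>2)) / 4)))"
      by (intro prod.cong refl mom(5)) auto
    also have "\<dots> = of_real (exp (\<Sum>k<n. - t\<^sup>2 * ((cmod (a k))\<^sup>2 * (2 * (\<sigma> k)\<^sup>2)) / 4))"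
      by (simp only: of_real_prod exp_sum[OF finite_lessThan])
    also have "(\<Sum>k<n. - t\<^sup>2 * ((cmod (a k))\<^sup>2 * (2 * (\<sigma> k)\<^sup>2)) / 4) = - t\<^sup>2 * V / 4"
      by (simp only: V_def sum_divide_distrib sum_distrib_left)
    finally show ?thesis .
  qed
  ultimately show ?thesis by simp
qed

lemma centered_complex_gaussian_characteristic:
  assumes X: "centered_complex_gaussian M I X" "i \<in> I"
  shows "(LINT \<omega>|M. cis (t * Re (X i \<omega>))) = of_real (exp (- t\<^sup>2 * Re (LINT \<omega>|M. X i \<omega> * cnj (X i \<omega>)) / 4))"
proof -
  have "\<exists>n (A :: _ \<Rightarrow> nat \<Rightarrow> complex) Y. circular_gaussian_vector M n Y \<and>
      (\<forall>j\<in>{i}. AE \<omega> in M. X j \<omega> = (\<Sum>k<n. A j k * Y k \<omega>))"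
    using X(1)[unfolded centered_complex_gaussian_def, THEN conjunct2, rule_format, of "{i}"] X(2) by simp
  then obtain n A Y where Y: "circular_gaussian_vector M n Y" and AE1: "\<forall>j\<in>{i}. AE \<omega> in M. X j \<omega> = (\<Sum>k<n. A j k * Y k \<omega>)"
    by (elim exE conjE)
  from AE1 have AE: "AE \<omega> in M. X i \<omega> = (\<Sum>k<n. A i k * Y k \<omega>)" by simp
  have [measurable]: "X i \<in> borel_measurable M"
    using X by (simp add: centered_complex_gaussian_def)
  have [measurable]: "Y k \<in> borel_measurable M" if "k \<in> {..<n}" for k
    using Y that by (auto simp: circular_gaussian_vector_def indep_vars_def)
  let ?S = "\<lambda>\<omega>. \<Sum>k<n. A i k * Y k \<omega>"
  have S [measurable]: "?S \<in> borel_measurable M" by measurable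
  have "(LINT \<omega>|M. cis (t * Re (X i \<omega>))) = (LINT \<omega>|M. cis (t * Re (?S \<omega>)))"
    by (rule integral_cong_AE) (use AE in \<open>measurable, auto\<close>)
  moreover have "(LINT \<omega>|M. X i \<omega> * cnj (X i \<omega>)) = (LINT \<omega>|M. ?S \<omega> * cnj (?S \<omega>))"
    by (rule integral_cong_AE) (use AE in \<open>measurable, auto\<close>)
  ultimately show ?thesis
    using circular_combination_characteristic[OF Y, of t "A i"] by simp
qed

lemma centered_complex_gaussian_Re_distr_eq:
  assumes X: "centered_complex_gaussian M I X" and ij: "i \<in> I" "j \<in> I"
    and eq: "(LINT \<omega>|M. X i \<omega> * cnj (X i \<omega>)) = (LINT \<omega>|M. X j \<omega> * cnj (X j \<omega>))"
  shows "distr M borel (\<lambda>\<omega>. Re (X i \<omega>)) = distr M borel (\<lambda>\<omega>. Re (X j \<omega>))"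
proof (rule finite_measure_eqI_fourier)
  have [measurable]: "X i \<in> borel_measurable M" "X j \<in> borel_measurable M"
    using X ij by (auto simp: centered_complex_gaussian_def)
  show "finite_measure (distr M borel (\<lambda>\<omega>. Re (X i \<omega>)))" "finite_measure (distr M borel (\<lambda>\<omega>. Re (X j \<omega>)))"
    by (intro finite_measure_distr; measurable)+
  show "(LINT x|distr M borel (\<lambda>\<omega>. Re (X i \<omega>)). cis (t * x)) = (LINT x|distr M borel (\<lambda>\<omega>. Re (X j \<omega>)). cis (t * x))" for t
    by (simp add: integral_distr centered_complex_gaussian_characteristic[OF X] ij eq)
qed simp_all

end

text \<open>Given \<open>s = v\<close>, the second moments of \<open>\<mu> f\<close> and \<open>\<mu> g\<close> are both \<open>v\<close> times the common squared norm, and the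
  second moment determines the law of the real part.\<close>

lemma ito_measure_given_Re_law_eq:
  assumes P: "prob_space P" and given: "ito_measure_given P s \<mu>"
    and fg: "f \<in> square_integrable" "g \<in> square_integrable"
    and norm: "(LBINT x. (cmod (f x))\<^sup>2) = (LBINT x. (cmod (g x))\<^sup>2)"
    and sets: "B \<in> sets borel" "C \<in> sets borel"
  shows "emeasure P {\<omega> \<in> space P. s \<omega> \<in> B \<and> Re (\<mu> f \<omega>) \<in> C} = emeasure P {\<omega> \<in> space P. s \<omega> \<in> B \<and> Re (\<mu> g \<omega>) \<in> C}"
proof -
  obtain \<kappa> where rcd: "regular_conditional_distribution P ito_space (ito_sample \<mu>) borel s \<kappa>"
    and ito: "AE v in distr P borel s. ito_family (\<kappa> v) v (\<lambda>f x. x f)"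
    using given by (auto simp: ito_measure_given_def)
  have \<kappa>: "\<kappa> v \<in> space (prob_algebra ito_space)" for v
    using rcd by (auto simp: regular_conditional_distribution_def dest!: measurable_space)
  let ?A = "\<lambda>f. {x \<in> space ito_space. Re (x f) \<in> C}"
  have A: "?A f \<in> sets ito_space" if "f \<in> square_integrable" for f
    using that sets(2) by measurable
  have eq: "emeasure P {\<omega> \<in> space P. s \<omega> \<in> B \<and> Re (\<mu> f \<omega>) \<in> C}
      = (\<integral>\<^sup>+ v\<in>B. emeasure (\<kappa> v) (?A f) \<partial>distr P borel s)" if "f \<in> square_integrable" for f
  proof -
    have "{\<omega> \<in> space P. s \<omega> \<in> B \<and> Re (\<mu> f \<omega>) \<in> C} = {\<omega> \<in> space P. ito_sample \<mu> \<omega> \<in> ?A f \<and> s \<omega> \<in> B}"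
      using that by (auto simp: space_PiM)
    moreover have "emeasure P {\<omega> \<in> space P. ito_sample \<mu> \<omega> \<in> ?A f \<and> s \<omega> \<in> B}
        = (\<integral>\<^sup>+ v\<in>B. emeasure (\<kappa> v) (?A f) \<partial>distr P borel s)"
      using rcd A[OF that] sets(1) unfolding regular_conditional_distribution_def by blast
    ultimately show ?thesis by (simp only:)
  qed
  have "(\<integral>\<^sup>+ v\<in>B. emeasure (\<kappa> v) (?A f) \<partial>distr P borel s) = (\<integral>\<^sup>+ v\<in>B. emeasure (\<kappa> v) (?A g) \<partial>distr P borel s)"
  proof (rule nn_integral_cong_AE)
    show "AE v in distr P borel s. emeasure (\<kappa> v) (?A f) * indicator B v = emeasure (\<kappa> v) (?A g) * indicator B v"
      using ito
    proof eventually_elim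
      case (elim v)
      have sK: "sets (\<kappa> v) = sets ito_space" and "prob_space (\<kappa> v)"
        using \<kappa>[of v] by (auto simp: space_prob_algebra)
      then interpret K: prob_space "\<kappa> v" by simp
      have spK: "space (\<kappa> v) = space ito_space" by (rule sets_eq_imp_space_eq[OF sK])
      have cov: "(LINT x|\<kappa> v. x h * cnj (x h)) = of_real v * of_real (LBINT y. (cmod (h y))\<^sup>2)"
        if "h \<in> square_integrable" for h
      proof -
        have "(LINT x|\<kappa> v. x h * cnj (x h)) = v * (LINT y|lborel. h y * cnj (h y))"
          using elim that by (simp add: ito_family_def)
        also have "(LINT y|lborel. h y * cnj (h y)) = of_real (LBINT y. (cmod (h y))\<^sup>2)"
          by (simp only: integral_complex_of_real[symmetric] complex_norm_square)
        finally show ?thesis .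
      qed
      have gauss: "centered_complex_gaussian (\<kappa> v) square_integrable (\<lambda>f x. x f)"
        using elim by (simp add: ito_family_def)
      have "distr (\<kappa> v) borel (\<lambda>x. Re (x f)) = distr (\<kappa> v) borel (\<lambda>x. Re (x g))"
        by (rule K.centered_complex_gaussian_Re_distr_eq[OF gauss fg]) (simp add: cov fg norm)
      then have "emeasure (distr (\<kappa> v) borel (\<lambda>x. Re (x f))) C = emeasure (distr (\<kappa> v) borel (\<lambda>x. Re (x g))) C"
        by simp
      moreover have "emeasure (distr (\<kappa> v) borel (\<lambda>x. Re (x h))) C = emeasure (\<kappa> v) (?A h)" if "h \<in> square_integrable" for h
      proof -
        have [measurable]: "(\<lambda>x. x h) \<in> borel_measurable (\<kappa> v)"
          using gauss that by (simp add: centered_complex_gaussian_def)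
        show ?thesis
          using sets(2) by (subst emeasure_distr) (auto simp: spK vimage_def Int_def conj_commute)
      qed
      ultimately show ?case using fg by simp
    qed
  qed
  then show ?thesis using eq fg by simp
qed

text \<open>Events about \<open>F\<close> of \<open>X\<close> are events about \<open>X\<close>, so independence passes to functions of the two variables.\<close>

lemma indep_var_of_independent_rvs:
  assumes "prob_space P" and ind: "independent_rvs P N X L Y" and X: "X \<in> measurable P N" and Y: "Y \<in> measurable P L"
    and F: "F \<in> measurable N K" and G: "G \<in> measurable L K'"
  shows "prob_space.indep_var P K (\<lambda>\<omega>. F (X \<omega>)) K' (\<lambda>\<omega>. G (Y \<omega>))"
proof -
  interpret prob_space P by fact
  have sub: "sigma_sets (space P) {(\<lambda>\<omega>. F (X \<omega>)) -` A \<inter> space P |A. A \<in> sets K} \<subseteq> sets (vimage_algebra (space P) X N)"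
    if X: "X \<in> measurable P N" and F: "F \<in> measurable N K" for X :: "'a \<Rightarrow> 'x" and F :: "'x \<Rightarrow> 'y" and N K
  proof -
    have "(\<lambda>\<omega>. F (X \<omega>)) -` A \<inter> space P \<in> sets (vimage_algebra (space P) X N)" if "A \<in> sets K" for A
    proof -
      have "(\<lambda>\<omega>. F (X \<omega>)) -` A \<inter> space P = X -` (F -` A \<inter> space N) \<inter> space P"
        using measurable_space[OF X] by auto
      then show ?thesis
        using measurable_sets[OF F that] unfolding sets_vimage_algebra
        by (intro sigma_sets.Basic CollectI exI[of _ "F -` A \<inter> space N"] conjI)
    qed
    then show ?thesis
      using sets.sigma_sets_subset[of "{(\<lambda>\<omega>. F (X \<omega>)) -` A \<inter> space P |A. A \<in> sets K}" "vimage_algebra (space P) X N"]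
      by auto
  qed
  have "indep_set (sigma_sets (space P) {(\<lambda>\<omega>. F (X \<omega>)) -` A \<inter> space P |A. A \<in> sets K})
      (sigma_sets (space P) {(\<lambda>\<omega>. G (Y \<omega>)) -` A \<inter> space P |A. A \<in> sets K'})"
    using ind unfolding independent_rvs_def indep_set_def
    by (rule indep_sets_mono_sets) (use sub[OF X F] sub[OF Y G] in \<open>auto split: bool.splits\<close>)
  then show ?thesis
    using measurable_compose[OF X F] measurable_compose[OF Y G] by (simp add: indep_var_eq)
qed

text \<open>Up to a null set the signal part of \<open>z \<phi>\<close> is a function of the Ito sample, so the noise is independent of it
  and of \<open>s\<close> jointly.\<close>

lemma characteristic_functional_of_observation:
  fixes \<eta> \<xi> z :: "'w \<Rightarrow> tempered"
  assumes P: "prob_space P" and s [measurable]: "s \<in> borel_measurable P"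
    and \<mu>: "\<And>f. f \<in> square_integrable \<Longrightarrow> \<mu> f \<in> borel_measurable P"
    and conv: "random_convolution P \<epsilon> \<mu> \<eta>"
    and f: "tempered_convolution (tempered_reflect \<epsilon>) \<phi> \<in> square_integrable"
    and \<xi> [measurable]: "\<xi> \<in> borel_measurable P"
    and ind: "independent_rvs P borel \<xi> (borel \<Otimes>\<^sub>M ito_space) (\<lambda>\<omega>. (s \<omega>, ito_sample \<mu> \<omega>))"
    and z: "\<And>\<omega>. \<omega> \<in> space P \<Longrightarrow> z \<omega> = \<eta> \<omega> + \<xi> \<omega>" and B [measurable]: "B \<in> sets borel"
  shows "(LINT \<omega>|P. indicator B (s \<omega>) *\<^sub>R cis (re_eval \<phi> (z \<omega>)))
    = (LINT x|distr P borel \<xi>. cis (re_eval \<phi> x))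
      * (LINT \<omega>|P. indicator B (s \<omega>) *\<^sub>R cis (Re (\<mu> (tempered_convolution (tempered_reflect \<epsilon>) \<phi>) \<omega>)))"
proof -
  interpret prob_space P by fact
  let ?f = "tempered_convolution (tempered_reflect \<epsilon>) \<phi>"
  have \<eta> [measurable]: "\<eta> \<in> borel_measurable P" and AE: "AE \<omega> in P. tempered_apply (\<eta> \<omega>) \<phi> = \<mu> ?f \<omega>"
    using conv by (auto simp: random_convolution_def)
  have [measurable]: "\<mu> ?f \<in> borel_measurable P" by (rule \<mu>[OF f])
  have [measurable]: "(\<lambda>\<omega>. ito_sample \<mu> \<omega>) \<in> measurable P ito_space"
    by (rule measurable_restrict) (rule \<mu>)
  have pair: "(\<lambda>\<omega>. (s \<omega>, ito_sample \<mu> \<omega>)) \<in> measurable P (borel \<Otimes>\<^sub>M ito_space)" by measurable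
  have [measurable]: "(\<lambda>x. x ?f) \<in> borel_measurable ito_space"
    by (rule measurable_component_singleton[OF f])
  \<comment> \<open>the signal part, as a function of the pair of \<open>s\<close> and the Ito sample\<close>
  let ?G = "\<lambda>p. indicator B (fst p) *\<^sub>R cis (Re (snd p ?f))"
  let ?S = "\<lambda>\<omega>. ?G (s \<omega>, ito_sample \<mu> \<omega>)" and ?N = "\<lambda>\<omega>. cis (re_eval \<phi> (\<xi> \<omega>))"
  have G: "?G \<in> borel_measurable (borel \<Otimes>\<^sub>M ito_space)" by measurable
  have z_meas [measurable]: "z \<in> borel_measurable P"
    by (subst measurable_cong[OF z]) measurable
  have "(LINT \<omega>|P. indicator B (s \<omega>) *\<^sub>R cis (re_eval \<phi> (z \<omega>)))
    = (LINT \<omega>|P. ?N \<omega> * ?S \<omega>)"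
  proof (rule integral_cong_AE)
    show "AE \<omega> in P. indicator B (s \<omega>) *\<^sub>R cis (re_eval \<phi> (z \<omega>))
        = ?N \<omega> * ?S \<omega>"
      using AE AE_space
    proof eventually_elim
      case (elim \<omega>)
      have "cis (re_eval \<phi> (z \<omega>)) = ?N \<omega> * cis (Re (\<mu> ?f \<omega>))"
        using elim z by (simp add: plus_tempered.rep_eq cis_mult add.commute)
      then show ?case using f by simp
    qed
    show "(\<lambda>\<omega>. ?N \<omega> * ?S \<omega>) \<in> borel_measurable P"
      using measurable_compose[OF pair G] by measurable
  qed measurable
  also have "\<dots> = (LINT \<omega>|P. ?N \<omega>) * (LINT \<omega>|P. ?S \<omega>)"
  proof (rule indep_var_lebesgue_integral)
    show "indep_var borel (\<lambda>\<omega>. ?N \<omega>) borel (\<lambda>\<omega>. ?S \<omega>)"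
      by (rule indep_var_of_independent_rvs[OF P ind \<xi> pair _ G]) measurable
    show "integrable P (\<lambda>\<omega>. ?S \<omega>)"
      using measurable_compose[OF pair G] by (intro integrable_const_bound[of _ 1]) (auto simp: indicator_def)
    show "integrable P (\<lambda>\<omega>. ?N \<omega>)"
      by (intro integrable_const_bound[of _ 1]) auto
  qed
  also have "(LINT \<omega>|P. ?N \<omega>) = (LINT x|distr P borel \<xi>. cis (re_eval \<phi> x))"
    by (subst integral_distr) auto
  also have "(LINT \<omega>|P. ?S \<omega>) = (LINT \<omega>|P. indicator B (s \<omega>) *\<^sub>R cis (Re (\<mu> ?f \<omega>)))"
    using f by simp
  finally show ?thesis .
qed

text \<open>Distribution functions are right continuous, so rational arguments determine them. This lets an
  almost sure statement about distributions be proved one argument at a time.\<close>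

lemma real_distribution_eqI_rat:
  assumes M: "real_distribution M1" "real_distribution M2"
    and eq: "\<And>q. cdf M1 (of_rat q) = cdf M2 (of_rat q)"
  shows "M1 = M2"
proof (rule cdf_unique[OF M], rule ext, rule antisym)
  have le: "cdf M x \<le> cdf N x" if M: "real_distribution M" and N: "real_distribution N"
    and eq: "\<And>q. cdf M (of_rat q) = cdf N (of_rat q)" for M N x
  proof (rule field_le_epsilon)
    fix e :: real assume "e > 0"
    interpret M: real_distribution M by fact
    interpret N: real_distribution N by fact
    have "(cdf N \<longlongrightarrow> cdf N x) (at_right x)"
      using N.cdf_is_right_cont[of x] by (simp add: continuous_within)
    then have "\<forall>\<^sub>F y in at_right x. cdf N y < cdf N x + e"
      using \<open>e > 0\<close> by (intro order_tendstoD) auto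
    then obtain b where b: "b > x" "\<And>y. x < y \<Longrightarrow> y < b \<Longrightarrow> cdf N y < cdf N x + e"
      by (auto simp: eventually_at_right_field)
    obtain q where q: "x < of_rat q" "of_rat q < b" using of_rat_dense[OF b(1)] by blast
    have "cdf M x \<le> cdf M (of_rat q)" using q by (intro M.cdf_nondecreasing) auto
    also have "\<dots> = cdf N (of_rat q)" by (rule eq)
    also have "\<dots> < cdf N x + e" by (rule b(2)[OF q])
    finally show "cdf M x \<le> cdf N x + e" by simp
  qed
  show "cdf M1 x \<le> cdf M2 x" "cdf M2 x \<le> cdf M1 x" for x
    using le[OF M eq] le[OF M(2,1) eq[symmetric]] by auto
qed

text \<open>For a fixed set \<open>A\<close>, both \<open>\<nu>1 y A\<close> and \<open>\<nu>2 y A\<close> are densities of the measure that sends \<open>B\<close> to the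
  probability of \<open>s \<in> A\<close> and \<open>Y1 \<in> B\<close>, hence almost everywhere equal. Countably many sets \<open>A\<close> determine a distribution
  on the real line.\<close>

lemma regular_conditional_distribution_unique:
  fixes \<nu>1 \<nu>2 :: "'b \<Rightarrow> real measure"
  assumes P: "prob_space P" and Y: "Y1 \<in> measurable P L" "Y2 \<in> measurable P L"
    and rcd: "regular_conditional_distribution P borel s L Y1 \<nu>1" "regular_conditional_distribution P borel s L Y2 \<nu>2"
    and joint: "\<And>A B. A \<in> sets borel \<Longrightarrow> B \<in> sets L \<Longrightarrow>
      emeasure P {\<omega> \<in> space P. s \<omega> \<in> A \<and> Y1 \<omega> \<in> B} = emeasure P {\<omega> \<in> space P. s \<omega> \<in> A \<and> Y2 \<omega> \<in> B}"
  shows "distr P L Y1 = distr P L Y2" and "AE y in distr P L Y1. \<nu>1 y = \<nu>2 y"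
proof -
  interpret prob_space P by fact
  show distr: "distr P L Y1 = distr P L Y2"
  proof (rule measure_eqI)
    fix B assume "B \<in> sets (distr P L Y1)"
    then show "emeasure (distr P L Y1) B = emeasure (distr P L Y2) B"
      using joint[of UNIV B] Y by (simp add: emeasure_distr vimage_def Int_def conj_commute)
  qed simp
  let ?D = "distr P L Y1"
  let ?d = "\<lambda>\<nu> A. density ?D (\<lambda>y. emeasure (\<nu> y) A)"
  interpret D: prob_space ?D by (rule prob_space_distr[OF Y(1)])
  have kernel: "\<nu>1 \<in> measurable L (prob_algebra borel)" "\<nu>2 \<in> measurable L (prob_algebra borel)"
    using rcd by (auto simp: regular_conditional_distribution_def)
  have meas: "(\<lambda>y. emeasure (\<nu> y) A) \<in> borel_measurable ?D" if "\<nu> \<in> measurable L (prob_algebra borel)" "A \<in> sets borel"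
    for \<nu> :: "'b \<Rightarrow> real measure" and A
    using measurable_emeasure_kernel[OF measurable_prob_algebraD[OF that(1)] that(2)] by simp
  have AE1: "AE y in ?D. emeasure (\<nu>1 y) A = emeasure (\<nu>2 y) A" if A: "A \<in> sets borel" for A
  proof (rule D.density_unique)
    show "?d \<nu>1 A = ?d \<nu>2 A"
    proof (rule measure_eqI)
      fix B assume "B \<in> sets (?d \<nu>1 A)"
      then have B: "B \<in> sets L" by simp
      have "(\<integral>\<^sup>+ y\<in>B. emeasure (\<nu>1 y) A \<partial>?D) = emeasure P {\<omega> \<in> space P. s \<omega> \<in> A \<and> Y1 \<omega> \<in> B}"
        using rcd(1) A B unfolding regular_conditional_distribution_def by simp
      also note joint[OF A B]
      also have "emeasure P {\<omega> \<in> space P. s \<omega> \<in> A \<and> Y2 \<omega> \<in> B} = (\<integral>\<^sup>+ y\<in>B. emeasure (\<nu>2 y) A \<partial>?D)"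
        using rcd(2) A B unfolding regular_conditional_distribution_def distr by blast
      finally have "(\<integral>\<^sup>+ y\<in>B. emeasure (\<nu>1 y) A \<partial>?D) = (\<integral>\<^sup>+ y\<in>B. emeasure (\<nu>2 y) A \<partial>?D)" .
      then show "emeasure (?d \<nu>1 A) B = emeasure (?d \<nu>2 A) B"
        using B meas kernel A by (simp add: emeasure_density)
    qed simp
  qed (use meas kernel A in auto)
  have "AE y in ?D. \<forall>q::rat. emeasure (\<nu>1 y) {..of_rat q} = emeasure (\<nu>2 y) {..of_rat q}"
    unfolding AE_all_countable by (intro allI AE1) simp
  with AE_space show "AE y in ?D. \<nu>1 y = \<nu>2 y"
  proof eventually_elim
    case (elim y)
    then have "\<nu>1 y \<in> space (prob_algebra borel)" "\<nu>2 y \<in> space (prob_algebra borel)"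
      using kernel by (auto dest: measurable_space)
    then have p: "prob_space (\<nu>1 y)" "prob_space (\<nu>2 y)" and sets: "sets (\<nu>1 y) = sets borel" "sets (\<nu>2 y) = sets borel"
      by (auto simp: space_prob_algebra)
    then have dist: "real_distribution (\<nu>1 y)" "real_distribution (\<nu>2 y)"
      using sets_eq_imp_space_eq[OF sets(1)] sets_eq_imp_space_eq[OF sets(2)]
      by (auto simp: real_distribution_def real_distribution_axioms_def)
    show ?case
    proof (rule real_distribution_eqI_rat[OF dist])
      show "cdf (\<nu>1 y) (of_rat q) = cdf (\<nu>2 y) (of_rat q)" for q
        using elim by (simp add: cdf_def measure_def)
    qed
  qed
qed

text \<open>The sub-probability law of \<open>X\<close> on the event \<open>E\<close>. For \<open>E\<close> of the form \<open>s \<in> A\<close> these measures describe the joint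
  law of \<open>s\<close> and \<open>X\<close> on rectangles.\<close>

definition restricted_law :: "'w measure \<Rightarrow> 'w set \<Rightarrow> 'a measure \<Rightarrow> ('w \<Rightarrow> 'a) \<Rightarrow> 'a measure" where
  "restricted_law P E N X = distr (density P (\<lambda>\<omega>. ennreal (indicator E \<omega>))) N X"

lemma sets_restricted_law [simp, measurable_cong]: "sets (restricted_law P E N X) = sets N"
  by (simp add: restricted_law_def)

lemma emeasure_restricted_law:
  assumes [measurable]: "X \<in> measurable P N" "E \<in> sets P" "C \<in> sets N"
  shows "emeasure (restricted_law P E N X) C = emeasure P {\<omega> \<in> space P. \<omega> \<in> E \<and> X \<omega> \<in> C}"
proof -
  have "emeasure (restricted_law P E N X) C = (\<integral>\<^sup>+ \<omega>. ennreal (indicator E \<omega>) * indicator (X -` C \<inter> space P) \<omega> \<partial>P)"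
    unfolding restricted_law_def by (subst emeasure_distr) (auto simp: emeasure_density)
  also have "\<dots> = (\<integral>\<^sup>+ \<omega>. indicator {\<omega> \<in> space P. \<omega> \<in> E \<and> X \<omega> \<in> C} \<omega> \<partial>P)"
    by (intro nn_integral_cong) (auto simp: indicator_def)
  also have "\<dots> = emeasure P {\<omega> \<in> space P. \<omega> \<in> E \<and> X \<omega> \<in> C}"
    by (rule nn_integral_indicator) measurable
  finally show ?thesis .
qed

lemma integral_restricted_law:
  fixes F :: "'a \<Rightarrow> complex"
  assumes [measurable]: "X \<in> measurable P N" "E \<in> sets P" "F \<in> borel_measurable N"
  shows "(LINT x|restricted_law P E N X. F x) = (LINT \<omega>|P. indicator E \<omega> *\<^sub>R F (X \<omega>))"
  unfolding restricted_law_def by (subst integral_distr) (auto simp: integral_density)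

lemma finite_measure_restricted_law:
  assumes "prob_space P" and [measurable]: "X \<in> measurable P N" "E \<in> sets P"
  shows "finite_measure (restricted_law P E N X)"
proof -
  interpret prob_space P by fact
  show ?thesis
  proof (rule finite_measureI)
    have "emeasure (restricted_law P E N X) (space (restricted_law P E N X)) = emeasure P {\<omega> \<in> space P. \<omega> \<in> E \<and> X \<omega> \<in> space N}"
      using emeasure_restricted_law[of X P N E "space N"] by (simp add: restricted_law_def)
    then show "emeasure (restricted_law P E N X) (space (restricted_law P E N X)) \<noteq> \<infinity>"
      by (simp add: emeasure_eq_measure)
  qed
qed

text \<open>The real parts of the evaluations form a real vector space, because evaluation is linear in the test function,
  and they generate the Borel sets.\<close>

lemma tempered_measure_eqI:
  fixes M N :: "tempered measure"
  assumes "finite_measure M" "finite_measure N" "sets M = sets borel" "sets N = sets borel"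
    and eq: "\<And>\<phi>. (LINT T|M. cis (re_eval \<phi> T)) = (LINT T|N. cis (re_eval \<phi> T))"
  shows "M = N"
proof (rule finite_measure_eqI_characteristic_functional[where V = "range re_eval"])
  have "space N = UNIV" using assms(4)[THEN sets_eq_imp_space_eq] by simp
  then show "sets N = sigma_sets (space N) {f -` C \<inter> space N |f C. f \<in> range re_eval \<and> C \<in> sets borel}"
    unfolding assms(4) sets_borel_tempered by simp
  show "(\<lambda>T. f T + t * g T) \<in> range re_eval"
    if f: "f \<in> range re_eval" and g: "g \<in> range re_eval" for f g t
  proof -
    obtain \<phi> \<psi> where "f = (re_eval \<phi>)" "g = (\<lambda>T. Re (tempered_apply T \<psi>))"
      using f g by blast
    then have "(\<lambda>T. f T + t * g T) = (\<lambda>T. Re (tempered_apply T (\<phi> + schwartz_scale (of_real t) \<psi>)))"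
      by (simp add: tempered_apply_add tempered_apply_scale)
    then show ?thesis by blast
  qed
  have "(\<lambda>_. 0) = (\<lambda>T. Re (tempered_apply T 0))" by (simp add: tempered_apply_zero)
  then show "(\<lambda>_. 0) \<in> range re_eval" by blast
  show "(LINT x|M. cis (f x)) = (LINT x|N. cis (f x))" if "f \<in> range re_eval" for f
    using that eq by auto
qed (use assms in simp_all)

theorem theorem3p3:
  fixes P :: "'w measure" and s :: "'w \<Rightarrow> real" and prior :: "real measure"
    and \<mu> :: "(real \<Rightarrow> complex) \<Rightarrow> 'w \<Rightarrow> complex"
    and \<epsilon>1 \<epsilon>2 :: tempered
    and \<eta>1 \<eta>2 \<xi>1 \<xi>2 z1 z2 :: "'w \<Rightarrow> tempered"
    and \<nu>1 \<nu>2 :: "tempered \<Rightarrow> real measure"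
  assumes "prob_space P"
    and "s \<in> borel_measurable P" "\<And>\<omega>. \<omega> \<in> space P \<Longrightarrow> s \<omega> > 0" "distr P borel s = prior"
    and "ito_measure_given P s \<mu>"
    and "admissible \<epsilon>1" "admissible \<epsilon>2"
    and "random_convolution P \<epsilon>1 \<mu> \<eta>1" "random_convolution P \<epsilon>2 \<mu> \<eta>2"
    and "complex_gaussian_object P \<xi>1" "complex_gaussian_object P \<xi>2"
    and "distr P borel \<xi>1 = distr P borel \<xi>2"
    and "independent_rvs P borel \<xi>1 (borel \<Otimes>\<^sub>M ito_space) (\<lambda>\<omega>. (s \<omega>, ito_sample \<mu> \<omega>))"
    and "independent_rvs P borel \<xi>2 (borel \<Otimes>\<^sub>M ito_space) (\<lambda>\<omega>. (s \<omega>, ito_sample \<mu> \<omega>))"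
    and "\<And>\<omega>. \<omega> \<in> space P \<Longrightarrow> z1 \<omega> = \<eta>1 \<omega> + \<xi>1 \<omega>" "\<And>\<omega>. \<omega> \<in> space P \<Longrightarrow> z2 \<omega> = \<eta>2 \<omega> + \<xi>2 \<omega>"
    and "equal_as_distributions (\<lambda>x. cmod (fourier_function \<epsilon>1 x)) (\<lambda>x. cmod (fourier_function \<epsilon>2 x))"
    and "regular_conditional_distribution P borel s borel z1 \<nu>1"
    and "regular_conditional_distribution P borel s borel z2 \<nu>2"
  shows "(AE y in distr P borel z1. posterior_variance (\<nu>1 y) = posterior_variance (\<nu>2 y)) \<and>
         (AE y in distr P borel z2. posterior_variance (\<nu>1 y) = posterior_variance (\<nu>2 y))"
proof -
  note P = assms(1) and s [measurable] = assms(2) and given = assms(5) and adm = assms(6,7) and conv = assms(8,9)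
    and \<xi>_distr = assms(12) and ind = assms(13,14) and z = assms(15,16) and mod = assms(17) and rcd = assms(18,19)
  interpret prob_space P by (rule P)
  have \<xi> [measurable]: "\<xi>1 \<in> borel_measurable P" "\<xi>2 \<in> borel_measurable P"
    using assms(10,11) by (auto simp: complex_gaussian_object_def)
  have [measurable]: "\<eta>1 \<in> borel_measurable P" "\<eta>2 \<in> borel_measurable P"
    using conv by (auto simp: random_convolution_def)
  have z_meas [measurable]: "z1 \<in> borel_measurable P" "z2 \<in> borel_measurable P"
    by (subst measurable_cong[OF z(1)], measurable) (subst measurable_cong[OF z(2)], measurable)
  have \<mu>: "\<mu> f \<in> borel_measurable P" if "f \<in> square_integrable" for f
    using given that by (auto simp: ito_measure_given_def)
  \<comment> \<open>the joint laws of \<open>s\<close> with the two observations agree, compared through one test function at a time\<close>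
  have law: "restricted_law P (s -` A \<inter> space P) borel z1 = restricted_law P (s -` A \<inter> space P) borel z2"
    if [measurable]: "A \<in> sets borel" for A
  proof (rule tempered_measure_eqI)
    let ?E = "s -` A \<inter> space P"
    have E [measurable]: "?E \<in> sets P" by measurable
    show "finite_measure (restricted_law P ?E borel z1)" "finite_measure (restricted_law P ?E borel z2)"
      by (intro finite_measure_restricted_law P z_meas E)+
    fix \<phi>
    let ?f = "\<lambda>\<epsilon>. tempered_convolution (tempered_reflect \<epsilon>) \<phi>"
    let ?R = "\<lambda>\<epsilon>. restricted_law P ?E borel (\<lambda>\<omega>. Re (\<mu> (?f \<epsilon>) \<omega>))"
    let ?i = "\<lambda>\<epsilon>. LINT \<omega>|P. indicator A (s \<omega>) *\<^sub>R cis (Re (\<mu> (?f \<epsilon>) \<omega>))"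
    have f: "?f \<epsilon>1 \<in> square_integrable" "?f \<epsilon>2 \<in> square_integrable"
      by (intro tempered_convolution_square_integrable adm)+
    note [measurable] = \<mu>[OF f(1)] \<mu>[OF f(2)]
    have ind_E: "(LINT \<omega>|P. indicator ?E \<omega> *\<^sub>R F \<omega>) = (LINT \<omega>|P. indicator A (s \<omega>) *\<^sub>R F \<omega>)" for F :: "'w \<Rightarrow> complex"
      by (intro Bochner_Integration.integral_cong) (auto simp: indicator_def)
    have "?R \<epsilon>1 = ?R \<epsilon>2"
    proof (rule measure_eqI)
      fix C assume "C \<in> sets (?R \<epsilon>1)"
      then have C [measurable]: "C \<in> sets borel" by simp
      have "emeasure (?R \<epsilon>) C = emeasure P {\<omega> \<in> space P. s \<omega> \<in> A \<and> Re (\<mu> (?f \<epsilon>) \<omega>) \<in> C}"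
        if "(\<lambda>\<omega>. Re (\<mu> (?f \<epsilon>) \<omega>)) \<in> borel_measurable P" for \<epsilon>
        by (subst emeasure_restricted_law[OF that E C]) (auto intro!: arg_cong[where f = "emeasure P"])
      then show "emeasure (?R \<epsilon>1) C
          = emeasure (?R \<epsilon>2) C"
        using ito_measure_given_Re_law_eq[OF P given f tempered_convolution_norm_eq[OF adm mod] that C] by simp
    qed simp
    then have "(LINT x|?R \<epsilon>1. cis x)
        = (LINT x|?R \<epsilon>2. cis x)"
      by simp
    then have \<mu>_eq: "?i \<epsilon>1
        = ?i \<epsilon>2"
      by (simp add: integral_restricted_law ind_E)
    have integral_law: "(LINT T|restricted_law P ?E borel z. cis (re_eval \<phi> T))
        = (LINT \<omega>|P. indicator A (s \<omega>) *\<^sub>R cis (re_eval \<phi> (z \<omega>)))" if "z \<in> borel_measurable P" for z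
      unfolding ind_E[symmetric] by (rule integral_restricted_law[OF that E]) measurable
    have "(LINT T|restricted_law P ?E borel z1. cis (re_eval \<phi> T))
        = (LINT x|distr P borel \<xi>1. cis (re_eval \<phi> x))
          * ?i \<epsilon>1"
      unfolding integral_law[OF z_meas(1)]
      by (rule characteristic_functional_of_observation[OF P s \<mu> conv(1) f(1) \<xi>(1) ind(1) z(1) that])
    also have "\<dots> = (LINT x|distr P borel \<xi>2. cis (re_eval \<phi> x))
          * ?i \<epsilon>2"
      unfolding \<xi>_distr \<mu>_eq ..
    also have "\<dots> = (LINT T|restricted_law P ?E borel z2. cis (re_eval \<phi> T))"
      unfolding integral_law[OF z_meas(2)]
      by (rule characteristic_functional_of_observation[OF P s \<mu> conv(2) f(2) \<xi>(2) ind(2) z(2) that, symmetric])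
    finally show "(LINT T|restricted_law P ?E borel z1. cis (re_eval \<phi> T))
        = (LINT T|restricted_law P ?E borel z2. cis (re_eval \<phi> T))" .
  qed simp_all
  have joint: "emeasure P {\<omega> \<in> space P. s \<omega> \<in> A \<and> z1 \<omega> \<in> B} = emeasure P {\<omega> \<in> space P. s \<omega> \<in> A \<and> z2 \<omega> \<in> B}"
    if A [measurable]: "A \<in> sets borel" and B: "B \<in> sets borel" for A B
  proof -
    have E: "s -` A \<inter> space P \<in> sets P" by measurable
    have law_B: "emeasure (restricted_law P (s -` A \<inter> space P) borel z) B = emeasure P {\<omega> \<in> space P. s \<omega> \<in> A \<and> z \<omega> \<in> B}"
      if "z \<in> borel_measurable P" for z
      by (subst emeasure_restricted_law[OF that E B]) (auto intro!: arg_cong[where f = "emeasure P"])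
    then show ?thesis using law_B[OF z_meas(1)] law_B[OF z_meas(2)] law[OF A] by (simp only:)
  qed
  have distr_eq: "distr P borel z1 = distr P borel z2"
    by (rule regular_conditional_distribution_unique(1)[OF P z_meas rcd]) (rule joint)
  have "AE y in distr P borel z1. \<nu>1 y = \<nu>2 y"
    by (rule regular_conditional_distribution_unique(2)[OF P z_meas rcd]) (rule joint)
  then have "AE y in distr P borel z1. posterior_variance (\<nu>1 y) = posterior_variance (\<nu>2 y)"
    by eventually_elim simp
  then show ?thesis unfolding distr_eq by simp
qed

end
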